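(* Let $X$ be a locally compact Hausdorff space. The symmetric monoidal category $\mathbf{Hilb}_{C_0(X)}$ of Hilbert $C_0(X)$-modules and nonexpansive $C_0(X)$-linear maps is firm, and its subunits are (represented by the inclusions into $C_0(X)$ of) $$\{ f \in C_0(X) \mid f(X \setminus U) = 0 \} \simeq C_0(U)$$ for open subsets $U \subseteq X$.
   Context: $C_0(X)$ is the commutative C*-algebra of continuous functions $X \to \mathbb{C}$ vanishing at infinity. A Hilbert $C_0(X)$-module is a $C_0(X)$-module $A$ with a map $\langle - \mid - \rangle \colon A \times A \to C_0(X)$ that is $C_0(X)$-linear in the second variable, satisfies $\langle a \mid b\rangle = \langle b \mid a \rangle^*$ and $\langle a \mid a \rangle \ge 0$ with equality only if $a=0$, and makes $A$ complete in the norm $\|a\|_A^2 = \sup_{x \in X} \langle a \mid a \rangle(x)$. A function $f \colon A \to B$ is bounded when $\|f(a)\|_B \le C\|a\|_A$ for some constant $C$ and all $a$; the infimum of such $C$ is $\|f\|$; $f$ is nonexpansive when $\|f\| \le 1$. The tensor product $A \otimes B$ is the completion of the algebraic tensor product of $C_0(X)$-modules to a Hilbert module with inner product $\langle a \otimes b \mid a' \otimes b'\rangle = \langle a \mid a'\rangle \langle b \mid b'\rangle$. The tensor unit is $C_0(X)$ with $\langle f \mid g\rangle(x) = f(x)^* g(x)$; the displayed ideals carry the restricted inner product. In a braided monoidal category with tensor unit $I$, a subunit is a subobject $s \colon S \rightarrowtail I$ (equivalence class of monomorphisms, identified when they factor through each other) such that $s \otimes \mathrm{id}_S \colon S \otimes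 S \to I \otimes S$ is an isomorphism. The category is firm when $s \otimes \mathrm{id}_T \colon S \otimes T \to I \otimes T$ is a monomorphism for all subunits $s \colon S \rightarrowtail I$, $t\colon T \rightarrowtail I$. *)

theory Defs
  imports "HOL-Analysis.Analysis" "HOL-Algebra.Module"
begin

section \<open>Subunits and firmness\<close>

text \<open>
  The part of a braided monoidal category that enters the notions of subunit and firmness;
  the coherence isomorphisms do not occur in them.  Hom-sets of different pairs of objects need not
  be disjoint, so the operations on arrows carry the objects as arguments:
  \<open>Comp C A B D g f\<close> is \<open>g \<circ> f\<close> for \<open>f : A \<rightarrow> B\<close>, \<open>g : B \<rightarrow> D\<close>, and
  \<open>TensorArr C A A' B B' f g\<close> is \<open>f \<otimes> g\<close> for \<open>f : A \<rightarrow> A'\<close>, \<open>g : B \<rightarrow> B'\<close>.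
\<close>

record ('o, 'm) monoidal_data =
  Ob :: "'o set"
  Hom :: "'o \<Rightarrow> 'o \<Rightarrow> 'm set"
  Id :: "'o \<Rightarrow> 'm"
  Comp :: "'o \<Rightarrow> 'o \<Rightarrow> 'o \<Rightarrow> 'm \<Rightarrow> 'm \<Rightarrow> 'm"
  Unit :: "'o"
  TensorOb :: "'o \<Rightarrow> 'o \<Rightarrow> 'o"
  TensorArr :: "'o \<Rightarrow> 'o \<Rightarrow> 'o \<Rightarrow> 'o \<Rightarrow> 'm \<Rightarrow> 'm \<Rightarrow> 'm"

definition mono_arr :: "('o, 'm) monoidal_data \<Rightarrow> 'o \<Rightarrow> 'o \<Rightarrow> 'm \<Rightarrow> bool" where
  "mono_arr C A B f \<longleftrightarrow> A \<in> Ob C \<and> B \<in> Ob C \<and> f \<in> Hom C A B \<and>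
     (\<forall>W \<in> Ob C. \<forall>g \<in> Hom C W A. \<forall>h \<in> Hom C W A.
        Comp C W A B f g = Comp C W A B f h \<longrightarrow> g = h)"

definition iso_arr :: "('o, 'm) monoidal_data \<Rightarrow> 'o \<Rightarrow> 'o \<Rightarrow> 'm \<Rightarrow> bool" where
  "iso_arr C A B f \<longleftrightarrow> A \<in> Ob C \<and> B \<in> Ob C \<and> f \<in> Hom C A B \<and>
     (\<exists>g \<in> Hom C B A. Comp C A B A g f = Id C A \<and> Comp C B A B f g = Id C B)"

definition factors_through ::
    "('o, 'm) monoidal_data \<Rightarrow> 'o \<Rightarrow> 'o \<Rightarrow> 'm \<Rightarrow> 'o \<Rightarrow> 'm \<Rightarrow> bool" where
  "factors_through C B S s T t \<longleftrightarrow> (\<exists>m \<in> Hom C S T. s = Comp C S T B t m)"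

definition subobject_class ::
    "('o, 'm) monoidal_data \<Rightarrow> 'o \<Rightarrow> 'o \<Rightarrow> 'm \<Rightarrow> ('o \<times> 'm) set" where
  "subobject_class C B S s = {(T, t). mono_arr C T B t \<and>
     factors_through C B S s T t \<and> factors_through C B T t S s}"

text \<open>A monomorphism that represents a subunit.\<close>

definition represents_subunit :: "('o, 'm) monoidal_data \<Rightarrow> 'o \<Rightarrow> 'm \<Rightarrow> bool" where
  "represents_subunit C S s \<longleftrightarrow> mono_arr C S (Unit C) s \<and>
     iso_arr C (TensorOb C S S) (TensorOb C (Unit C) S)
       (TensorArr C S (Unit C) S S s (Id C S))"

definition subunits :: "('o, 'm) monoidal_data \<Rightarrow> ('o \<times> 'm) set set" where
  "subunits C = {subobject_class C (Unit C) S s | S s. represents_subunit C S s}"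

definition firm :: "('o, 'm) monoidal_data \<Rightarrow> bool" where
  "firm C \<longleftrightarrow> (\<forall>S s T t. represents_subunit C S s \<and> represents_subunit C T t \<longrightarrow>
     mono_arr C (TensorOb C S T) (TensorOb C (Unit C) T)
       (TensorArr C S (Unit C) T T s (Id C T)))"


section \<open>Hilbert modules over \<open>C\<^sub>0(X)\<close>\<close>

text \<open>
  Functions on the space \<open>X\<close> are total functions on the type \<open>'x\<close> that take the
  value 0 outside \<open>topspace X\<close>.
\<close>

definition C0 :: "'x topology \<Rightarrow> ('x \<Rightarrow> complex) set" where
  "C0 X = {f. continuous_map X euclidean f \<and>
              (\<forall>e>0. compactin X {x \<in> topspace X. e \<le> norm (f x)}) \<and>
              (\<forall>x. x \<notin> topspace X \<longrightarrow> f x = 0)}"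

text \<open>
  The \<open>smult\<close> inherited from \<open>HOL-Algebra\<close> is the action of \<open>C\<^sub>0(X)\<close>; as there, the
  fields \<open>mult\<close> and \<open>one\<close> play no role.  The library's module locale is not
  applicable because \<open>C\<^sub>0(X)\<close> has no unit unless \<open>X\<close> is compact.
\<close>

record ('x, 'a) hmodule = "('x \<Rightarrow> complex, 'a) module" +
  cscale :: "complex \<Rightarrow> 'a \<Rightarrow> 'a"
  ip :: "'a \<Rightarrow> 'a \<Rightarrow> 'x \<Rightarrow> complex"

text \<open>
  A module over the complex algebra \<open>C\<^sub>0(X)\<close>: a complex vector space with a bilinear,
  associative action.
\<close>

locale C0_module = abelian_group A
  for X :: "'x topology" and A :: "('x, 'a) hmodule" (structure) +
  assumes act_closed: "\<lbrakk>f \<in> C0 X; a \<in> carrier A\<rbrakk> \<Longrightarrow> f \<odot> a \<in> carrier A"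
    and act_add_right: "\<lbrakk>f \<in> C0 X; a \<in> carrier A; b \<in> carrier A\<rbrakk>
          \<Longrightarrow> f \<odot> (a \<oplus> b) = f \<odot> a \<oplus> f \<odot> b"
    and act_add_left: "\<lbrakk>f \<in> C0 X; g \<in> C0 X; a \<in> carrier A\<rbrakk>
          \<Longrightarrow> (\<lambda>x. f x + g x) \<odot> a = f \<odot> a \<oplus> g \<odot> a"
    and act_assoc: "\<lbrakk>f \<in> C0 X; g \<in> C0 X; a \<in> carrier A\<rbrakk>
          \<Longrightarrow> (\<lambda>x. f x * g x) \<odot> a = f \<odot> (g \<odot> a)"
    and cscale_closed: "a \<in> carrier A \<Longrightarrow> cscale A z a \<in> carrier A"
    and cscale_add_right: "\<lbrakk>a \<in> carrier A; b \<in> carrier A\<rbrakk>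
          \<Longrightarrow> cscale A z (a \<oplus> b) = cscale A z a \<oplus> cscale A z b"
    and cscale_add_left: "a \<in> carrier A \<Longrightarrow> cscale A (z + w) a = cscale A z a \<oplus> cscale A w a"
    and cscale_assoc: "a \<in> carrier A \<Longrightarrow> cscale A (z * w) a = cscale A z (cscale A w a)"
    and cscale_one: "a \<in> carrier A \<Longrightarrow> cscale A 1 a = a"
    and act_cscale_left: "\<lbrakk>f \<in> C0 X; a \<in> carrier A\<rbrakk>
          \<Longrightarrow> (\<lambda>x. z * f x) \<odot> a = cscale A z (f \<odot> a)"
    and act_cscale_right: "\<lbrakk>f \<in> C0 X; a \<in> carrier A\<rbrakk>
          \<Longrightarrow> f \<odot> cscale A z a = cscale A z (f \<odot> a)"

text \<open>
  The supremum over \<open>X\<close> of a nonnegative function; inserting 0 only matters for empty \<open>X\<close>.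
\<close>

definition sup_Re :: "'x topology \<Rightarrow> ('x \<Rightarrow> complex) \<Rightarrow> real" where
  "sup_Re X h = Sup (insert 0 ((\<lambda>x. Re (h x)) ` topspace X))"

definition hnorm :: "'x topology \<Rightarrow> ('x, 'a) hmodule \<Rightarrow> 'a \<Rightarrow> real" where
  "hnorm X A a = sqrt (sup_Re X (ip A a a))"

locale hilbert_C0_module = C0_module X A
  for X :: "'x topology" and A :: "('x, 'a) hmodule" (structure) +
  assumes ip_closed: "\<lbrakk>a \<in> carrier A; b \<in> carrier A\<rbrakk> \<Longrightarrow> ip A a b \<in> C0 X"
    and ip_add_right: "\<lbrakk>a \<in> carrier A; b \<in> carrier A; c \<in> carrier A\<rbrakk>
          \<Longrightarrow> ip A a (b \<oplus> c) = (\<lambda>x. ip A a b x + ip A a c x)"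
    and ip_cscale_right: "\<lbrakk>a \<in> carrier A; b \<in> carrier A\<rbrakk>
          \<Longrightarrow> ip A a (cscale A z b) = (\<lambda>x. z * ip A a b x)"
    and ip_act_right: "\<lbrakk>a \<in> carrier A; b \<in> carrier A; f \<in> C0 X\<rbrakk>
          \<Longrightarrow> ip A a (f \<odot> b) = (\<lambda>x. f x * ip A a b x)"
    and ip_commute: "\<lbrakk>a \<in> carrier A; b \<in> carrier A\<rbrakk>
          \<Longrightarrow> ip A a b = (\<lambda>x. cnj (ip A b a x))"
    and ip_nonneg: "a \<in> carrier A \<Longrightarrow> ip A a a x \<in> \<real>\<^sub>\<ge>\<^sub>0"
    and ip_eq_zero: "\<lbrakk>a \<in> carrier A; ip A a a = (\<lambda>x. 0)\<rbrakk> \<Longrightarrow> a = \<zero>"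
    and complete: "\<lbrakk>\<forall>n. s n \<in> carrier A;
            \<forall>e>0. \<exists>N. \<forall>m\<ge>N. \<forall>n\<ge>N. hnorm X A (s m \<ominus> s n) < e\<rbrakk>
          \<Longrightarrow> \<exists>a \<in> carrier A. (\<lambda>n. hnorm X A (s n \<ominus> a)) \<longlonglongrightarrow> 0"

definition C0_linear ::
    "'x topology \<Rightarrow> ('x, 'a) hmodule \<Rightarrow> ('x, 'b) hmodule \<Rightarrow> ('a \<Rightarrow> 'b) \<Rightarrow> bool" where
  "C0_linear X A B f \<longleftrightarrow>
     (\<forall>a \<in> carrier A. \<forall>b \<in> carrier A. f (a \<oplus>\<^bsub>A\<^esub> b) = f a \<oplus>\<^bsub>B\<^esub> f b) \<and>
     (\<forall>z. \<forall>a \<in> carrier A. f (cscale A z a) = cscale B z (f a)) \<and>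
     (\<forall>h \<in> C0 X. \<forall>a \<in> carrier A. f (h \<odot>\<^bsub>A\<^esub> a) = h \<odot>\<^bsub>B\<^esub> f a)"

definition bounds ::
    "'x topology \<Rightarrow> ('x, 'a) hmodule \<Rightarrow> ('x, 'b) hmodule \<Rightarrow> ('a \<Rightarrow> 'b) \<Rightarrow> real set" where
  "bounds X A B f = {c. 0 \<le> c \<and> (\<forall>a \<in> carrier A. hnorm X B (f a) \<le> c * hnorm X A a)}"

definition nonexpansive ::
    "'x topology \<Rightarrow> ('x, 'a) hmodule \<Rightarrow> ('x, 'b) hmodule \<Rightarrow> ('a \<Rightarrow> 'b) \<Rightarrow> bool" where
  "nonexpansive X A B f \<longleftrightarrow> bounds X A B f \<noteq> {} \<and> Inf (bounds X A B f) \<le> 1"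

definition hilb_hom ::
    "'x topology \<Rightarrow> ('x, 'a) hmodule \<Rightarrow> ('x, 'b) hmodule \<Rightarrow> ('a \<Rightarrow> 'b) set" where
  "hilb_hom X A B =
     {f \<in> carrier A \<rightarrow>\<^sub>E carrier B. C0_linear X A B f \<and> nonexpansive X A B f}"

definition C0_self :: "'x topology \<Rightarrow> ('x, 'x \<Rightarrow> complex) hmodule" where
  "C0_self X = \<lparr>carrier = C0 X, mult = undefined, one = undefined,
     zero = (\<lambda>x. 0), add = (\<lambda>f g x. f x + g x),
     smult = (\<lambda>h f x. h x * f x),
     cscale = (\<lambda>z f x. z * f x),
     ip = (\<lambda>f g x. cnj (f x) * g x)\<rparr>"

definition C0_ideal :: "'x topology \<Rightarrow> 'x set \<Rightarrow> ('x \<Rightarrow> complex) set" where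
  "C0_ideal X U = {f \<in> C0 X. \<forall>x \<in> topspace X - U. f x = 0}"

text \<open>Isomorphism of *-algebras of functions; sums, products and conjugates are pointwise.\<close>

definition star_isomorphism ::
    "('x \<Rightarrow> complex) set \<Rightarrow> ('y \<Rightarrow> complex) set \<Rightarrow>
     (('x \<Rightarrow> complex) \<Rightarrow> ('y \<Rightarrow> complex)) \<Rightarrow> bool" where
  "star_isomorphism F G \<phi> \<longleftrightarrow> bij_betw \<phi> F G \<and>
     (\<forall>f \<in> F. \<forall>g \<in> F. \<phi> (\<lambda>x. f x + g x) = (\<lambda>y. \<phi> f y + \<phi> g y)) \<and>
     (\<forall>f \<in> F. \<forall>g \<in> F. \<phi> (\<lambda>x. f x * g x) = (\<lambda>y. \<phi> f y * \<phi> g y)) \<and>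
     (\<forall>z. \<forall>f \<in> F. \<phi> (\<lambda>x. z * f x) = (\<lambda>y. z * \<phi> f y)) \<and>
     (\<forall>f \<in> F. \<phi> (\<lambda>x. cnj (f x)) = (\<lambda>y. cnj (\<phi> f y)))"


section \<open>The tensor product of Hilbert modules\<close>

text \<open>
  A list \<open>[(a\<^sub>1, b\<^sub>1), \<dots>, (a\<^sub>k, b\<^sub>k)]\<close> stands for the element
  \<open>a\<^sub>1 \<otimes> b\<^sub>1 + \<dots> + a\<^sub>k \<otimes> b\<^sub>k\<close> of the algebraic tensor product.  The completion consists of Cauchy
  sequences of such sums modulo null sequences.  Two lists denoting the same element of the
  algebraic tensor product over \<open>C\<^sub>0(X)\<close> are at distance 0, so the tensor relations need not be
  divided out beforehand.
\<close>

definition tsums :: "('x, 'a) hmodule \<Rightarrow> ('x, 'b) hmodule \<Rightarrow> ('a \<times> 'b) list set" where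
  "tsums A B = lists (carrier A \<times> carrier B)"

definition tsum_ip :: "('x, 'a) hmodule \<Rightarrow> ('x, 'b) hmodule \<Rightarrow>
    ('a \<times> 'b) list \<Rightarrow> ('a \<times> 'b) list \<Rightarrow> 'x \<Rightarrow> complex" where
  "tsum_ip A B p q x = (\<Sum>(a, b)\<leftarrow>p. \<Sum>(a', b')\<leftarrow>q. ip A a a' x * ip B b b' x)"

definition tsum_diff :: "('x, 'a) hmodule \<Rightarrow>
    ('a \<times> 'b) list \<Rightarrow> ('a \<times> 'b) list \<Rightarrow> ('a \<times> 'b) list" where
  "tsum_diff A p q = p @ map (\<lambda>(a, b). (\<ominus>\<^bsub>A\<^esub> a, b)) q"

definition tsum_dist :: "'x topology \<Rightarrow> ('x, 'a) hmodule \<Rightarrow> ('x, 'b) hmodule \<Rightarrow>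
    ('a \<times> 'b) list \<Rightarrow> ('a \<times> 'b) list \<Rightarrow> real" where
  "tsum_dist X A B p q = sqrt (sup_Re X (tsum_ip A B (tsum_diff A p q) (tsum_diff A p q)))"

definition tcauchy :: "'x topology \<Rightarrow> ('x, 'a) hmodule \<Rightarrow> ('x, 'b) hmodule \<Rightarrow>
    (nat \<Rightarrow> ('a \<times> 'b) list) set" where
  "tcauchy X A B = {s. (\<forall>n. s n \<in> tsums A B) \<and>
     (\<forall>e>0. \<exists>N. \<forall>m\<ge>N. \<forall>n\<ge>N. tsum_dist X A B (s m) (s n) < e)}"

definition tnull :: "'x topology \<Rightarrow> ('x, 'a) hmodule \<Rightarrow> ('x, 'b) hmodule \<Rightarrow>
    (nat \<Rightarrow> ('a \<times> 'b) list) rel" where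
  "tnull X A B = {(s, t). s \<in> tcauchy X A B \<and> t \<in> tcauchy X A B \<and>
     (\<lambda>n. tsum_dist X A B (s n) (t n)) \<longlonglongrightarrow> 0}"

definition tclass :: "'x topology \<Rightarrow> ('x, 'a) hmodule \<Rightarrow> ('x, 'b) hmodule \<Rightarrow>
    (nat \<Rightarrow> ('a \<times> 'b) list) \<Rightarrow> (nat \<Rightarrow> ('a \<times> 'b) list) set" where
  "tclass X A B s = tnull X A B `` {s}"

definition trep :: "(nat \<Rightarrow> ('a \<times> 'b) list) set \<Rightarrow> nat \<Rightarrow> ('a \<times> 'b) list" where
  "trep P = (SOME s. s \<in> P)"

definition tensor_completion :: "'x topology \<Rightarrow> ('x, 'a) hmodule \<Rightarrow> ('x, 'b) hmodule \<Rightarrow>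
    ('x, (nat \<Rightarrow> ('a \<times> 'b) list) set) hmodule" where
  "tensor_completion X A B = \<lparr>carrier = tcauchy X A B // tnull X A B,
     mult = undefined, one = undefined,
     zero = tclass X A B (\<lambda>n. []),
     add = (\<lambda>P Q. tclass X A B (\<lambda>n. trep P n @ trep Q n)),
     smult = (\<lambda>f P. tclass X A B (\<lambda>n. map (\<lambda>(a, b). (f \<odot>\<^bsub>A\<^esub> a, b)) (trep P n))),
     cscale = (\<lambda>z P. tclass X A B (\<lambda>n. map (\<lambda>(a, b). (cscale A z a, b)) (trep P n))),
     ip = (\<lambda>P Q x. lim (\<lambda>n. tsum_ip A B (trep P n) (trep Q n) x))\<rparr>"

definition tensor_completion_map ::
    "'x topology \<Rightarrow> ('x, 'c) hmodule \<Rightarrow> ('x, 'd) hmodule \<Rightarrow> ('a \<Rightarrow> 'c) \<Rightarrow> ('b \<Rightarrow> 'd) \<Rightarrow>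
     (nat \<Rightarrow> ('a \<times> 'b) list) set \<Rightarrow> (nat \<Rightarrow> ('c \<times> 'd) list) set" where
  "tensor_completion_map X A' B' f g P =
     tclass X A' B' (\<lambda>n. map (map_prod f g) (trep P n))"


section \<open>The category of Hilbert modules\<close>

text \<open>
  All objects of a category have to be of one type, so the carriers of its modules are the
  subsets of a fixed universe.  The type parameter \<open>'k\<close> is arbitrary: every Hilbert module with carrier
  of type \<open>'k\<close> has a copy in the universe.  Sequences are built in so that a countable sequence of finite
  lists of elements can again be coded by a single element; hence \<open>C\<^sub>0(X)\<close> and the tensor products
  of modules in the universe have copies in it as well.
\<close>

type_synonym ('x, 'k) universe = "nat \<Rightarrow> ('x \<Rightarrow> complex) + 'k"

definition code :: "('x, 'a) hmodule \<Rightarrow> 'a \<Rightarrow> 'u" where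
  "code A = (SOME e. inj_on e (carrier A))"

definition decode :: "('x, 'a) hmodule \<Rightarrow> 'u \<Rightarrow> 'a" where
  "decode A = inv_into (carrier A) (code A)"

definition copy :: "('x, 'a) hmodule \<Rightarrow> ('x, 'u) hmodule" where
  "copy A = \<lparr>carrier = code A ` carrier A, mult = undefined, one = undefined,
     zero = code A \<zero>\<^bsub>A\<^esub>,
     add = (\<lambda>u v. code A (decode A u \<oplus>\<^bsub>A\<^esub> decode A v)),
     smult = (\<lambda>f u. code A (f \<odot>\<^bsub>A\<^esub> decode A u)),
     cscale = (\<lambda>z u. code A (cscale A z (decode A u))),
     ip = (\<lambda>u v. ip A (decode A u) (decode A v))\<rparr>"

definition hilb_unit :: "'x topology \<Rightarrow> ('x, 'u) hmodule" where
  "hilb_unit X = copy (C0_self X)"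

definition hilb_tensor ::
    "'x topology \<Rightarrow> ('x, 'u) hmodule \<Rightarrow> ('x, 'u) hmodule \<Rightarrow> ('x, 'u) hmodule" where
  "hilb_tensor X A B = copy (tensor_completion X A B)"

definition hilb_tensor_map ::
    "'x topology \<Rightarrow> ('x, 'u) hmodule \<Rightarrow> ('x, 'u) hmodule \<Rightarrow> ('x, 'u) hmodule \<Rightarrow> ('x, 'u) hmodule \<Rightarrow>
     ('u \<Rightarrow> 'u) \<Rightarrow> ('u \<Rightarrow> 'u) \<Rightarrow> 'u \<Rightarrow> 'u" where
  "hilb_tensor_map X A A' B B' f g =
     (\<lambda>u \<in> carrier (hilb_tensor X A B).
        code (tensor_completion X A' B')
          (tensor_completion_map X A' B' f g (decode (tensor_completion X A B) u)))"

type_synonym ('x, 'k) hilb_category =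
  "(('x, ('x, 'k) universe) hmodule, ('x, 'k) universe \<Rightarrow> ('x, 'k) universe) monoidal_data"

definition Hilb :: "'x topology \<Rightarrow> ('x, 'k) hilb_category" where
  "Hilb X = \<lparr>Ob = {A. hilbert_C0_module X A},
     Hom = hilb_hom X,
     Id = (\<lambda>A. \<lambda>a \<in> carrier A. a),
     Comp = (\<lambda>A B D g f. compose (carrier A) g f),
     Unit = hilb_unit X,
     TensorOb = hilb_tensor X,
     TensorArr = hilb_tensor_map X\<rparr>"

text \<open>
  The ideal of an open set as a submodule of the tensor unit, and its inclusion.
\<close>

definition ideal_object :: "'x topology \<Rightarrow> 'x set \<Rightarrow> ('x, 'u) hmodule" where
  "ideal_object X U = (hilb_unit X)\<lparr>carrier := code (C0_self X) ` C0_ideal X U\<rparr>"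

definition ideal_inclusion :: "'x topology \<Rightarrow> 'x set \<Rightarrow> 'u \<Rightarrow> 'u" where
  "ideal_inclusion X U = (\<lambda>u \<in> carrier (ideal_object X U). u)"

end

theory Submission
  imports Defs
begin

text \<open>
  The decisive step is that a subunit is an isometric embedding.  A nonexpansive \<open>C\<^sub>0(X)\<close>-linear map
  \<open>f\<close> satisfies \<open>\<langle>f a | f a\<rangle> \<le> \<langle>a | a\<rangle>\<close> not only in supremum but at every point of \<open>X\<close>, because it
  commutes with multiplication by functions concentrated near that point (\<open>hilb_hom_iff\<close>).  Hence an
  isomorphism preserves \<open>\<langle>a | a\<rangle>\<close>.  If \<open>s : S \<rightarrow> C\<^sub>0(X)\<close> is a subunit, the isomorphism \<open>s \<otimes> id\<close> applied
  to \<open>a \<otimes> a\<close> gives \<open>\<langle>a | a\<rangle>\<^sup>2 = \<bar>s(a)\<bar>\<^sup>2 \<langle>a | a\<rangle>\<close>, and together with \<open>\<bar>s(a)\<bar>\<^sup>2 \<le> \<langle>a | a\<rangle>\<close> this forces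
  \<open>\<langle>a | a\<rangle> = \<bar>s(a)\<bar>\<^sup>2\<close> (\<open>subunit_isometry\<close>).

  Everything else follows from this.  By polarisation \<open>s\<close> preserves inner products, so \<open>s \<otimes> id\<close>
  preserves those of \<open>S \<otimes> T\<close> for every \<open>T\<close>; it is therefore injective, hence monic, which is firmness.
  The range of \<open>s\<close> is complete, so it is a closed ideal of \<open>C\<^sub>0(X)\<close>, and a closed ideal consists of
  all functions that vanish off some open set \<open>U\<close> (\<open>C0_ideal_approximation\<close>).  So \<open>s\<close> is an
  isomorphism onto the ideal of \<open>U\<close>.  Conversely, the inclusion \<open>i : J \<rightarrow> C\<^sub>0(X)\<close> of such an ideal is
  isometric, so \<open>i \<otimes> id\<close> is isometric too, and it only remains to see that it is onto.  The inner
  products of an element \<open>\<Sum> f\<^sub>k \<otimes> g\<^sub>k\<close> of \<open>C\<^sub>0(X) \<otimes> J\<close> depend only on the function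
  \<open>h = \<Sum> f\<^sub>k g\<^sub>k \<in> J\<close>, and \<open>h\<close> is a product of two elements of \<open>J\<close>, namely
  \<open>h = (h / \<surd>\<bar>h\<bar>) \<cdot> \<surd>\<bar>h\<bar>\<close> (\<open>C0_ideal_factorisation\<close>).

  Most of the work goes into showing that the completed tensor product is a Hilbert module and that
  \<open>f \<otimes> id\<close> is a morphism.  Two ideas keep this manageable.  First, elements of a Hilbert module are
  separated by their inner products, so all module axioms follow from the linearity of the inner
  product (\<open>hilbert_C0_moduleI\<close>), and one can work with formal sums that carry nothing but a semi-inner
  product.  Secondly, at a fixed point of \<open>X\<close> the inner product of a formal sum with itself is the sum
  of the entries of an entrywise product of two positive matrices, hence nonnegative by the Schur
  product theorem.  The same theorem, applied to the positive form \<open>\<langle>a | b\<rangle> - \<langle>f a | f b\<rangle>\<close> instead of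
  \<open>\<langle>a | b\<rangle>\<close>, shows that \<open>f \<otimes> id\<close> is contractive.
\<close>

section \<open>Functions vanishing at infinity\<close>

text \<open>
  Vanishing at infinity only asks for some compact set outside of which the function is small; this
  form is stable under algebraic operations and uniform limits.
\<close>

lemma C0_iff:
  "f \<in> C0 X \<longleftrightarrow> continuous_map X euclidean f \<and>
     (\<forall>e>0. \<exists>K. compactin X K \<and> (\<forall>x \<in> topspace X - K. norm (f x) < e)) \<and>
     (\<forall>x. x \<notin> topspace X \<longrightarrow> f x = 0)"
proof -
  have "compactin X {x \<in> topspace X. e \<le> norm (f x)} \<longleftrightarrow>
      (\<exists>K. compactin X K \<and> (\<forall>x \<in> topspace X - K. norm (f x) < e))"
    if cont: "continuous_map X euclidean f" for e
  proof
    assume "compactin X {x \<in> topspace X. e \<le> norm (f x)}"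
    then show "\<exists>K. compactin X K \<and> (\<forall>x \<in> topspace X - K. norm (f x) < e)"
      by (intro exI[of _ "{x \<in> topspace X. e \<le> norm (f x)}"]) auto
  next
    assume "\<exists>K. compactin X K \<and> (\<forall>x \<in> topspace X - K. norm (f x) < e)"
    then obtain K where K: "compactin X K" "\<forall>x \<in> topspace X - K. norm (f x) < e" by auto
    have "closed {z::complex. e \<le> norm z}"
      by (intro closed_Collect_le continuous_intros)
    then have "closedin X {x \<in> topspace X. f x \<in> {z. e \<le> norm z}}"
      by (intro closedin_continuous_map_preimage[OF cont]) auto
    then show "compactin X {x \<in> topspace X. e \<le> norm (f x)}"
      using K by (intro closed_compactin[OF K(1)]) (auto simp: not_less[symmetric])
  qed
  then show ?thesis unfolding C0_def by blast
qed

lemma C0_continuous: "f \<in> C0 X \<Longrightarrow> continuous_map X euclidean f"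
  by (simp add: C0_def)

lemma C0_outside: "f \<in> C0 X \<Longrightarrow> x \<notin> topspace X \<Longrightarrow> f x = 0"
  by (simp add: C0_def)

lemma C0_small_off_compact:
  assumes "f \<in> C0 X" "0 < e"
  obtains K where "compactin X K" "\<And>x. x \<in> topspace X - K \<Longrightarrow> norm (f x) < e"
  using assms unfolding C0_iff by blast

lemma continuous_map_compose2:
  fixes \<phi> :: "'b::topological_space \<times> 'c::topological_space \<Rightarrow> 'd::topological_space"
  assumes "continuous_map X euclidean f" "continuous_map X euclidean g" "continuous_on UNIV \<phi>"
  shows "continuous_map X euclidean (\<lambda>x. \<phi> (f x, g x))"
proof -
  have "continuous_map X (prod_topology euclidean euclidean) (\<lambda>x. (f x, g x))"
    by (intro continuous_map_pairedI assms)
  then have "continuous_map X euclidean (\<lambda>x. (f x, g x))"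
    by (simp add: euclidean_product_topology)
  from continuous_map_compose[OF this, of euclidean \<phi>] assms(3) show ?thesis
    by (simp add: o_def)
qed

text \<open>
  All closure properties of \<open>C\<^sub>0(X)\<close> under pointwise operations are instances of this lemma and its
  unary form: near infinity both arguments are small, and \<open>\<phi>\<close> is continuous and vanishes at the origin.
\<close>

lemma C0_compose2:
  assumes f: "f \<in> C0 X" and g: "g \<in> C0 X" and \<phi>: "continuous_on UNIV \<phi>" and \<phi>0: "\<phi> (0, 0) = 0"
  shows "(\<lambda>x. \<phi> (f x, g x)) \<in> C0 X"
  unfolding C0_iff
proof (intro conjI allI impI)
  show "continuous_map X euclidean (\<lambda>x. \<phi> (f x, g x))"
    using f g \<phi> by (intro continuous_map_compose2 C0_continuous)
  show "\<phi> (f x, g x) = 0" if "x \<notin> topspace X" for x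
    using that f g \<phi>0 by (simp add: C0_outside)
next
  fix e :: real assume "0 < e"
  then obtain d where d: "0 < d" "\<And>z. dist z (0, 0) < d \<Longrightarrow> dist (\<phi> z) (\<phi> (0, 0)) < e"
    using \<phi> by (metis UNIV_I continuous_on_iff)
  obtain K where K: "compactin X K" "\<And>x. x \<in> topspace X - K \<Longrightarrow> norm (f x) < d / 2"
    using C0_small_off_compact[OF f, of "d / 2"] d(1) by auto
  obtain L where L: "compactin X L" "\<And>x. x \<in> topspace X - L \<Longrightarrow> norm (g x) < d / 2"
    using C0_small_off_compact[OF g, of "d / 2"] d(1) by auto
  have "norm (\<phi> (f x, g x)) < e" if "x \<in> topspace X - (K \<union> L)" for x
  proof -
    have "norm (f x, g x) \<le> norm (f x) + norm (g x)"
      by (rule norm_Pair_le)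
    also have "\<dots> < d"
      using K(2)[of x] L(2)[of x] that by auto
    finally have "dist (f x, g x) (0, 0) < d"
      by (simp add: dist_norm)
    from d(2)[OF this] show ?thesis
      by (simp add: \<phi>0)
  qed
  then show "\<exists>K. compactin X K \<and> (\<forall>x \<in> topspace X - K. norm (\<phi> (f x, g x)) < e)"
    using K(1) L(1) compactin_Un by blast
qed

lemma C0_zero: "(\<lambda>x. 0) \<in> C0 X"
  unfolding C0_iff using compactin_empty by auto

lemma C0_add: "f \<in> C0 X \<Longrightarrow> g \<in> C0 X \<Longrightarrow> (\<lambda>x. f x + g x) \<in> C0 X"
  using C0_compose2[of f X g "\<lambda>z. fst z + snd z"] by (simp add: continuous_intros)

lemma C0_mult: "f \<in> C0 X \<Longrightarrow> g \<in> C0 X \<Longrightarrow> (\<lambda>x. f x * g x) \<in> C0 X"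
  using C0_compose2[of f X g "\<lambda>z. fst z * snd z"] by (simp add: continuous_intros)

lemma C0_compose:
  assumes "f \<in> C0 X" "continuous_on UNIV \<phi>" "\<phi> 0 = 0"
  shows "(\<lambda>x. \<phi> (f x)) \<in> C0 X"
proof -
  have "continuous_on UNIV (\<lambda>z::complex \<times> complex. \<phi> (fst z))"
    using assms(2) by (intro continuous_on_compose2[OF assms(2)] continuous_intros) auto
  from C0_compose2[OF assms(1) assms(1) this] assms(3) show ?thesis by simp
qed

lemma C0_cmult: "f \<in> C0 X \<Longrightarrow> (\<lambda>x. z * f x) \<in> C0 X"
  using C0_compose[of f X "\<lambda>w. z * w"] by (simp add: continuous_intros)

lemma C0_cnj: "f \<in> C0 X \<Longrightarrow> (\<lambda>x. cnj (f x)) \<in> C0 X"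
  using C0_compose[of f X cnj] by (simp add: continuous_intros)

lemma C0_diff: "f \<in> C0 X \<Longrightarrow> g \<in> C0 X \<Longrightarrow> (\<lambda>x. f x - g x) \<in> C0 X"
  using C0_compose2[of f X g "\<lambda>z. fst z - snd z"] by (simp add: continuous_intros)

lemma C0_sum:
  assumes "\<And>i. i \<in> I \<Longrightarrow> f i \<in> C0 X" shows "(\<lambda>x. \<Sum>i\<in>I. f i x) \<in> C0 X"
  using assms by (induction I rule: infinite_finite_induct) (auto simp: C0_zero C0_add)

lemma C0_sum_list:
  assumes "\<And>i. i \<in> set xs \<Longrightarrow> f i \<in> C0 X" shows "(\<lambda>x. \<Sum>i\<leftarrow>xs. f i x) \<in> C0 X"
  using assms by (induction xs) (auto simp: C0_zero C0_add)

lemma C0_bounded: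
  assumes "f \<in> C0 X" obtains M where "0 \<le> M" "\<And>x. norm (f x) \<le> M"
proof -
  obtain K where K: "compactin X K" "\<And>x. x \<in> topspace X - K \<Longrightarrow> norm (f x) < 1"
    using C0_small_off_compact[OF assms, of 1] by auto
  have "compact (f ` K)"
    using image_compactin[OF K(1) C0_continuous[OF assms]] by simp
  then obtain M where M: "\<And>x. x \<in> K \<Longrightarrow> norm (f x) \<le> M"
    using compact_imp_bounded[of "f ` K"] unfolding bounded_iff by auto
  show thesis
  proof (rule that[of "max 1 M"])
    show "norm (f x) \<le> max 1 M" for x
      using K(2)[of x] M[of x] C0_outside[OF assms, of x]
      by (cases "x \<in> K"; cases "x \<in> topspace X") (auto simp: le_max_iff_disj less_imp_le)
  qed auto
qed

lemma C0_uniform_limit: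
  assumes f: "\<And>n. f n \<in> C0 X" and lim: "uniform_limit UNIV f g sequentially"
  shows "g \<in> C0 X"
  unfolding C0_iff
proof (intro conjI allI impI)
  show "g x = 0" if "x \<notin> topspace X" for x
    using tendsto_uniform_limitI[OF lim, of x] C0_outside[OF f that] by (simp add: LIMSEQ_const_iff)
  have "\<forall>\<^sub>F n in sequentially. \<forall>x \<in> topspace X. g x \<in> UNIV \<and> dist (f n x) (g x) < e" if "0 < e" for e
    using uniform_limitD[OF lim that] by eventually_elim auto
  then have "continuous_map X Met_TC.mtopology g"
    using C0_continuous[OF f]
    by (intro Met_TC.continuous_map_uniform_limit[of X f sequentially]) auto
  then show "continuous_map X euclidean g"
    by simp
next
  fix e :: real assume "0 < e"
  then obtain n where n: "\<And>x. dist (f n x) (g x) < e / 2"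
    using uniform_limitD[OF lim, of "e / 2"] unfolding eventually_sequentially by auto
  obtain K where K: "compactin X K" "\<And>x. x \<in> topspace X - K \<Longrightarrow> norm (f n x) < e / 2"
    using C0_small_off_compact[OF f, of "e / 2"] \<open>0 < e\<close> by auto
  have "norm (g x) < e" if "x \<in> topspace X - K" for x
  proof -
    have "norm (g x) \<le> norm (f n x) + dist (f n x) (g x)"
      by (metis add.commute dist_0_norm dist_commute dist_triangle2)
    then show ?thesis using K(2)[OF that] n[of x] by simp
  qed
  then show "\<exists>K. compactin X K \<and> (\<forall>x \<in> topspace X - K. norm (g x) < e)"
    using K(1) by blast
qed

lemma sup_Re_upper:
  assumes "f \<in> C0 X" "x \<in> topspace X" shows "Re (f x) \<le> sup_Re X f"
proof -
  obtain M where "0 \<le> M" "\<And>x. norm (f x) \<le> M" using C0_bounded[OF assms(1)] by blast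
  then have "bdd_above (insert 0 ((\<lambda>x. Re (f x)) ` topspace X))"
    by (intro bdd_aboveI[of _ M]) (auto intro: order_trans[OF complex_Re_le_cmod])
  then show ?thesis unfolding sup_Re_def using assms(2) by (intro cSup_upper) auto
qed

lemma sup_Re_nonneg:
  assumes "f \<in> C0 X" shows "0 \<le> sup_Re X f"
proof -
  obtain M where "0 \<le> M" "\<And>x. norm (f x) \<le> M" using C0_bounded[OF assms(1)] by blast
  then have "bdd_above (insert 0 ((\<lambda>x. Re (f x)) ` topspace X))"
    by (intro bdd_aboveI[of _ M]) (auto intro: order_trans[OF complex_Re_le_cmod])
  then show ?thesis unfolding sup_Re_def by (intro cSup_upper) auto
qed

lemma sup_Re_least:
  assumes "\<And>x. x \<in> topspace X \<Longrightarrow> Re (f x) \<le> c" "0 \<le> c" shows "sup_Re X f \<le> c"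
  unfolding sup_Re_def using assms by (intro cSup_least) auto

text \<open>
  If \<open>q(x) > p(x)\<close>, choose \<open>p(x) < d < c < q(x)\<close>.  The weight \<open>h = (q - c)\<^sup>+ (d - p)\<^sup>+\<close> is built from \<open>p\<close>
  and \<open>q\<close> themselves and is supported where \<open>p < d\<close> and \<open>q > c\<close>.  So \<open>h\<^sup>2 p \<le> (d / c) h\<^sup>2 q\<close>, and the
  supremum of \<open>h\<^sup>2 p\<close> is strictly smaller than that of \<open>h\<^sup>2 q\<close>.
\<close>

lemma C0_le_of_weighted_sup_le:
  assumes p: "p \<in> C0 X" and q: "q \<in> C0 X"
    and p0: "\<And>x. 0 \<le> Re (p x)" and q0: "\<And>x. 0 \<le> Re (q x)"
    and le: "\<And>h. h \<in> C0 X \<Longrightarrow>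
      sup_Re X (\<lambda>x. cnj (h x) * h x * q x) \<le> sup_Re X (\<lambda>x. cnj (h x) * h x * p x)"
  shows "Re (q x) \<le> Re (p x)"
proof (rule ccontr)
  assume "\<not> Re (q x) \<le> Re (p x)"
  then obtain c where c: "Re (p x) < c" "c < Re (q x)" using dense not_le by metis
  then obtain d where d: "Re (p x) < d" "d < c" using dense by metis
  then have "0 < d" "0 < c" using p0[of x] by linarith+
  define h where "h y = complex_of_real (max 0 (Re (q y) - c) * max 0 (d - Re (p y)))" for y
  have "continuous_on UNIV
      (\<lambda>z. complex_of_real (max 0 (Re (fst z) - c) * max 0 (d - Re (snd z))))"
    by (intro continuous_intros)
  from C0_compose2[OF q p this] \<open>0 < c\<close> have hC: "h \<in> C0 X"
    by (simp add: h_def[abs_def])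
  have x: "x \<in> topspace X" using c(2) \<open>0 < c\<close> C0_outside[OF q] by fastforce
  define r where "r y = max 0 (Re (q y) - c) * max 0 (d - Re (p y))" for y
  have hh: "Re (cnj (h y) * h y * w) = (r y)\<^sup>2 * Re w" for y w
    by (simp add: h_def r_def power2_eq_square)
  have C: "(\<lambda>x. cnj (h x) * h x * f x) \<in> C0 X" if "f \<in> C0 X" for f
    using hC that by (intro C0_mult C0_cnj)
  define S where "S = sup_Re X (\<lambda>x. cnj (h x) * h x * q x)"
  have S: "(r y)\<^sup>2 * Re (q y) \<le> S" if "y \<in> topspace X" for y
    using sup_Re_upper[OF C[OF q] that] unfolding hh S_def .
  have "0 < r x" using c d by (simp add: r_def)
  then have "0 < (r x)\<^sup>2 * Re (q x)" using c \<open>0 < c\<close> by simp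
  then have "0 < S" using S[OF x] by linarith
  have "sup_Re X (\<lambda>x. cnj (h x) * h x * p x) \<le> d / c * S"
  proof (rule sup_Re_least)
    fix y assume y: "y \<in> topspace X"
    have "(r y)\<^sup>2 * Re (p y) \<le> d / c * ((r y)\<^sup>2 * Re (q y))"
    proof (cases "r y = 0")
      case False
      then have "Re (p y) \<le> d" "c \<le> Re (q y)" by (auto simp: r_def max_def split: if_splits)
      then have "c * Re (p y) \<le> Re (q y) * d"
        using \<open>0 < c\<close> \<open>0 < d\<close> p0[of y] by (metis mult_mono order_trans less_imp_le)
      then have "Re (p y) \<le> d / c * Re (q y)"
        using \<open>0 < c\<close> by (simp add: field_simps)
      then show ?thesis
        using mult_left_mono[of "Re (p y)" "d / c * Re (q y)" "(r y)\<^sup>2"] by (simp add: mult_ac)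
    qed simp
    also have "\<dots> \<le> d / c * S"
      using S[OF y] \<open>0 < d\<close> \<open>0 < c\<close> by (intro mult_left_mono) auto
    finally show "Re (cnj (h y) * h y * p y) \<le> d / c * S" unfolding hh .
  qed (use \<open>0 < S\<close> \<open>0 < d\<close> \<open>0 < c\<close> in auto)
  then have "S \<le> d / c * S" using le[OF hC] unfolding S_def by linarith
  then have "c * S \<le> d * S" using \<open>0 < c\<close> by (simp add: field_simps)
  then show False using \<open>0 < S\<close> \<open>d < c\<close> by simp
qed

lemma sup_Re_tendsto:
  assumes f: "\<And>n. f n \<in> C0 X" and lim: "uniform_limit UNIV f g sequentially"
  shows "(\<lambda>n. sup_Re X (f n)) \<longlonglongrightarrow> sup_Re X g"
proof (rule metric_LIMSEQ_I)
  fix e :: real assume "0 < e"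
  have g: "g \<in> C0 X" using C0_uniform_limit[OF f lim] .
  have close: "sup_Re X h \<le> sup_Re X k + e / 2"
    if "h \<in> C0 X" "k \<in> C0 X" "\<And>x. dist (h x) (k x) < e / 2" for h k
  proof (rule sup_Re_least)
    fix x assume "x \<in> topspace X"
    have "Re (h x) - Re (k x) \<le> dist (h x) (k x)"
      unfolding dist_norm using complex_Re_le_cmod[of "h x - k x"] by simp
    then show "Re (h x) \<le> sup_Re X k + e / 2"
      using that(3)[of x] sup_Re_upper[OF that(2) \<open>x \<in> topspace X\<close>] by linarith
  qed (use sup_Re_nonneg[OF that(2)] \<open>0 < e\<close> in auto)
  obtain N where N: "\<And>n x. n \<ge> N \<Longrightarrow> dist (f n x) (g x) < e / 2"
    using uniform_limitD[OF lim, of "e / 2"] \<open>0 < e\<close> unfolding eventually_sequentially by auto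
  have "dist (sup_Re X (f n)) (sup_Re X g) < e" if "n \<ge> N" for n
    using close[OF f g N[OF that]] close[OF g f, of n] N[OF that] \<open>0 < e\<close>
    by (auto simp: dist_real_def dist_commute)
  then show "\<exists>N. \<forall>n\<ge>N. dist (sup_Re X (f n)) (sup_Re X g) < e" by blast
qed


section \<open>Semi-inner products with values in \<open>C\<^sub>0(X)\<close>\<close>

text \<open>
  The operations are only assumed to be compatible with the form.  This makes formal sums of
  elementary tensors an instance, on which the module axioms hold only up to vectors of length 0.
\<close>

locale semi_inner_product =
  fixes X :: "'x topology" and V :: "'v set"
    and add :: "'v \<Rightarrow> 'v \<Rightarrow> 'v" and scale :: "complex \<Rightarrow> 'v \<Rightarrow> 'v"
    and act :: "('x \<Rightarrow> complex) \<Rightarrow> 'v \<Rightarrow> 'v" and null :: 'v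
    and form :: "'v \<Rightarrow> 'v \<Rightarrow> 'x \<Rightarrow> complex"
  assumes add_closed: "\<lbrakk>u \<in> V; v \<in> V\<rbrakk> \<Longrightarrow> add u v \<in> V"
    and scale_closed: "v \<in> V \<Longrightarrow> scale z v \<in> V"
    and act_closed: "\<lbrakk>f \<in> C0 X; v \<in> V\<rbrakk> \<Longrightarrow> act f v \<in> V"
    and null_closed: "null \<in> V"
    and form_closed: "\<lbrakk>u \<in> V; v \<in> V\<rbrakk> \<Longrightarrow> form u v \<in> C0 X"
    and form_add: "\<lbrakk>u \<in> V; v \<in> V; w \<in> V\<rbrakk> \<Longrightarrow> form u (add v w) x = form u v x + form u w x"
    and form_scale: "\<lbrakk>u \<in> V; v \<in> V\<rbrakk> \<Longrightarrow> form u (scale z v) x = z * form u v x"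
    and form_act: "\<lbrakk>f \<in> C0 X; u \<in> V; v \<in> V\<rbrakk> \<Longrightarrow> form u (act f v) x = f x * form u v x"
    and form_null: "u \<in> V \<Longrightarrow> form u null x = 0"
    and form_commute: "\<lbrakk>u \<in> V; v \<in> V\<rbrakk> \<Longrightarrow> form u v x = cnj (form v u x)"
    and form_nonneg: "v \<in> V \<Longrightarrow> 0 \<le> Re (form v v x)"
begin

definition len :: "'v \<Rightarrow> real" where "len v = sqrt (sup_Re X (form v v))"

definition gap :: "'v \<Rightarrow> 'v \<Rightarrow> real" where "gap u v = len (add u (scale (- 1) v))"

lemma form_add_left:
  "\<lbrakk>u \<in> V; v \<in> V; w \<in> V\<rbrakk> \<Longrightarrow> form (add u v) w x = form u w x + form v w x"
  by (metis add_closed complex_cnj_add form_add form_commute)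

lemma form_scale_left: "\<lbrakk>u \<in> V; v \<in> V\<rbrakk> \<Longrightarrow> form (scale z u) v x = cnj z * form u v x"
  by (metis scale_closed complex_cnj_mult form_scale form_commute)

lemma form_act_left:
  "\<lbrakk>f \<in> C0 X; u \<in> V; v \<in> V\<rbrakk> \<Longrightarrow> form (act f u) v x = cnj (f x) * form u v x"
  by (metis act_closed complex_cnj_mult form_act form_commute)

lemma form_null_left: "v \<in> V \<Longrightarrow> form null v x = 0"
  by (metis complex_cnj_zero form_commute form_null null_closed)

lemma form_self_Im: "v \<in> V \<Longrightarrow> Im (form v v x) = 0"
  by (metis Reals_cnj_iff complex_is_Real_iff form_commute)

lemma form_self_eq_of_real: "v \<in> V \<Longrightarrow> form v v x = of_real (Re (form v v x))"
  by (simp add: complex_eq_iff form_self_Im)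

lemmas form_simps = form_add form_scale form_act form_null
  form_add_left form_scale_left form_act_left form_null_left
lemmas closed_simps = add_closed scale_closed act_closed null_closed

lemma form_add_self:
  assumes "u \<in> V" "v \<in> V"
  shows "Re (form (add u v) (add u v) x) = Re (form u u x) + 2 * Re (form u v x) + Re (form v v x)"
proof -
  have "Re (form v u x) = Re (form u v x)"
    using assms by (metis cnj.simps(1) form_commute)
  then show ?thesis using assms by (simp add: form_simps closed_simps)
qed

text \<open>
  The quadratic polynomial \<open>\<langle>u - t b\<^sup>* v | u - t b\<^sup>* v\<rangle>\<close> in the real variable \<open>t\<close>, where \<open>b = \<langle>u | v\<rangle>\<close>, is
  nonnegative.  If \<open>c = \<langle>v | v\<rangle>\<close> is nonzero take \<open>t = 1 / c\<close>; otherwise the polynomial is linear, so its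
  slope vanishes.
\<close>

lemma Cauchy_Schwarz:
  assumes u: "u \<in> V" and v: "v \<in> V"
  shows "(cmod (form u v x))\<^sup>2 \<le> Re (form u u x) * Re (form v v x)"
proof -
  define a b c where "a = Re (form u u x)" and "b = form u v x" and "c = Re (form v v x)"
  have quad: "0 \<le> a - 2 * t * (cmod b)\<^sup>2 + t\<^sup>2 * (cmod b)\<^sup>2 * c" for t
  proof -
    define z where "z = - (of_real t * cnj b)"
    have "0 \<le> Re (form (add u (scale z v)) (add u (scale z v)) x)"
      using u v by (intro form_nonneg closed_simps)
    also have "\<dots> = a + 2 * Re (z * b) + Re (z * (cnj z * form v v x))"
      using u v
      by (simp only: form_add_self[OF u scale_closed[OF v]] form_scale form_scale_left
          scale_closed a_def b_def c_def mult.assoc)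
    also have "z * b = of_real (- t * (cmod b)\<^sup>2)"
      unfolding z_def complex_norm_square of_real_mult by (simp add: mult_ac)
    also have "form v v x = of_real c"
      unfolding c_def by (rule form_self_eq_of_real[OF v])
    also have "z * (cnj z * of_real c) = of_real (t\<^sup>2 * (cmod b)\<^sup>2 * c)"
      unfolding z_def complex_norm_square of_real_mult by (simp add: mult_ac power2_eq_square)
    finally show ?thesis by simp
  qed
  have "0 \<le> a" "0 \<le> c" using u v form_nonneg by (simp_all add: a_def c_def)
  have "(cmod b)\<^sup>2 \<le> a * c"
  proof (cases "c = 0")
    case True
    have "cmod b = 0"
    proof (rule ccontr)
      assume "cmod b \<noteq> 0"
      then show False using quad[of "(a + 1) / (cmod b)\<^sup>2"] True \<open>0 \<le> a\<close> by simp
    qed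
    then show ?thesis using True by simp
  next
    case False
    then have "0 < c" using \<open>0 \<le> c\<close> by simp
    then show ?thesis using quad[of "1 / c"] by (simp add: field_simps power2_eq_square)
  qed
  then show ?thesis by (simp add: a_def b_def c_def)
qed

lemma form_self_outside: "v \<in> V \<Longrightarrow> x \<notin> topspace X \<Longrightarrow> form v v x = 0"
  by (rule C0_outside[OF form_closed])

lemma len_nonneg: "v \<in> V \<Longrightarrow> 0 \<le> len v"
  by (simp add: len_def sup_Re_nonneg form_closed)

lemma len_upper: "v \<in> V \<Longrightarrow> Re (form v v x) \<le> (len v)\<^sup>2"
  using sup_Re_upper[OF form_closed[of v v], of x] form_self_outside[of v x]
  by (cases "x \<in> topspace X") (auto simp: len_def sup_Re_nonneg form_closed)

lemma len_least: "0 \<le> c \<Longrightarrow> (\<And>x. Re (form v v x) \<le> c\<^sup>2) \<Longrightarrow> len v \<le> c"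
  unfolding len_def by (rule real_le_lsqrt) (auto intro: sup_Re_least)

lemma form_bound:
  assumes "u \<in> V" "v \<in> V" shows "cmod (form u v x) \<le> len u * len v"
proof (rule power2_le_imp_le)
  have "(cmod (form u v x))\<^sup>2 \<le> Re (form u u x) * Re (form v v x)"
    by (rule Cauchy_Schwarz[OF assms])
  also have "\<dots> \<le> (len u)\<^sup>2 * (len v)\<^sup>2"
    using assms by (intro mult_mono len_upper form_nonneg) auto
  finally show "(cmod (form u v x))\<^sup>2 \<le> (len u * len v)\<^sup>2" by (simp add: power_mult_distrib)
qed (use assms len_nonneg in simp)

lemma len_add: assumes "u \<in> V" "v \<in> V" shows "len (add u v) \<le> len u + len v"
proof (rule len_least)
  fix x
  have "Re (form u v x) \<le> len u * len v"
    using form_bound[OF assms, of x] complex_Re_le_cmod order_trans by blast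
  then show "Re (form (add u v) (add u v) x) \<le> (len u + len v)\<^sup>2"
    using len_upper[OF assms(1), of x] len_upper[OF assms(2), of x]
    unfolding form_add_self[OF assms] by (simp add: power2_sum)
qed (use assms len_nonneg in simp)

text \<open>
  Identities between vectors are replaced by identities between their inner products; all estimates
  for \<open>gap\<close> below rest on this.
\<close>

lemma len_cong:
  assumes "u \<in> V" "v \<in> V" "\<And>t x. t \<in> V \<Longrightarrow> form t u x = form t v x"
  shows "len u = len v"
proof -
  have "form u u x = form v v x" for x
    using assms(3)[OF assms(1), of x] assms(3)[OF assms(2), of x]
      form_commute[OF assms(1,2), of x] form_commute[OF assms(2,2), of x] by simp
  then have "form u u = form v v" by blast
  then show ?thesis by (simp add: len_def)
qed

lemma len_scale: assumes "v \<in> V" shows "len (scale z v) \<le> cmod z * len v"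
proof (rule len_least)
  fix x
  have "Re (form (scale z v) (scale z v) x) = (cmod z)\<^sup>2 * Re (form v v x)"
    using assms form_self_eq_of_real[OF assms, of x]
    by (simp add: form_simps closed_simps cmod_power2) (simp add: algebra_simps power2_eq_square form_self_Im)
  also have "\<dots> \<le> (cmod z * len v)\<^sup>2"
    using len_upper[OF assms, of x] by (simp add: power_mult_distrib mult_left_mono)
  finally show "Re (form (scale z v) (scale z v) x) \<le> (cmod z * len v)\<^sup>2" .
qed (use assms len_nonneg in simp)

lemma len_act:
  assumes "v \<in> V" "f \<in> C0 X" "\<And>x. cmod (f x) \<le> M" shows "len (act f v) \<le> M * len v"
proof (rule len_least)
  fix x
  have "0 \<le> M" using assms(3) norm_ge_zero order_trans by blast
  have "Re (form (act f v) (act f v) x) = (cmod (f x))\<^sup>2 * Re (form v v x)"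
    using assms form_self_eq_of_real[OF assms(1), of x]
    by (simp add: form_simps closed_simps cmod_power2) (simp add: algebra_simps power2_eq_square form_self_Im)
  also have "\<dots> \<le> M\<^sup>2 * (len v)\<^sup>2"
    using len_upper[OF assms(1), of x] assms(3)[of x] form_nonneg[OF assms(1)]
    by (intro mult_mono power_mono) auto
  finally show "Re (form (act f v) (act f v) x) \<le> (M * len v)\<^sup>2" by (simp add: power_mult_distrib)
next
  show "0 \<le> M * len v"
    using assms len_nonneg by (metis mult_nonneg_nonneg norm_ge_zero order_trans)
qed

lemma gap_nonneg: "u \<in> V \<Longrightarrow> v \<in> V \<Longrightarrow> 0 \<le> gap u v"
  by (simp add: gap_def len_nonneg closed_simps)

lemma gap_triangle:
  assumes "u \<in> V" "v \<in> V" "w \<in> V" shows "gap u w \<le> gap u v + gap v w"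
proof -
  have "gap u w = len (add (add u (scale (- 1) v)) (add v (scale (- 1) w)))"
    unfolding gap_def using assms by (intro len_cong) (auto simp: closed_simps form_simps)
  also have "\<dots> \<le> gap u v + gap v w"
    unfolding gap_def using assms by (intro len_add closed_simps)
  finally show ?thesis .
qed

lemma gap_le_commute: assumes "u \<in> V" "v \<in> V" shows "gap u v \<le> gap v u"
proof -
  have "gap u v = len (scale (- 1) (add v (scale (- 1) u)))"
    unfolding gap_def using assms by (intro len_cong) (simp_all add: closed_simps form_simps)
  also have "\<dots> \<le> cmod (- 1) * gap v u"
    unfolding gap_def using assms by (intro len_scale closed_simps)
  finally show ?thesis by simp
qed

lemma gap_commute: "u \<in> V \<Longrightarrow> v \<in> V \<Longrightarrow> gap u v = gap v u"
  by (intro order.antisym gap_le_commute)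

lemma gap_self: assumes "u \<in> V" shows "gap u u = 0"
proof -
  have "gap u u = len null"
    unfolding gap_def using assms by (intro len_cong) (auto simp: closed_simps form_simps)
  moreover have "len null \<le> 0"
    by (rule len_least) (auto simp: form_simps closed_simps)
  ultimately show ?thesis using gap_nonneg[OF assms assms] by simp
qed

lemma gap_eq_0I:
  assumes "u \<in> V" "v \<in> V" "\<And>t x. t \<in> V \<Longrightarrow> form t u x = form t v x" shows "gap u v = 0"
proof -
  have "gap u v = gap v v"
    unfolding gap_def using assms by (intro len_cong) (simp_all add: closed_simps form_simps)
  then show ?thesis using assms gap_self by simp
qed

lemma len_le_gap: assumes "u \<in> V" "v \<in> V" shows "len u \<le> len v + gap u v"
proof -
  have "len u = len (add v (add u (scale (- 1) v)))"
    using assms by (intro len_cong) (auto simp: closed_simps form_simps)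
  also have "\<dots> \<le> len v + gap u v"
    unfolding gap_def using assms by (intro len_add closed_simps)
  finally show ?thesis .
qed

lemma gap_add:
  assumes "u \<in> V" "v \<in> V" "u' \<in> V" "v' \<in> V"
  shows "gap (add u v) (add u' v') \<le> gap u u' + gap v v'"
proof -
  have "gap (add u v) (add u' v') = len (add (add u (scale (- 1) u')) (add v (scale (- 1) v')))"
    unfolding gap_def using assms by (intro len_cong) (auto simp: closed_simps form_simps)
  also have "\<dots> \<le> gap u u' + gap v v'"
    unfolding gap_def using assms by (intro len_add closed_simps)
  finally show ?thesis .
qed

lemma gap_scale: assumes "u \<in> V" "v \<in> V" shows "gap (scale z u) (scale z v) \<le> cmod z * gap u v"
proof -
  have "gap (scale z u) (scale z v) = len (scale z (add u (scale (- 1) v)))"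
    unfolding gap_def using assms
    by (intro len_cong) (auto simp: closed_simps form_simps algebra_simps)
  also have "\<dots> \<le> cmod z * gap u v"
    unfolding gap_def using assms by (intro len_scale closed_simps)
  finally show ?thesis .
qed

lemma gap_act:
  assumes "u \<in> V" "v \<in> V" "f \<in> C0 X" "\<And>x. cmod (f x) \<le> M"
  shows "gap (act f u) (act f v) \<le> M * gap u v"
proof -
  have "gap (act f u) (act f v) = len (act f (add u (scale (- 1) v)))"
    unfolding gap_def using assms
    by (intro len_cong) (auto simp: closed_simps form_simps algebra_simps)
  also have "\<dots> \<le> M * gap u v"
    unfolding gap_def using assms by (intro len_act closed_simps)
  finally show ?thesis .
qed

lemma form_gap_bound:
  assumes "u \<in> V" "v \<in> V" "u' \<in> V" "v' \<in> V"
  shows "cmod (form u v x - form u' v' x) \<le> gap u u' * len v + len u' * gap v v'"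
proof -
  have "form u v x - form u' v' x =
      form (add u (scale (- 1) u')) v x + form u' (add v (scale (- 1) v')) x"
    using assms by (simp add: form_simps closed_simps)
  also have "cmod \<dots> \<le> gap u u' * len v + len u' * gap v v'"
    unfolding gap_def using assms
    by (intro order_trans[OF norm_triangle_ineq] add_mono form_bound closed_simps)
  finally show ?thesis .
qed

end


locale module_semi_inner_product =
  semi_inner_product X "carrier A" "ring.add A" "cscale A" "smult A" "ring.zero A" "ip A"
  for X :: "'x topology" and A :: "('x, 'a) hmodule"


section \<open>The completion of a semi-inner product\<close>

context semi_inner_product
begin

definition cauchy_seqs :: "(nat \<Rightarrow> 'v) set" where
  "cauchy_seqs = {s. (\<forall>n. s n \<in> V) \<and> (\<forall>e>0. \<exists>N. \<forall>m\<ge>N. \<forall>n\<ge>N. gap (s m) (s n) < e)}"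

definition null_rel :: "(nat \<Rightarrow> 'v) rel" where
  "null_rel = {(s, t). s \<in> cauchy_seqs \<and> t \<in> cauchy_seqs \<and> (\<lambda>n. gap (s n) (t n)) \<longlonglongrightarrow> 0}"

definition cls :: "(nat \<Rightarrow> 'v) \<Rightarrow> (nat \<Rightarrow> 'v) set" where "cls s = null_rel `` {s}"

definition rep :: "(nat \<Rightarrow> 'v) set \<Rightarrow> nat \<Rightarrow> 'v" where "rep P = (SOME s. s \<in> P)"

text \<open>
  On formal sums of elementary tensors this is literally the construction of the completed tensor
  product, representatives chosen by \<open>SOME\<close> included.
\<close>

definition completion :: "('x, (nat \<Rightarrow> 'v) set) hmodule" where
  "completion = \<lparr>carrier = cauchy_seqs // null_rel, mult = undefined, one = undefined,
     zero = cls (\<lambda>n. null),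
     add = (\<lambda>P Q. cls (\<lambda>n. add (rep P n) (rep Q n))),
     smult = (\<lambda>f P. cls (\<lambda>n. act f (rep P n))),
     cscale = (\<lambda>z P. cls (\<lambda>n. scale z (rep P n))),
     ip = (\<lambda>P Q x. lim (\<lambda>n. form (rep P n) (rep Q n) x))\<rparr>"

lemma cauchy_seqs_closed: "s \<in> cauchy_seqs \<Longrightarrow> s n \<in> V"
  by (simp add: cauchy_seqs_def)

lemma cauchy_seqs_gap:
  assumes "s \<in> cauchy_seqs" "0 < e" obtains N where "\<And>m n. m \<ge> N \<Longrightarrow> n \<ge> N \<Longrightarrow> gap (s m) (s n) < e"
  using assms unfolding cauchy_seqs_def by blast

lemma cauchy_seqs_dominated:
  assumes s: "s \<in> cauchy_seqs" and t: "t \<in> cauchy_seqs" and r: "\<And>n. r n \<in> V"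
    and le: "\<And>m n. gap (r m) (r n) \<le> M * (gap (s m) (s n) + gap (t m) (t n))"
  shows "r \<in> cauchy_seqs"
proof -
  have "\<exists>N. \<forall>m\<ge>N. \<forall>n\<ge>N. gap (r m) (r n) < e" if "0 < e" for e
  proof -
    have pos: "0 < e / (2 * (\<bar>M\<bar> + 1))" using that by simp
    obtain N where N: "\<And>m n. m \<ge> N \<Longrightarrow> n \<ge> N \<Longrightarrow> gap (s m) (s n) < e / (2 * (\<bar>M\<bar> + 1))"
      using cauchy_seqs_gap[OF s pos] by blast
    obtain K where K: "\<And>m n. m \<ge> K \<Longrightarrow> n \<ge> K \<Longrightarrow> gap (t m) (t n) < e / (2 * (\<bar>M\<bar> + 1))"
      using cauchy_seqs_gap[OF t pos] by blast
    have "gap (r m) (r n) < e" if "m \<ge> max N K" "n \<ge> max N K" for m n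
    proof -
      define g where "g = gap (s m) (s n) + gap (t m) (t n)"
      have "0 \<le> g" using s t gap_nonneg cauchy_seqs_closed by (simp add: g_def)
      have "g < e / (\<bar>M\<bar> + 1)"
        using N[of m n] K[of m n] that by (simp add: g_def field_simps)
      then have "(\<bar>M\<bar> + 1) * g < e" by (simp add: field_simps)
      moreover have "M * g \<le> (\<bar>M\<bar> + 1) * g"
        using \<open>0 \<le> g\<close> by (intro mult_right_mono) auto
      ultimately show ?thesis using le[of m n] by (simp add: g_def)
    qed
    then show ?thesis by blast
  qed
  then show ?thesis using r by (simp add: cauchy_seqs_def)
qed

lemma cauchy_seqs_add:
  assumes "s \<in> cauchy_seqs" "t \<in> cauchy_seqs" shows "(\<lambda>n. add (s n) (t n)) \<in> cauchy_seqs"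
proof (rule cauchy_seqs_dominated[OF assms, where M = 1])
  note V = cauchy_seqs_closed[OF assms(1)] cauchy_seqs_closed[OF assms(2)]
  show "add (s n) (t n) \<in> V" for n by (intro add_closed V)
  show "gap (add (s m) (t m)) (add (s n) (t n)) \<le> 1 * (gap (s m) (s n) + gap (t m) (t n))" for m n
    unfolding mult_1 by (intro gap_add V)
qed

lemma cauchy_seqs_scale:
  assumes "s \<in> cauchy_seqs" shows "(\<lambda>n. scale z (s n)) \<in> cauchy_seqs"
proof (rule cauchy_seqs_dominated[OF assms assms, where M = "cmod z"])
  note V = cauchy_seqs_closed[OF assms]
  show "scale z (s n) \<in> V" for n by (intro scale_closed V)
  show "gap (scale z (s m)) (scale z (s n)) \<le> cmod z * (gap (s m) (s n) + gap (s m) (s n))" for m n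
  proof -
    have "gap (scale z (s m)) (scale z (s n)) \<le> cmod z * gap (s m) (s n)"
      by (intro gap_scale V)
    also have "\<dots> \<le> cmod z * (gap (s m) (s n) + gap (s m) (s n))"
      using gap_nonneg[OF V V, of m n] by (simp add: mult_left_mono)
    finally show ?thesis .
  qed
qed

lemma cauchy_seqs_act:
  assumes s: "s \<in> cauchy_seqs" and f: "f \<in> C0 X" shows "(\<lambda>n. act f (s n)) \<in> cauchy_seqs"
proof -
  obtain M where M: "0 \<le> M" "\<And>x. cmod (f x) \<le> M" using C0_bounded[OF f] by blast
  note V = cauchy_seqs_closed[OF s]
  show ?thesis
  proof (rule cauchy_seqs_dominated[OF s s, where M = M])
    show "act f (s n) \<in> V" for n by (intro act_closed V f)
    show "gap (act f (s m)) (act f (s n)) \<le> M * (gap (s m) (s n) + gap (s m) (s n))" for m n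
    proof -
      have "gap (act f (s m)) (act f (s n)) \<le> M * gap (s m) (s n)"
        using M by (intro gap_act V f)
      also have "\<dots> \<le> M * (gap (s m) (s n) + gap (s m) (s n))"
        using gap_nonneg[OF V V, of m n] M by (simp add: mult_left_mono)
      finally show ?thesis .
    qed
  qed
qed

lemma cauchy_seqs_const: "v \<in> V \<Longrightarrow> (\<lambda>n. v) \<in> cauchy_seqs"
  by (auto simp: cauchy_seqs_def gap_self)

lemma equiv_null_rel: "equiv cauchy_seqs null_rel"
proof (rule equivI)
  show "null_rel \<subseteq> cauchy_seqs \<times> cauchy_seqs" by (auto simp: null_rel_def)
  show "refl_on cauchy_seqs null_rel"
    by (auto simp: refl_on_def null_rel_def gap_self cauchy_seqs_closed)
  show "sym null_rel"
    by (auto simp: sym_def null_rel_def gap_commute cauchy_seqs_closed)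
  show "trans null_rel"
  proof (rule transI)
    fix r s t assume "(r, s) \<in> null_rel" "(s, t) \<in> null_rel"
    then have R: "r \<in> cauchy_seqs" "s \<in> cauchy_seqs" "t \<in> cauchy_seqs"
      "(\<lambda>n. gap (r n) (s n)) \<longlonglongrightarrow> 0" "(\<lambda>n. gap (s n) (t n)) \<longlonglongrightarrow> 0"
      by (auto simp: null_rel_def)
    have "(\<lambda>n. gap (r n) (t n)) \<longlonglongrightarrow> 0"
    proof (rule tendsto_sandwich[OF _ _ tendsto_const])
      show "(\<lambda>n. gap (r n) (s n) + gap (s n) (t n)) \<longlonglongrightarrow> 0"
        using tendsto_add[OF R(4,5)] by simp
    qed (use R in \<open>auto intro!: always_eventually gap_nonneg gap_triangle cauchy_seqs_closed\<close>)
    then show "(r, t) \<in> null_rel" using R by (simp add: null_rel_def)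
  qed
qed

lemma cls_closed: "s \<in> cauchy_seqs \<Longrightarrow> cls s \<in> carrier completion"
  by (simp add: completion_def cls_def quotientI)

lemma cls_eq_iff: "s \<in> cauchy_seqs \<Longrightarrow> t \<in> cauchy_seqs \<Longrightarrow> cls s = cls t \<longleftrightarrow> (s, t) \<in> null_rel"
  unfolding cls_def using eq_equiv_class_iff[OF equiv_null_rel] by blast

lemma cls_rep:
  assumes "P \<in> carrier completion" shows "rep P \<in> cauchy_seqs" "cls (rep P) = P"
proof -
  have P: "P \<in> cauchy_seqs // null_rel" using assms by (simp add: completion_def)
  then obtain s where s: "s \<in> cauchy_seqs" "P = null_rel `` {s}" by (auto elim: quotientE)
  then have "s \<in> P" using equiv_class_self[OF equiv_null_rel] by blast
  then have "rep P \<in> P" unfolding rep_def by (rule someI[where P = "\<lambda>s. s \<in> P"])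
  then have rel: "(s, rep P) \<in> null_rel" using s(2) by blast
  then show "rep P \<in> cauchy_seqs" by (simp add: null_rel_def)
  show "cls (rep P) = P"
    using equiv_class_eq[OF equiv_null_rel rel] s(2) unfolding cls_def by metis
qed

lemma rep_cls: "s \<in> cauchy_seqs \<Longrightarrow> (rep (cls s), s) \<in> null_rel"
  using cls_rep[OF cls_closed] cls_eq_iff by metis

definition lim_form :: "(nat \<Rightarrow> 'v) \<Rightarrow> (nat \<Rightarrow> 'v) \<Rightarrow> 'x \<Rightarrow> complex" where
  "lim_form s t x = lim (\<lambda>n. form (s n) (t n) x)"

lemma cauchy_seqs_len_bounded:
  assumes "s \<in> cauchy_seqs"
  obtains M where "0 < M" "eventually (\<lambda>n. len (s n) \<le> M) sequentially"
proof -
  obtain N where N: "\<And>m n. m \<ge> N \<Longrightarrow> n \<ge> N \<Longrightarrow> gap (s m) (s n) < 1"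
    using cauchy_seqs_gap[OF assms, of 1] by auto
  have "len (s n) \<le> len (s N) + 1" if "n \<ge> N" for n
    using len_le_gap[of "s n" "s N"] N[of n N] that assms cauchy_seqs_closed by fastforce
  then show thesis
    using that[of "len (s N) + 1"] len_nonneg[OF cauchy_seqs_closed[OF assms]]
    by (fastforce simp: eventually_sequentially add_nonneg_pos)
qed

text \<open>
  The convergence is uniform on \<open>X\<close>, so the limit is again a function in \<open>C\<^sub>0(X)\<close>.
\<close>

lemma lim_form_uniform:
  assumes s: "s \<in> cauchy_seqs" and t: "t \<in> cauchy_seqs"
  shows "uniform_limit UNIV (\<lambda>n. form (s n) (t n)) (lim_form s t) sequentially"
proof -
  obtain M where M: "0 < M" "eventually (\<lambda>n. len (s n) \<le> M) sequentially"
    using cauchy_seqs_len_bounded[OF s] by blast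
  obtain K where K: "0 < K" "eventually (\<lambda>n. len (t n) \<le> K) sequentially"
    using cauchy_seqs_len_bounded[OF t] by blast
  have "uniformly_Cauchy_on UNIV (\<lambda>n. form (s n) (t n))"
  proof (rule uniformly_Cauchy_onI)
    fix e :: real assume "0 < e"
    obtain N1 where N1: "\<And>m n. m \<ge> N1 \<Longrightarrow> n \<ge> N1 \<Longrightarrow> gap (s m) (s n) < e / (2 * K)"
      using cauchy_seqs_gap[OF s, of "e / (2 * K)"] \<open>0 < e\<close> \<open>0 < K\<close> by auto
    obtain N2 where N2: "\<And>m n. m \<ge> N2 \<Longrightarrow> n \<ge> N2 \<Longrightarrow> gap (t m) (t n) < e / (2 * M)"
      using cauchy_seqs_gap[OF t, of "e / (2 * M)"] \<open>0 < e\<close> \<open>0 < M\<close> by auto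
    obtain N3 where N3: "\<And>n. n \<ge> N3 \<Longrightarrow> len (s n) \<le> M" "\<And>n. n \<ge> N3 \<Longrightarrow> len (t n) \<le> K"
      using eventually_conj[OF M(2) K(2)] unfolding eventually_sequentially by blast
    have "dist (form (s m) (t m) x) (form (s n) (t n) x) < e"
      if "m \<ge> max N1 (max N2 N3)" "n \<ge> max N1 (max N2 N3)" for m n x
    proof -
      note V = cauchy_seqs_closed[OF s] cauchy_seqs_closed[OF t]
      have "dist (form (s m) (t m) x) (form (s n) (t n) x)
          \<le> gap (s m) (s n) * len (t m) + len (s n) * gap (t m) (t n)"
        unfolding dist_norm using V by (intro form_gap_bound)
      also have "\<dots> \<le> gap (s m) (s n) * K + M * gap (t m) (t n)"
        using V N3 that by (intro add_mono mult_mono) (auto simp: gap_nonneg len_nonneg less_imp_le M K)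
      also have "\<dots> < e / (2 * K) * K + M * (e / (2 * M))"
        using N1[of m n] N2[of m n] that M(1) K(1)
        by (intro add_strict_mono mult_strict_right_mono mult_strict_left_mono) auto
      also have "\<dots> = e" using M(1) K(1) by simp
      finally show ?thesis .
    qed
    then show "\<exists>N. \<forall>x\<in>UNIV. \<forall>m\<ge>N. \<forall>n\<ge>N.
        dist (form (s m) (t m) x) (form (s n) (t n) x) < e" by blast
  qed
  then have "uniformly_convergent_on UNIV (\<lambda>n. form (s n) (t n))"
    by (rule Cauchy_uniformly_convergent)
  then show ?thesis
    unfolding uniformly_convergent_uniform_limit_iff lim_form_def[abs_def] .
qed

lemma lim_form_tendsto:
  "s \<in> cauchy_seqs \<Longrightarrow> t \<in> cauchy_seqs \<Longrightarrow> (\<lambda>n. form (s n) (t n) x) \<longlonglongrightarrow> lim_form s t x"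
  using tendsto_uniform_limitI[OF lim_form_uniform] by blast

lemma lim_form_eqI:
  "s \<in> cauchy_seqs \<Longrightarrow> t \<in> cauchy_seqs \<Longrightarrow> (\<lambda>n. form (s n) (t n) x) \<longlonglongrightarrow> c \<Longrightarrow> lim_form s t x = c"
  using lim_form_tendsto LIMSEQ_unique by blast

lemma lim_form_cong:
  assumes ss: "(s, s') \<in> null_rel" and tt: "(t, t') \<in> null_rel"
  shows "lim_form s t = lim_form s' t'"
proof
  fix x
  have C: "s \<in> cauchy_seqs" "s' \<in> cauchy_seqs" "t \<in> cauchy_seqs" "t' \<in> cauchy_seqs"
    and gs: "(\<lambda>n. gap (s n) (s' n)) \<longlonglongrightarrow> 0" and gt: "(\<lambda>n. gap (t n) (t' n)) \<longlonglongrightarrow> 0"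
    using ss tt by (auto simp: null_rel_def)
  note V = C[THEN cauchy_seqs_closed]
  obtain M where M: "0 < M" "eventually (\<lambda>n. len (s' n) \<le> M) sequentially"
    using cauchy_seqs_len_bounded[OF C(2)] by blast
  obtain K where K: "0 < K" "eventually (\<lambda>n. len (t n) \<le> K) sequentially"
    using cauchy_seqs_len_bounded[OF C(3)] by blast
  have "(\<lambda>n. form (s n) (t n) x - form (s' n) (t' n) x) \<longlonglongrightarrow> 0"
  proof (rule tendsto_0_le[where K = 1])
    show "(\<lambda>n. gap (s n) (s' n) * K + M * gap (t n) (t' n)) \<longlonglongrightarrow> 0"
      using tendsto_add[OF tendsto_mult_right[OF gs, of K] tendsto_mult_left[OF gt, of M]] by simp
    show "\<forall>\<^sub>F n in sequentially. cmod (form (s n) (t n) x - form (s' n) (t' n) x)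
        \<le> norm (gap (s n) (s' n) * K + M * gap (t n) (t' n)) * 1"
      using M(2) K(2)
    proof eventually_elim
      case (elim n)
      have "cmod (form (s n) (t n) x - form (s' n) (t' n) x)
          \<le> gap (s n) (s' n) * len (t n) + len (s' n) * gap (t n) (t' n)"
        using V by (intro form_gap_bound)
      also have "\<dots> \<le> gap (s n) (s' n) * K + M * gap (t n) (t' n)"
        using V elim by (intro add_mono mult_mono) (auto simp: gap_nonneg len_nonneg less_imp_le M K)
      finally show ?case by simp
    qed
  qed
  from tendsto_add[OF this lim_form_tendsto[OF C(2) C(4), of x]]
  show "lim_form s t x = lim_form s' t' x"
    using C by (intro lim_form_eqI) auto
qed

lemma ip_completion: "ip completion P Q = lim_form (rep P) (rep Q)"
  by (simp add: completion_def lim_form_def fun_eq_iff)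

lemma ip_cls: "s \<in> cauchy_seqs \<Longrightarrow> t \<in> cauchy_seqs \<Longrightarrow> ip completion (cls s) (cls t) = lim_form s t"
  unfolding ip_completion by (intro lim_form_cong rep_cls)

lemma ip_cls_right:
  "P \<in> carrier completion \<Longrightarrow> t \<in> cauchy_seqs \<Longrightarrow> ip completion P (cls t) = lim_form (rep P) t"
  using ip_cls[of "rep P" t] by (simp add: cls_rep)

lemma semi_inner_product_completion:
  "module_semi_inner_product X completion"
proof
  note R = cls_rep(1)
  have add_eq: "ring.add completion P Q = cls (\<lambda>n. add (rep P n) (rep Q n))"
    and scale_eq: "cscale completion z P = cls (\<lambda>n. scale z (rep P n))"
    and act_eq: "smult completion f P = cls (\<lambda>n. act f (rep P n))"
    and zero_eq: "ring.zero completion = cls (\<lambda>n. null)" for P Q f z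
    by (simp_all add: completion_def)
  show "ring.add completion P Q \<in> carrier completion"
    if "P \<in> carrier completion" "Q \<in> carrier completion" for P Q
    unfolding add_eq using that by (intro cls_closed cauchy_seqs_add R)
  show "cscale completion z P \<in> carrier completion" if "P \<in> carrier completion" for P z
    unfolding scale_eq using that by (intro cls_closed cauchy_seqs_scale R)
  show "smult completion f P \<in> carrier completion"
    if "f \<in> C0 X" "P \<in> carrier completion" for P f
    unfolding act_eq using that by (intro cls_closed cauchy_seqs_act R)
  show "ring.zero completion \<in> carrier completion"
    unfolding zero_eq by (intro cls_closed cauchy_seqs_const null_closed)
  show "ip completion P Q \<in> C0 X"
    if "P \<in> carrier completion" "Q \<in> carrier completion" for P Q
    unfolding ip_completion using that
    by (intro C0_uniform_limit[OF _ lim_form_uniform] form_closed cauchy_seqs_closed R)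
  show "ip completion P (ring.add completion Q S) x = ip completion P Q x + ip completion P S x"
    if "P \<in> carrier completion" "Q \<in> carrier completion" "S \<in> carrier completion" for P Q S x
  proof -
    have "lim_form (rep P) (\<lambda>n. add (rep Q n) (rep S n)) x =
        lim_form (rep P) (rep Q) x + lim_form (rep P) (rep S) x"
      using that tendsto_add[OF lim_form_tendsto lim_form_tendsto, OF R R R R, of P Q P S x x]
      by (intro lim_form_eqI cauchy_seqs_add R) (simp_all add: form_add cauchy_seqs_closed R)
    then show ?thesis
      unfolding add_eq using that by (simp add: ip_cls_right cauchy_seqs_add R) (simp add: ip_completion)
  qed
  show "ip completion P (cscale completion z Q) x = z * ip completion P Q x"
    if "P \<in> carrier completion" "Q \<in> carrier completion" for P Q z x
  proof -
    have "lim_form (rep P) (\<lambda>n. scale z (rep Q n)) x = z * lim_form (rep P) (rep Q) x"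
      using that tendsto_mult_left[OF lim_form_tendsto, OF R R, of P Q z x]
      by (intro lim_form_eqI cauchy_seqs_scale R) (simp_all add: form_scale cauchy_seqs_closed R)
    then show ?thesis
      unfolding scale_eq using that by (simp add: ip_cls_right cauchy_seqs_scale R) (simp add: ip_completion)
  qed
  show "ip completion P (smult completion f Q) x = f x * ip completion P Q x"
    if "f \<in> C0 X" "P \<in> carrier completion" "Q \<in> carrier completion" for P Q f x
  proof -
    have "lim_form (rep P) (\<lambda>n. act f (rep Q n)) x = f x * lim_form (rep P) (rep Q) x"
      using that tendsto_mult_left[OF lim_form_tendsto, OF R R, of P Q "f x" x]
      by (intro lim_form_eqI cauchy_seqs_act R) (simp_all add: form_act cauchy_seqs_closed R)
    then show ?thesis
      unfolding act_eq using that by (simp add: ip_cls_right cauchy_seqs_act R) (simp add: ip_completion)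
  qed
  show "ip completion P (ring.zero completion) x = 0" if "P \<in> carrier completion" for P x
    unfolding zero_eq using that
    by (simp add: ip_cls_right cauchy_seqs_const null_closed)
      (intro lim_form_eqI R cauchy_seqs_const null_closed,
        simp_all add: form_null R cauchy_seqs_closed)
  show "ip completion P Q x = cnj (ip completion Q P x)"
    if "P \<in> carrier completion" "Q \<in> carrier completion" for P Q x
    unfolding ip_completion using that
      tendsto_cnj[OF lim_form_tendsto, OF R R, of Q P x]
    by (intro lim_form_eqI R) (simp_all add: form_commute[of "rep P _"] R cauchy_seqs_closed)
  show "0 \<le> Re (ip completion P P x)" if "P \<in> carrier completion" for P x
    unfolding ip_completion
    by (rule LIMSEQ_le_const[OF tendsto_Re[OF lim_form_tendsto]])
      (use that R in \<open>auto intro!: form_nonneg cauchy_seqs_closed\<close>)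
qed

end


section \<open>Hilbert modules and nondegenerate semi-inner products\<close>

abbreviation "module_gap X A \<equiv> semi_inner_product.gap X (ring.add A) (cscale A) (ip A)"

text \<open>
  If \<open>gap\<close> is a genuine distance, then vectors with the same inner products are equal.  Each module
  axiom is an equation between vectors, and taking inner products turns it into an identity of complex
  numbers.
\<close>

lemma hilbert_C0_moduleI:
  fixes A :: "('x, 'a) hmodule" (structure)
  assumes sip: "module_semi_inner_product X A"
    and separated: "\<And>a b. \<lbrakk>a \<in> carrier A; b \<in> carrier A; module_gap X A a b = 0\<rbrakk> \<Longrightarrow> a = b"
    and complete: "\<And>s. \<lbrakk>\<And>n. s n \<in> carrier A;
        \<And>e. 0 < e \<Longrightarrow> \<exists>N. \<forall>m\<ge>N. \<forall>n\<ge>N. module_gap X A (s m) (s n) < e\<rbrakk>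
      \<Longrightarrow> \<exists>a \<in> carrier A. (\<lambda>n. module_gap X A (s n) a) \<longlonglongrightarrow> 0"
  shows "hilbert_C0_module X A"
proof -
  interpret S: module_semi_inner_product X A
    by (rule sip)
  have eqI: "a = b" if "a \<in> carrier A" "b \<in> carrier A"
    "\<And>t x. t \<in> carrier A \<Longrightarrow> ip A t a x = ip A t b x" for a b
    by (rule separated[OF that(1,2) S.gap_eq_0I[OF that]])
  note simps = S.closed_simps S.form_simps
  interpret abelian_group A
  proof (rule abelian_groupI)
    show "\<exists>b \<in> carrier A. b \<oplus> a = \<zero>" if "a \<in> carrier A" for a
      by (rule bexI[of _ "cscale A (- 1) a"], rule eqI) (use that in \<open>simp_all add: simps\<close>)
    show "a \<oplus> b \<oplus> c = a \<oplus> (b \<oplus> c)"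
      if "a \<in> carrier A" "b \<in> carrier A" "c \<in> carrier A" for a b c
      by (rule eqI) (use that in \<open>simp_all add: simps\<close>)
    show "a \<oplus> b = b \<oplus> a" if "a \<in> carrier A" "b \<in> carrier A" for a b
      by (rule eqI) (use that in \<open>simp_all add: simps\<close>)
    show "\<zero> \<oplus> a = a" if "a \<in> carrier A" for a
      by (rule eqI) (use that in \<open>simp_all add: simps\<close>)
  qed (simp_all add: simps)
  have uminus: "\<ominus> a = cscale A (- 1) a" if "a \<in> carrier A" for a
  proof (rule minus_equality)
    show "cscale A (- 1) a \<oplus> a = \<zero>"
      by (rule eqI) (use that in \<open>simp_all add: simps\<close>)
  qed (use that in \<open>simp_all add: simps\<close>)
  have hnorm_minus: "hnorm X A (a \<ominus> b) = S.gap a b" if "a \<in> carrier A" "b \<in> carrier A" for a b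
    using that by (simp add: S.gap_def S.len_def hnorm_def a_minus_def uminus)
  show ?thesis
  proof unfold_locales
    show "f \<odot> (a \<oplus> b) = f \<odot> a \<oplus> f \<odot> b"
      if "f \<in> C0 X" "a \<in> carrier A" "b \<in> carrier A" for f a b
      by (rule eqI) (use that in \<open>simp_all add: simps distrib_left\<close>)
    show "(\<lambda>x. f x + g x) \<odot> a = f \<odot> a \<oplus> g \<odot> a"
      if "f \<in> C0 X" "g \<in> C0 X" "a \<in> carrier A" for f g a
      by (rule eqI) (use that in \<open>simp_all add: simps C0_add distrib_right\<close>)
    show "(\<lambda>x. f x * g x) \<odot> a = f \<odot> (g \<odot> a)"
      if "f \<in> C0 X" "g \<in> C0 X" "a \<in> carrier A" for f g a
      by (rule eqI) (use that in \<open>simp_all add: simps C0_mult\<close>)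
    show "cscale A z (a \<oplus> b) = cscale A z a \<oplus> cscale A z b"
      if "a \<in> carrier A" "b \<in> carrier A" for z a b
      by (rule eqI) (use that in \<open>simp_all add: simps distrib_left\<close>)
    show "cscale A (z + w) a = cscale A z a \<oplus> cscale A w a" if "a \<in> carrier A" for z w a
      by (rule eqI) (use that in \<open>simp_all add: simps distrib_right\<close>)
    show "cscale A (z * w) a = cscale A z (cscale A w a)" if "a \<in> carrier A" for z w a
      by (rule eqI) (use that in \<open>simp_all add: simps\<close>)
    show "cscale A 1 a = a" if "a \<in> carrier A" for a
      by (rule eqI) (use that in \<open>simp_all add: simps\<close>)
    show "(\<lambda>x. z * f x) \<odot> a = cscale A z (f \<odot> a)" if "f \<in> C0 X" "a \<in> carrier A" for z f a
      by (rule eqI) (use that in \<open>simp_all add: simps C0_cmult\<close>)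
    show "f \<odot> cscale A z a = cscale A z (f \<odot> a)" if "f \<in> C0 X" "a \<in> carrier A" for z f a
      by (rule eqI) (use that in \<open>simp_all add: simps\<close>)
    show "ip A a b = (\<lambda>x. cnj (ip A b a x))" if "a \<in> carrier A" "b \<in> carrier A" for a b
      using S.form_commute[OF that] by blast
    show "ip A a a x \<in> \<real>\<^sub>\<ge>\<^sub>0" if "a \<in> carrier A" for a x
      using S.form_nonneg[OF that] S.form_self_Im[OF that] by (simp add: complex_nonneg_Reals_iff)
    show "a = \<zero>" if "a \<in> carrier A" "ip A a a = (\<lambda>x. 0)" for a
    proof (rule separated)
      have "S.gap a \<zero> = S.len a"
        unfolding S.gap_def using that(1) by (intro S.len_cong) (simp_all add: simps)
      also have "\<dots> \<le> 0" by (rule S.len_least) (simp_all add: that(2))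
      finally show "S.gap a \<zero> = 0" using S.gap_nonneg[OF that(1), of \<zero>] simps by simp
    qed (use that simps in simp_all)
    show "\<exists>a\<in>carrier A. (\<lambda>n. hnorm X A (s n \<ominus> a)) \<longlonglongrightarrow> 0"
      if s: "\<forall>n. s n \<in> carrier A"
        and c: "\<forall>e>0. \<exists>N. \<forall>m\<ge>N. \<forall>n\<ge>N. hnorm X A (s m \<ominus> s n) < e" for s
    proof -
      have "\<exists>a \<in> carrier A. (\<lambda>n. S.gap (s n) a) \<longlonglongrightarrow> 0"
        using s c by (intro complete) (simp_all add: hnorm_minus)
      then show ?thesis using s by (auto simp: hnorm_minus)
    qed
  qed (simp_all add: simps S.form_closed fun_eq_iff)
qed

context C0_module
begin

lemma cscale_zero: assumes "a \<in> carrier A" shows "cscale A 0 a = \<zero>"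
proof -
  have "cscale A 0 a \<oplus> cscale A 0 a = cscale A 0 a"
    using cscale_add_left[OF assms, of 0 0] by simp
  then show ?thesis using cscale_closed[OF assms, of 0]
    by (metis add.r_cancel_one')
qed

lemma uminus_eq_cscale: assumes "a \<in> carrier A" shows "\<ominus> a = cscale A (- 1) a"
proof (rule minus_equality)
  show "cscale A (- 1) a \<oplus> a = \<zero>"
    using cscale_add_left[OF assms, of "- 1" 1] assms by (simp add: cscale_one cscale_zero)
qed (use assms in \<open>simp_all add: cscale_closed\<close>)

end

sublocale hilbert_C0_module \<subseteq>
  sip: module_semi_inner_product X A
proof
  show "ip A a \<zero> x = 0" if "a \<in> carrier A" for a x
    using fun_cong[OF ip_add_right[OF that zero_closed zero_closed], of x] by simp
  show "ip A a b x = cnj (ip A b a x)" if "a \<in> carrier A" "b \<in> carrier A" for a b x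
    using fun_cong[OF ip_commute[OF that]] .
  show "0 \<le> Re (ip A a a x)" if "a \<in> carrier A" for a x
    using ip_nonneg[OF that, of x] by (simp add: complex_nonneg_Reals_iff)
qed (simp_all add: act_closed cscale_closed ip_closed ip_add_right ip_cscale_right ip_act_right)

context hilbert_C0_module
begin

lemma hnorm_eq_len: "hnorm X A a = sip.len a"
  by (simp add: hnorm_def sip.len_def)

lemma hnorm_minus_eq_gap: "a \<in> carrier A \<Longrightarrow> b \<in> carrier A \<Longrightarrow> hnorm X A (a \<ominus> b) = sip.gap a b"
  by (simp add: hnorm_eq_len sip.gap_def a_minus_def uminus_eq_cscale)

lemma ip_self_eq_zeroD:
  assumes "a \<in> carrier A" "\<And>x. Re (ip A a a x) \<le> 0" shows "a = \<zero>"
proof (rule ip_eq_zero[OF assms(1)])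
  show "ip A a a = (\<lambda>x. 0)"
    using sip.form_nonneg[OF assms(1)] sip.form_self_Im[OF assms(1)] assms(2)
    by (auto simp: complex_eq_iff fun_eq_iff intro: antisym)
qed

lemma eq_of_gap:
  assumes "a \<in> carrier A" "b \<in> carrier A" "sip.gap a b \<le> 0" shows "a = b"
proof -
  have C: "a \<oplus> cscale A (- 1) b \<in> carrier A" using assms by (simp add: cscale_closed)
  have len0: "sip.len (a \<oplus> cscale A (- 1) b) = 0"
    using assms sip.len_nonneg[OF C] by (simp add: sip.gap_def)
  have "a \<ominus> b = \<zero>"
    unfolding a_minus_def uminus_eq_cscale[OF assms(2)]
    using sip.len_upper[OF C] by (intro ip_self_eq_zeroD C) (simp add: len0)
  moreover have "a \<ominus> b \<oplus> b = a"
    unfolding a_minus_def using assms by (metis a_assoc a_inv_closed l_neg r_zero)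
  ultimately show ?thesis using assms by simp
qed

lemma ip_separates:
  assumes "a \<in> carrier A" "b \<in> carrier A" "\<And>t x. t \<in> carrier A \<Longrightarrow> ip A t a x = ip A t b x"
  shows "a = b"
  by (rule eq_of_gap[OF assms(1,2)]) (simp add: sip.gap_eq_0I assms)

end

section \<open>Completeness of the completion\<close>

context semi_inner_product
begin

interpretation comp: module_semi_inner_product X completion
  by (rule semi_inner_product_completion)

text \<open>
  The inner product of a difference with itself is a combination of four inner products, each of which
  converges uniformly; suprema pass to uniform limits.
\<close>

lemma gap_tendsto_comp_gap:
  assumes s: "s \<in> cauchy_seqs" and t: "t \<in> cauchy_seqs"
  shows "(\<lambda>n. gap (s n) (t n)) \<longlonglongrightarrow> comp.gap (cls s) (cls t)"
proof -
  define D where "D n = add (s n) (scale (- 1) (t n))" for n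
  have D: "D \<in> cauchy_seqs"
    unfolding D_def[abs_def] using s t by (intro cauchy_seqs_add cauchy_seqs_scale)
  have "ip completion (ring.add completion (cls s) (cscale completion (- 1) (cls t)))
      (ring.add completion (cls s) (cscale completion (- 1) (cls t))) x = lim_form D D x" for x
  proof (rule sym, rule lim_form_eqI[OF D D])
    have *: "form (D n) (D n) x = form (s n) (s n) x - form (s n) (t n) x
        - (form (t n) (s n) x - form (t n) (t n) x)" for n
      using s t by (simp add: D_def form_simps closed_simps cauchy_seqs_closed)
    have "(\<lambda>n. form (D n) (D n) x) \<longlonglongrightarrow> lim_form s s x - lim_form s t x
        - (lim_form t s x - lim_form t t x)"
      unfolding * using s t by (intro tendsto_diff lim_form_tendsto)
    also have "lim_form s s x - lim_form s t x - (lim_form t s x - lim_form t t x) =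
        ip completion (ring.add completion (cls s) (cscale completion (- 1) (cls t)))
          (ring.add completion (cls s) (cscale completion (- 1) (cls t))) x"
      using s t by (simp add: comp.form_simps comp.closed_simps cls_closed ip_cls)
    finally show "(\<lambda>n. form (D n) (D n) x) \<longlonglongrightarrow> \<dots>" .
  qed
  then have eq: "comp.gap (cls s) (cls t) = sqrt (sup_Re X (lim_form D D))"
    unfolding comp.gap_def comp.len_def by presburger
  have "(\<lambda>n. sqrt (sup_Re X (form (D n) (D n)))) \<longlonglongrightarrow> sqrt (sup_Re X (lim_form D D))"
    by (intro tendsto_real_sqrt sup_Re_tendsto lim_form_uniform form_closed cauchy_seqs_closed D)
  then show ?thesis
    unfolding eq gap_def len_def D_def .
qed

definition embed :: "'v \<Rightarrow> (nat \<Rightarrow> 'v) set" where "embed v = cls (\<lambda>n. v)"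

lemma embed_closed: "v \<in> V \<Longrightarrow> embed v \<in> carrier completion"
  by (simp add: embed_def cls_closed cauchy_seqs_const)

lemma comp_gap_embed_le:
  assumes "v \<in> V" "s \<in> cauchy_seqs" "eventually (\<lambda>n. gap v (s n) \<le> c) sequentially"
  shows "comp.gap (embed v) (cls s) \<le> c"
  using gap_tendsto_comp_gap[OF cauchy_seqs_const[OF assms(1)] assms(2)] assms(3)
  unfolding embed_def by (intro tendsto_upperbound) auto

lemma comp_gap_embed: "u \<in> V \<Longrightarrow> v \<in> V \<Longrightarrow> comp.gap (embed u) (embed v) = gap u v"
  using gap_tendsto_comp_gap[OF cauchy_seqs_const cauchy_seqs_const, of u v]
  unfolding embed_def by (simp add: LIMSEQ_const_iff)

lemma ip_embed: "u \<in> V \<Longrightarrow> v \<in> V \<Longrightarrow> ip completion (embed u) (embed v) x = form u v x"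
  unfolding embed_def ip_cls[OF cauchy_seqs_const cauchy_seqs_const]
  by (intro lim_form_eqI cauchy_seqs_const tendsto_const)

text \<open>
  Each member of a Cauchy sequence of classes is approximated by the class of a constant sequence
  within \<open>1 / (k + 1)\<close>.  The constants form a Cauchy sequence, and its class is the limit.
\<close>

theorem hilbert_C0_module_completion: "hilbert_C0_module X completion"
proof (rule hilbert_C0_moduleI)
  show "P = Q" if "P \<in> carrier completion" "Q \<in> carrier completion" "comp.gap P Q = 0" for P Q
    using gap_tendsto_comp_gap[of "rep P" "rep Q"] that cls_rep cls_eq_iff[of "rep P" "rep Q"]
    by (simp add: null_rel_def)
next
  fix S :: "nat \<Rightarrow> (nat \<Rightarrow> 'v) set"
  assume S: "\<And>k. S k \<in> carrier completion"
    and cauchy: "\<And>e. 0 < e \<Longrightarrow> \<exists>N. \<forall>m\<ge>N. \<forall>n\<ge>N. comp.gap (S m) (S n) < e"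
  have "\<exists>v \<in> V. comp.gap (embed v) (S k) \<le> 1 / (real k + 1)" for k
  proof -
    obtain N where N: "\<And>m n. m \<ge> N \<Longrightarrow> n \<ge> N \<Longrightarrow> gap (rep (S k) m) (rep (S k) n) < 1 / (real k + 1)"
      using cauchy_seqs_gap[OF cls_rep(1)[OF S], of "1 / (real k + 1)" k] by auto
    have "comp.gap (embed (rep (S k) N)) (cls (rep (S k))) \<le> 1 / (real k + 1)"
      using N by (intro comp_gap_embed_le cauchy_seqs_closed cls_rep(1) S)
        (auto simp: eventually_sequentially intro!: exI[of _ N] less_imp_le)
    then show ?thesis
      using cauchy_seqs_closed[OF cls_rep(1)[OF S]] unfolding cls_rep(2)[OF S] by blast
  qed
  then obtain p where p: "\<And>k. p k \<in> V"
    and p_near: "\<And>k. comp.gap (embed (p k)) (S k) \<le> 1 / (real k + 1)" by metis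
  have inv0: "(\<lambda>k. 1 / (real k + 1)) \<longlonglongrightarrow> 0"
    using LIMSEQ_inverse_real_of_nat by (simp add: inverse_eq_divide add.commute)
  have "\<exists>N. \<forall>m\<ge>N. \<forall>n\<ge>N. gap (p m) (p n) < e" if "0 < e" for e
  proof -
    obtain N1 where N1: "\<And>m n. m \<ge> N1 \<Longrightarrow> n \<ge> N1 \<Longrightarrow> comp.gap (S m) (S n) < e / 3"
      using cauchy[of "e / 3"] \<open>0 < e\<close> by auto
    have "eventually (\<lambda>k. 1 / (real k + 1) < e / 3) sequentially"
      using inv0 \<open>0 < e\<close> by (intro order_tendstoD) auto
    then obtain N2 where N2: "\<And>k. k \<ge> N2 \<Longrightarrow> 1 / (real k + 1) < e / 3"
      unfolding eventually_sequentially by blast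
    have "gap (p m) (p n) < e" if "m \<ge> max N1 N2" "n \<ge> max N1 N2" for m n
    proof -
      have "gap (p m) (p n) = comp.gap (embed (p m)) (embed (p n))"
        using p by (simp add: comp_gap_embed)
      also have "\<dots> \<le> comp.gap (embed (p m)) (S m) + comp.gap (S m) (embed (p n))"
        by (intro comp.gap_triangle embed_closed p S)
      also have "comp.gap (S m) (embed (p n)) \<le> comp.gap (S m) (S n) + comp.gap (S n) (embed (p n))"
        by (intro comp.gap_triangle embed_closed p S)
      also have "comp.gap (S n) (embed (p n)) = comp.gap (embed (p n)) (S n)"
        by (intro comp.gap_commute embed_closed p S)
      finally show ?thesis
        using p_near[of m] p_near[of n] N1[of m n] N2[of m] N2[of n] that by simp
    qed
    then show ?thesis by blast
  qed
  then have pC: "p \<in> cauchy_seqs" using p by (simp add: cauchy_seqs_def)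
  have "(\<lambda>k. comp.gap (embed (p k)) (cls p)) \<longlonglongrightarrow> 0"
  proof (rule metric_LIMSEQ_I)
    fix e :: real assume "0 < e"
    obtain N where N: "\<And>m n. m \<ge> N \<Longrightarrow> n \<ge> N \<Longrightarrow> gap (p m) (p n) < e / 2"
      using cauchy_seqs_gap[OF pC, of "e / 2"] \<open>0 < e\<close> by auto
    have "dist (comp.gap (embed (p k)) (cls p)) 0 < e" if "k \<ge> N" for k
    proof -
      have "comp.gap (embed (p k)) (cls p) \<le> e / 2"
        using N that by (intro comp_gap_embed_le p pC)
          (auto simp: eventually_sequentially intro!: exI[of _ N] less_imp_le)
      then show ?thesis
        using comp.gap_nonneg[OF embed_closed[OF p] cls_closed[OF pC], of k] \<open>0 < e\<close> by simp
    qed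
    then show "\<exists>N. \<forall>k\<ge>N. dist (comp.gap (embed (p k)) (cls p)) 0 < e" by blast
  qed
  from tendsto_add[OF inv0 this]
  have *: "(\<lambda>k. 1 / (real k + 1) + comp.gap (embed (p k)) (cls p)) \<longlonglongrightarrow> 0" by simp
  have "(\<lambda>k. comp.gap (S k) (cls p)) \<longlonglongrightarrow> 0"
  proof (rule tendsto_sandwich[OF _ _ tendsto_const *])
    have "comp.gap (S k) (cls p) \<le> 1 / (real k + 1) + comp.gap (embed (p k)) (cls p)" for k
      using comp.gap_triangle[OF S embed_closed[OF p] cls_closed[OF pC], of k k] p_near[of k]
        comp.gap_commute[OF S embed_closed[OF p], of k k] by linarith
    then show "\<forall>\<^sub>F k in sequentially. comp.gap (S k) (cls p)
        \<le> 1 / (real k + 1) + comp.gap (embed (p k)) (cls p)" by simp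
  qed (simp add: comp.gap_nonneg S cls_closed pC)
  then show "\<exists>a \<in> carrier completion. (\<lambda>k. comp.gap (S k) a) \<longlonglongrightarrow> 0"
    using cls_closed[OF pC] by blast
qed (rule semi_inner_product_completion)

end

section \<open>Extending contractions to completions\<close>

locale contraction =
  S: semi_inner_product X V addV scaleV actV nullV formV +
  T: semi_inner_product X W addW scaleW actW nullW formW
  for X :: "'x topology"
    and V :: "'v set" and addV scaleV actV nullV formV
    and W :: "'w set" and addW scaleW actW nullW formW +
  fixes \<phi> :: "'v \<Rightarrow> 'w"
  assumes map_closed: "v \<in> V \<Longrightarrow> \<phi> v \<in> W"
    and map_add: "\<lbrakk>u \<in> V; v \<in> V\<rbrakk> \<Longrightarrow> \<phi> (addV u v) = addW (\<phi> u) (\<phi> v)"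
    and map_scale: "v \<in> V \<Longrightarrow> \<phi> (scaleV z v) = scaleW z (\<phi> v)"
    and map_act: "\<lbrakk>f \<in> C0 X; v \<in> V\<rbrakk> \<Longrightarrow> \<phi> (actV f v) = actW f (\<phi> v)"
    and map_contract: "v \<in> V \<Longrightarrow> Re (formW (\<phi> v) (\<phi> v) x) \<le> Re (formV v v x)"
begin

interpretation T_comp: module_semi_inner_product X "T.completion"
  by (rule T.semi_inner_product_completion)

definition extend :: "(nat \<Rightarrow> 'v) set \<Rightarrow> (nat \<Rightarrow> 'w) set" where
  "extend P = T.cls (\<lambda>n. \<phi> (S.rep P n))"

lemma len_map: "v \<in> V \<Longrightarrow> T.len (\<phi> v) \<le> S.len v"
  using S.len_upper[of v] map_contract[of v] S.len_nonneg[of v]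
  by (intro T.len_least) (auto intro: order_trans)

lemma gap_map: assumes "u \<in> V" "v \<in> V" shows "T.gap (\<phi> u) (\<phi> v) \<le> S.gap u v"
  using len_map[of "addV u (scaleV (- 1) v)"] assms
  by (simp add: S.gap_def T.gap_def map_add map_scale S.closed_simps)

lemma gap_map_eq:
  assumes iso: "\<And>v x. v \<in> V \<Longrightarrow> Re (formW (\<phi> v) (\<phi> v) x) = Re (formV v v x)"
    and "u \<in> V" "v \<in> V"
  shows "T.gap (\<phi> u) (\<phi> v) = S.gap u v"
proof -
  have D: "addV u (scaleV (- 1) v) \<in> V" by (intro S.closed_simps assms)
  have eq: "addW (\<phi> u) (scaleW (- 1) (\<phi> v)) = \<phi> (addV u (scaleV (- 1) v))"
    using assms(2,3) by (simp add: map_add map_scale S.closed_simps)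
  have "formW (\<phi> w) (\<phi> w) = formV w w" if "w \<in> V" for w
    using iso[OF that] S.form_self_eq_of_real[OF that] T.form_self_eq_of_real[OF map_closed[OF that]]
    by (intro ext) metis
  then show ?thesis
    unfolding S.gap_def T.gap_def S.len_def T.len_def eq using D by simp
qed

lemma cauchy_seqs_map:
  assumes s: "s \<in> S.cauchy_seqs" shows "(\<lambda>n. \<phi> (s n)) \<in> T.cauchy_seqs"
proof -
  have "\<exists>N. \<forall>m\<ge>N. \<forall>n\<ge>N. T.gap (\<phi> (s m)) (\<phi> (s n)) < e" if e: "0 < e" for e
  proof -
    obtain N where N: "\<And>m n. m \<ge> N \<Longrightarrow> n \<ge> N \<Longrightarrow> S.gap (s m) (s n) < e"
      using S.cauchy_seqs_gap[OF s e] by blast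
    show ?thesis
      using N order_le_less_trans[OF gap_map[OF S.cauchy_seqs_closed[OF s] S.cauchy_seqs_closed[OF s]]]
      by blast
  qed
  then show ?thesis
    using S.cauchy_seqs_closed[OF s] by (simp add: T.cauchy_seqs_def map_closed)
qed

lemma extend_closed: "P \<in> carrier S.completion \<Longrightarrow> extend P \<in> carrier T.completion"
  unfolding extend_def by (intro T.cls_closed cauchy_seqs_map S.cls_rep)

lemma extend_cls:
  assumes s: "s \<in> S.cauchy_seqs" shows "extend (S.cls s) = T.cls (\<lambda>n. \<phi> (s n))"
proof -
  let ?r = "S.rep (S.cls s)"
  have rel: "(?r, s) \<in> S.null_rel" by (rule S.rep_cls[OF s])
  then have r: "?r \<in> S.cauchy_seqs" and lim: "(\<lambda>n. S.gap (?r n) (s n)) \<longlonglongrightarrow> 0"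
    by (auto simp: S.null_rel_def)
  note V = S.cauchy_seqs_closed[OF r] S.cauchy_seqs_closed[OF s]
  have "(\<lambda>n. T.gap (\<phi> (?r n)) (\<phi> (s n))) \<longlonglongrightarrow> 0"
  proof (rule tendsto_sandwich[OF _ _ tendsto_const lim])
    show "\<forall>\<^sub>F n in sequentially. T.gap (\<phi> (?r n)) (\<phi> (s n)) \<le> S.gap (?r n) (s n)"
      by (intro always_eventually allI gap_map V)
    show "\<forall>\<^sub>F n in sequentially. 0 \<le> T.gap (\<phi> (?r n)) (\<phi> (s n))"
      by (intro always_eventually allI T.gap_nonneg map_closed V)
  qed
  then show ?thesis
    unfolding extend_def by (simp add: T.cls_eq_iff T.null_rel_def cauchy_seqs_map r s)
qed

lemma ip_extend_right:
  "R \<in> carrier T.completion \<Longrightarrow> P \<in> carrier S.completion \<Longrightarrow>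
    ip T.completion R (extend P) = T.lim_form (T.rep R) (\<lambda>n. \<phi> (S.rep P n))"
  unfolding extend_def by (intro T.ip_cls_right cauchy_seqs_map S.cls_rep)

lemma ip_extend:
  "P \<in> carrier S.completion \<Longrightarrow> Q \<in> carrier S.completion \<Longrightarrow>
    ip T.completion (extend P) (extend Q) = T.lim_form (\<lambda>n. \<phi> (S.rep P n)) (\<lambda>n. \<phi> (S.rep Q n))"
  unfolding extend_def by (intro T.ip_cls cauchy_seqs_map S.cls_rep)

text \<open>
  Values of \<open>extend\<close> are compared through their inner products with the elements of the target, which
  are limits of inner products in \<open>W\<close>.
\<close>

lemma C0_linear_extend: "C0_linear X S.completion T.completion extend"
proof -
  interpret H: hilbert_C0_module X T.completion by (rule T.hilbert_C0_module_completion)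
  note C = S.cls_rep(1) T.cls_rep(1)
  have E: "extend P \<in> carrier T.completion" if "P \<in> carrier S.completion" for P
    by (rule extend_closed[OF that])
  have eq: "extend (S.cls s) = Q"
    if "s \<in> S.cauchy_seqs" "Q \<in> carrier T.completion"
      and "\<And>R x. R \<in> carrier T.completion \<Longrightarrow>
        (\<lambda>n. formW (T.rep R n) (\<phi> (s n)) x) \<longlonglongrightarrow> ip T.completion R Q x" for s Q
  proof (rule H.ip_separates)
    show "extend (S.cls s) \<in> carrier T.completion" by (intro E S.cls_closed that)
    fix R x assume R: "R \<in> carrier T.completion"
    have "ip T.completion R (extend (S.cls s)) x = T.lim_form (T.rep R) (\<lambda>n. \<phi> (s n)) x"
      by (simp add: extend_cls that(1) T.ip_cls_right[OF R cauchy_seqs_map[OF that(1)]])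
    also have "\<dots> = ip T.completion R Q x"
      by (intro T.lim_form_eqI C cauchy_seqs_map that R)
    finally show "ip T.completion R (extend (S.cls s)) x = ip T.completion R Q x" .
  qed (rule that(2))
  have lim: "(\<lambda>n. formW (T.rep R n) (\<phi> (S.rep P n)) x) \<longlonglongrightarrow> ip T.completion R (extend P) x"
    if "P \<in> carrier S.completion" "R \<in> carrier T.completion" for P R x
    unfolding ip_extend_right[OF that(2,1)] by (intro T.lim_form_tendsto C cauchy_seqs_map that)
  have W: "T.rep R n \<in> W" if "R \<in> carrier T.completion" for R n
    by (intro T.cauchy_seqs_closed C that)
  have V: "S.rep P n \<in> V" if "P \<in> carrier S.completion" for P n
    by (intro S.cauchy_seqs_closed C that)
  show ?thesis
    unfolding C0_linear_def
  proof (intro conjI ballI allI)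
    fix P Q assume PQ: "P \<in> carrier S.completion" "Q \<in> carrier S.completion"
    have "extend (S.cls (\<lambda>n. addV (S.rep P n) (S.rep Q n))) =
        extend P \<oplus>\<^bsub>T.completion\<^esub> extend Q"
    proof (rule eq)
      fix R x assume R: "R \<in> carrier T.completion"
      show "(\<lambda>n. formW (T.rep R n) (\<phi> (addV (S.rep P n) (S.rep Q n))) x)
          \<longlonglongrightarrow> ip T.completion R (extend P \<oplus>\<^bsub>T.completion\<^esub> extend Q) x"
        using tendsto_add[OF lim[OF PQ(1) R, of x] lim[OF PQ(2) R, of x]] PQ R
        by (simp add: map_add T.form_add W V map_closed T_comp.form_add E)
    qed (use PQ in \<open>simp_all add: S.cauchy_seqs_add C E\<close>)
    then show "extend (P \<oplus>\<^bsub>S.completion\<^esub> Q) = extend P \<oplus>\<^bsub>T.completion\<^esub> extend Q"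
      by (simp add: S.completion_def)
  next
    fix z P assume P: "P \<in> carrier S.completion"
    have "extend (S.cls (\<lambda>n. scaleV z (S.rep P n))) = cscale T.completion z (extend P)"
    proof (rule eq)
      fix R x assume R: "R \<in> carrier T.completion"
      show "(\<lambda>n. formW (T.rep R n) (\<phi> (scaleV z (S.rep P n))) x)
          \<longlonglongrightarrow> ip T.completion R (cscale T.completion z (extend P)) x"
        using tendsto_mult_left[OF lim[OF P R, of x], of z] P R
        by (simp add: map_scale T.form_scale W V map_closed T_comp.form_scale E)
    qed (use P in \<open>simp_all add: S.cauchy_seqs_scale C E T_comp.scale_closed\<close>)
    then show "extend (cscale S.completion z P) = cscale T.completion z (extend P)"
      by (simp add: S.completion_def)
  next
    fix f P assume f: "f \<in> C0 X" and P: "P \<in> carrier S.completion"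
    have "extend (S.cls (\<lambda>n. actV f (S.rep P n))) = f \<odot>\<^bsub>T.completion\<^esub> extend P"
    proof (rule eq)
      fix R x assume R: "R \<in> carrier T.completion"
      show "(\<lambda>n. formW (T.rep R n) (\<phi> (actV f (S.rep P n))) x)
          \<longlonglongrightarrow> ip T.completion R (f \<odot>\<^bsub>T.completion\<^esub> extend P) x"
        using tendsto_mult_left[OF lim[OF P R, of x], of "f x"] P R f
        by (simp add: map_act T.form_act W V map_closed T_comp.form_act E)
    qed (use P f in \<open>simp_all add: S.cauchy_seqs_act C E T_comp.act_closed\<close>)
    then show "extend (f \<odot>\<^bsub>S.completion\<^esub> P) = f \<odot>\<^bsub>T.completion\<^esub> extend P"
      by (simp add: S.completion_def)
  qed
qed

lemma ip_extend_le:
  assumes P: "P \<in> carrier S.completion"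
  shows "Re (ip T.completion (extend P) (extend P) x) \<le> Re (ip S.completion P P x)"
proof -
  have r: "S.rep P \<in> S.cauchy_seqs" by (rule S.cls_rep[OF P])
  show ?thesis
    unfolding ip_extend[OF P P] S.ip_completion
    by (rule LIMSEQ_le[OF tendsto_Re[OF T.lim_form_tendsto] tendsto_Re[OF S.lim_form_tendsto]])
      (auto intro!: cauchy_seqs_map r map_contract S.cauchy_seqs_closed[OF r])
qed

lemma ip_extend_eq:
  assumes iso: "\<And>u v x. u \<in> V \<Longrightarrow> v \<in> V \<Longrightarrow> formW (\<phi> u) (\<phi> v) x = formV u v x"
    and P: "P \<in> carrier S.completion" and Q: "Q \<in> carrier S.completion"
  shows "ip T.completion (extend P) (extend Q) = ip S.completion P Q"
proof -
  have r: "S.rep P \<in> S.cauchy_seqs" "S.rep Q \<in> S.cauchy_seqs"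
    using P Q S.cls_rep by auto
  then show ?thesis
    unfolding ip_extend[OF P Q] S.ip_completion T.lim_form_def[abs_def] S.lim_form_def[abs_def]
    by (simp add: iso S.cauchy_seqs_closed)
qed

lemma extend_embed: "v \<in> V \<Longrightarrow> extend (S.embed v) = T.embed (\<phi> v)"
  unfolding S.embed_def T.embed_def by (intro extend_cls S.cauchy_seqs_const)

text \<open>
  Every Cauchy sequence in \<open>W\<close> lifts term by term to a sequence in \<open>V\<close>, which is Cauchy because \<open>\<phi>\<close>
  preserves the form.
\<close>

lemma extend_surj:
  assumes iso: "\<And>u v x. u \<in> V \<Longrightarrow> v \<in> V \<Longrightarrow> formW (\<phi> u) (\<phi> v) x = formV u v x"
    and onto: "\<And>w. w \<in> W \<Longrightarrow> \<exists>v \<in> V. T.gap (\<phi> v) w = 0"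
    and Q: "Q \<in> carrier T.completion"
  shows "\<exists>P \<in> carrier S.completion. extend P = Q"
proof -
  have t: "T.rep Q \<in> T.cauchy_seqs" "T.cls (T.rep Q) = Q" using T.cls_rep[OF Q] by auto
  note W = T.cauchy_seqs_closed[OF t(1)]
  obtain s where s: "\<And>n. s n \<in> V" "\<And>n. T.gap (\<phi> (s n)) (T.rep Q n) = 0"
    using onto[OF W] by metis
  have near: "S.gap (s m) (s n) \<le> T.gap (T.rep Q m) (T.rep Q n)" for m n
  proof -
    note C = map_closed[OF s(1)]
    have "S.gap (s m) (s n) = T.gap (\<phi> (s m)) (\<phi> (s n))"
      by (rule gap_map_eq[symmetric]) (simp_all add: iso s)
    also have "\<dots> \<le> T.gap (\<phi> (s m)) (T.rep Q m) + T.gap (T.rep Q m) (\<phi> (s n))"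
      by (intro T.gap_triangle C W)
    also have "T.gap (T.rep Q m) (\<phi> (s n)) \<le>
        T.gap (T.rep Q m) (T.rep Q n) + T.gap (T.rep Q n) (\<phi> (s n))"
      by (intro T.gap_triangle C W)
    also have "T.gap (T.rep Q n) (\<phi> (s n)) = T.gap (\<phi> (s n)) (T.rep Q n)"
      by (intro T.gap_commute C W)
    finally show ?thesis by (simp add: s)
  qed
  have "\<exists>N. \<forall>m\<ge>N. \<forall>n\<ge>N. S.gap (s m) (s n) < e" if e: "0 < e" for e
  proof -
    obtain N where N: "\<And>m n. m \<ge> N \<Longrightarrow> n \<ge> N \<Longrightarrow> T.gap (T.rep Q m) (T.rep Q n) < e"
      using T.cauchy_seqs_gap[OF t(1) e] by blast
    show ?thesis using order_le_less_trans[OF near N] by blast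
  qed
  then have sC: "s \<in> S.cauchy_seqs" using s(1) by (simp add: S.cauchy_seqs_def)
  have "extend (S.cls s) = Q"
  proof -
    have "((\<lambda>n. \<phi> (s n)), T.rep Q) \<in> T.null_rel"
      by (simp add: t cauchy_seqs_map sC T.null_rel_def s)
    then have "T.cls (\<lambda>n. \<phi> (s n)) = T.cls (T.rep Q)"
      using T.cls_eq_iff[OF cauchy_seqs_map[OF sC] t(1)] by blast
    then show ?thesis unfolding extend_cls[OF sC] t(2) .
  qed
  then show ?thesis using S.cls_closed[OF sC] by blast
qed

end


section \<open>The Schur product theorem\<close>

definition positive_kernel :: "'i set \<Rightarrow> ('i \<Rightarrow> 'i \<Rightarrow> complex) \<Rightarrow> bool" where
  "positive_kernel I G \<longleftrightarrow> (\<forall>i\<in>I. \<forall>j\<in>I. G i j = cnj (G j i)) \<and>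
     (\<forall>c. 0 \<le> Re (\<Sum>i\<in>I. \<Sum>j\<in>I. cnj (c i) * c j * G i j))"

lemma sum_insert_twice:
  assumes "finite I" "k \<notin> I"
  shows "(\<Sum>i\<in>insert k I. \<Sum>j\<in>insert k I. f i j) =
    f k k + (\<Sum>j\<in>I. f k j) + (\<Sum>i\<in>I. f i k) + (\<Sum>i\<in>I. \<Sum>j\<in>I. f i j :: complex)"
  using assms by (simp add: sum.distrib add_ac)

text \<open>
  The quadratic form at the vector with entries \<open>c\<close> on \<open>I\<close> and \<open>t\<close> at the new index \<open>k\<close>, expanded in \<open>t\<close>.
\<close>

lemma positive_kernel_insert:
  assumes I: "finite I" "k \<notin> I" and G: "positive_kernel (insert k I) G"
  shows "0 \<le> (cmod t)\<^sup>2 * Re (G k k) + 2 * Re (cnj t * (\<Sum>j\<in>I. c j * G k j))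
    + Re (\<Sum>i\<in>I. \<Sum>j\<in>I. cnj (c i) * c j * G i j)"
proof -
  define S where "S = (\<Sum>j\<in>I. c j * G k j)"
  define Q where "Q = (\<Sum>i\<in>I. \<Sum>j\<in>I. cnj (c i) * c j * G i j)"
  define d where "d i = (if i = k then t else c i)" for i
  have dI: "d i = c i" if "i \<in> I" for i using that I(2) by (auto simp: d_def)
  have dk: "d k = t" by (simp add: d_def)
  have herm: "G i k = cnj (G k i)" if "i \<in> I" for i
    using G that unfolding positive_kernel_def by blast
  have "0 \<le> Re (\<Sum>i\<in>insert k I. \<Sum>j\<in>insert k I. cnj (d i) * d j * G i j)"
    using G unfolding positive_kernel_def by blast
  also have "(\<Sum>i\<in>insert k I. \<Sum>j\<in>insert k I. cnj (d i) * d j * G i j) =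
      cnj t * t * G k k + cnj t * S + t * cnj S + Q"
    unfolding S_def Q_def sum_insert_twice[OF I] dk sum_distrib_left cnj_sum
    by (simp add: dI herm mult_ac cong: sum.cong)
  also have "t * cnj S = cnj (cnj t * S)"
    by simp
  also have "cnj t * t = of_real ((cmod t)\<^sup>2)"
    by (subst mult.commute) (rule complex_norm_square[symmetric])
  finally show ?thesis unfolding S_def[symmetric] Q_def[symmetric] by (simp add: algebra_simps)
qed

text \<open>
  Induction on the index set by Gaussian elimination: subtracting from \<open>G\<close> the rank one kernel
  \<open>G i k * G k j / G k k\<close> clears the row and the column of \<open>k\<close> and leaves a positive kernel, while the
  rank one part contributes a nonnegative multiple of the quadratic form of \<open>H\<close> at the row \<open>G k\<close>.
\<close>

theorem Schur_product_nonneg: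
  assumes "finite I" "positive_kernel I G" "positive_kernel I H"
  shows "0 \<le> Re (\<Sum>i\<in>I. \<Sum>j\<in>I. G i j * H i j)"
  using assms
proof (induction I arbitrary: G rule: finite_induct)
  case empty
  then show ?case by simp
next
  case (insert k I)
  note G = insert.prems(1) and H = insert.prems(2) and I = insert.hyps
  have herm: "G i j = cnj (G j i)" if "i \<in> insert k I" "j \<in> insert k I" for i j
    using G that unfolding positive_kernel_def by blast
  have H_I: "positive_kernel I H"
    unfolding positive_kernel_def
  proof (intro conjI allI)
    show "\<forall>i\<in>I. \<forall>j\<in>I. H i j = cnj (H j i)"
      using H unfolding positive_kernel_def by blast
    show "0 \<le> Re (\<Sum>i\<in>I. \<Sum>j\<in>I. cnj (c i) * c j * H i j)" for c
      using positive_kernel_insert[OF I H, of 0 c] by simp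
  qed
  define g where "g = Re (G k k)"
  have Gkk: "G k k = of_real g"
    using arg_cong[OF herm[of k k], of Im] by (simp add: g_def complex_eq_iff)
  have "0 \<le> g"
    using positive_kernel_insert[OF I G, of 1 "\<lambda>_. 0"] by (simp add: g_def)
  \<comment> \<open>For \<open>g = 0\<close> nothing is subtracted, since division by 0 gives 0; the row of \<open>k\<close> is then 0 by positivity.\<close>
  define G' where "G' i j = G i j - G i k * G k j / of_real g" for i j
  have "positive_kernel I G'"
    unfolding positive_kernel_def
  proof (intro conjI allI ballI)
    show "G' i j = cnj (G' j i)" if "i \<in> I" "j \<in> I" for i j
      using herm[of i j] herm[of i k] herm[of k j] that by (simp add: G'_def mult.commute)
    fix c
    define S where "S = (\<Sum>j\<in>I. c j * G k j)"
    have S': "(\<Sum>i\<in>I. cnj (c i) * G i k) = cnj S"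
      unfolding S_def cnj_sum using herm[of _ k] by (intro sum.cong) auto
    have "(\<Sum>i\<in>I. \<Sum>j\<in>I. cnj (c i) * c j * G' i j) =
        (\<Sum>i\<in>I. \<Sum>j\<in>I. cnj (c i) * c j * G i j)
        - (\<Sum>i\<in>I. \<Sum>j\<in>I. (cnj (c i) * G i k) * (c j * G k j)) / of_real g"
      unfolding G'_def sum_divide_distrib sum_subtractf[symmetric]
      by (intro sum.cong refl) (simp add: algebra_simps)
    also have "(\<Sum>i\<in>I. \<Sum>j\<in>I. (cnj (c i) * G i k) * (c j * G k j)) = cnj S * S"
      unfolding sum_product[symmetric] S' by (simp add: S_def)
    also have "cnj S * S = of_real ((cmod S)\<^sup>2)"
      by (subst mult.commute) (rule complex_norm_square[symmetric])
    finally have eq: "Re (\<Sum>i\<in>I. \<Sum>j\<in>I. cnj (c i) * c j * G' i j) =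
        Re (\<Sum>i\<in>I. \<Sum>j\<in>I. cnj (c i) * c j * G i j) - (cmod S)\<^sup>2 / g"
      by (simp only: minus_complex.sel Re_divide_of_real Re_complex_of_real)
    \<comment> \<open>For \<open>g > 0\<close> this entry at \<open>k\<close> minimises the quadratic form when the entries on \<open>I\<close> are \<open>c\<close>.\<close>
    define t where "t = - (S / of_real g)"
    have "cnj t * S = - of_real ((cmod S)\<^sup>2 / g)"
      unfolding t_def of_real_divide complex_norm_square by (simp add: mult.commute)
    moreover have "(cmod t)\<^sup>2 * g = (cmod S)\<^sup>2 / g"
      using \<open>0 \<le> g\<close> by (simp add: t_def norm_divide power_divide power2_eq_square)
    ultimately show "0 \<le> Re (\<Sum>i\<in>I. \<Sum>j\<in>I. cnj (c i) * c j * G' i j)"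
      using positive_kernel_insert[OF I G, of t c] unfolding eq S_def[symmetric] g_def[symmetric]
      by simp
  qed
  then have IH: "0 \<le> Re (\<Sum>i\<in>I. \<Sum>j\<in>I. G' i j * H i j)"
    using insert.IH H_I by blast
  have row: "G' k j = 0" if "j \<in> insert k I" for j
  proof (cases "g = 0")
    case False
    then show ?thesis by (simp add: G'_def Gkk)
  next
    case True
    have "G k j = 0"
    proof (cases "j = k")
      case False
      then have "j \<in> I" using that by simp
      define c where "c i = (if i = j then 1 else 0 :: complex)" for i
      have S: "(\<Sum>i\<in>I. c i * G k i) = G k j"
        using \<open>j \<in> I\<close> I(1) by (simp add: c_def if_distrib[of "\<lambda>x. x * _"] cong: if_cong)
      define Q where "Q = Re (\<Sum>i\<in>I. \<Sum>j\<in>I. cnj (c i) * c j * G i j)"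
      have pos: "0 \<le> 2 * Re (cnj t * G k j) + Q" for t
        using positive_kernel_insert[OF I G, of t c] True unfolding S Q_def g_def by simp
      show ?thesis
      proof (rule ccontr)
        assume ne: "G k j \<noteq> 0"
        \<comment> \<open>The form is affine in the entry at \<open>k\<close>, so it would take negative values.\<close>
        define r where "r = (\<bar>Q\<bar> + 1) / (cmod (G k j))\<^sup>2"
        have "cnj (- of_real r * G k j) * G k j = - of_real (r * (cmod (G k j))\<^sup>2)"
          unfolding of_real_mult complex_norm_square by (simp add: mult_ac)
        also have "r * (cmod (G k j))\<^sup>2 = \<bar>Q\<bar> + 1" using ne by (simp add: r_def)
        finally show False using pos[of "- of_real r * G k j"] by simp
      qed
    qed (simp add: Gkk True)
    then show ?thesis by (simp add: G'_def Gkk True)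
  qed
  have col: "G' i k = 0" if "i \<in> I" for i
  proof -
    have "G' i k = cnj (G' k i)"
      using that herm[of i k] herm[of k k] by (simp add: G'_def mult.commute Gkk)
    then show ?thesis using row[of i] that by simp
  qed
  have "(\<Sum>i\<in>insert k I. \<Sum>j\<in>insert k I. G i j * H i j) =
      (\<Sum>i\<in>insert k I. \<Sum>j\<in>insert k I. G i k * G k j / of_real g * H i j) +
      (\<Sum>i\<in>insert k I. \<Sum>j\<in>insert k I. G' i j * H i j)"
    unfolding sum.distrib[symmetric] G'_def by (intro sum.cong refl) (simp add: algebra_simps)
  also have "(\<Sum>i\<in>insert k I. \<Sum>j\<in>insert k I. G' i j * H i j) = (\<Sum>i\<in>I. \<Sum>j\<in>I. G' i j * H i j)"
    unfolding sum_insert_twice[OF I] by (simp add: row col)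
  also have "(\<Sum>i\<in>insert k I. \<Sum>j\<in>insert k I. G i k * G k j / of_real g * H i j) =
      (\<Sum>i\<in>insert k I. \<Sum>j\<in>insert k I. cnj (G k i) * G k j * H i j) / of_real g"
    unfolding sum_divide_distrib using herm[of _ k] by (intro sum.cong refl) simp
  finally have "Re (\<Sum>i\<in>insert k I. \<Sum>j\<in>insert k I. G i j * H i j) =
      Re (\<Sum>i\<in>insert k I. \<Sum>j\<in>insert k I. cnj (G k i) * G k j * H i j) / g
      + Re (\<Sum>i\<in>I. \<Sum>j\<in>I. G' i j * H i j)"
    by simp
  moreover have "0 \<le> Re (\<Sum>i\<in>insert k I. \<Sum>j\<in>insert k I. cnj (G k i) * G k j * H i j)"
    using H unfolding positive_kernel_def by blast
  ultimately show ?case using IH \<open>0 \<le> g\<close> by simp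
qed

context semi_inner_product
begin

lemma ex_combination:
  assumes "finite I" "\<And>i. i \<in> I \<Longrightarrow> v i \<in> V"
  shows "\<exists>w \<in> V. \<forall>t \<in> V. \<forall>x. form t w x = (\<Sum>i\<in>I. c i * form t (v i) x)"
  using assms
proof (induction I rule: finite_induct)
  case empty
  then show ?case using null_closed form_null by auto
next
  case (insert k I)
  then obtain w where "w \<in> V" "\<forall>t \<in> V. \<forall>x. form t w x = (\<Sum>i\<in>I. c i * form t (v i) x)" by auto
  then show ?case using insert
    by (intro bexI[of _ "add (scale (c k) (v k)) w"]) (simp_all add: form_simps closed_simps)
qed

lemma positive_kernel_form:
  assumes "finite I" "\<And>i. i \<in> I \<Longrightarrow> v i \<in> V"
  shows "positive_kernel I (\<lambda>i j. form (v i) (v j) x)"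
  unfolding positive_kernel_def
proof (intro conjI allI ballI)
  show "form (v i) (v j) x = cnj (form (v j) (v i) x)" if "i \<in> I" "j \<in> I" for i j
    using that assms form_commute by blast
  fix c
  obtain w where w: "w \<in> V" "\<And>t x. t \<in> V \<Longrightarrow> form t w x = (\<Sum>i\<in>I. c i * form t (v i) x)"
    using ex_combination[where v = v and c = c, OF assms] by blast
  have "form w w x = (\<Sum>j\<in>I. c j * form w (v j) x)" using w by simp
  also have "\<dots> = (\<Sum>j\<in>I. \<Sum>i\<in>I. cnj (c i) * c j * form (v i) (v j) x)"
  proof (intro sum.cong refl)
    fix j assume "j \<in> I"
    then have "form w (v j) x = cnj (\<Sum>i\<in>I. c i * form (v j) (v i) x)"
      using w assms form_commute[of w "v j" x] by simp
    also have "\<dots> = (\<Sum>i\<in>I. cnj (c i) * form (v i) (v j) x)"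
      using assms \<open>j \<in> I\<close> form_commute[of "v _" "v j" x] by simp
    finally show "c j * form w (v j) x = (\<Sum>i\<in>I. cnj (c i) * c j * form (v i) (v j) x)"
      by (simp add: sum_distrib_left mult_ac)
  qed
  also have "\<dots> = (\<Sum>i\<in>I. \<Sum>j\<in>I. cnj (c i) * c j * form (v i) (v j) x)"
    by (rule sum.swap)
  finally show "0 \<le> Re (\<Sum>i\<in>I. \<Sum>j\<in>I. cnj (c i) * c j * form (v i) (v j) x)"
    using form_nonneg[OF w(1), of x] by simp
qed

end

context contraction
begin

text \<open>
  The defect \<open>\<langle>u | v\<rangle> - \<langle>\<phi> u | \<phi> v\<rangle>\<close> is a positive form, so Cauchy-Schwarz and the Schur product theorem
  apply to it.
\<close>

lemma semi_inner_product_defect: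
  "semi_inner_product X V addV scaleV actV nullV
     (\<lambda>u v x. formV u v x - formW (\<phi> u) (\<phi> v) x)"
proof
  have "\<phi> nullV \<in> W" by (intro map_closed S.null_closed)
  have null0: "formW w (\<phi> nullV) x = 0" if "w \<in> W" for w x
  proof -
    have "cmod (formW w (\<phi> nullV) x) \<le> T.len w * T.len (\<phi> nullV)"
      using that \<open>\<phi> nullV \<in> W\<close> by (rule T.form_bound)
    moreover have "S.len nullV \<le> 0"
      by (rule S.len_least) (simp_all add: S.form_simps S.closed_simps)
    moreover have "T.len (\<phi> nullV) \<le> S.len nullV" by (intro len_map S.null_closed)
    ultimately have "T.len (\<phi> nullV) = 0"
      using T.len_nonneg[OF \<open>\<phi> nullV \<in> W\<close>] by simp
    then show ?thesis
      using \<open>cmod (formW w (\<phi> nullV) x) \<le> T.len w * T.len (\<phi> nullV)\<close> by simp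
  qed
  show "formV u nullV x - formW (\<phi> u) (\<phi> nullV) x = 0" if "u \<in> V" for u x
    using that by (simp add: S.form_null null0 map_closed)
  show "(\<lambda>x. formV u v x - formW (\<phi> u) (\<phi> v) x) \<in> C0 X" if "u \<in> V" "v \<in> V" for u v
    using that by (intro C0_diff S.form_closed T.form_closed map_closed)
  show "formV u v x - formW (\<phi> u) (\<phi> v) x = cnj (formV v u x - formW (\<phi> v) (\<phi> u) x)"
    if "u \<in> V" "v \<in> V" for u v x
    using S.form_commute[OF that, of x] T.form_commute[OF map_closed map_closed, OF that, of x]
    by simp
  show "0 \<le> Re (formV v v x - formW (\<phi> v) (\<phi> v) x)" if "v \<in> V" for v x
    using map_contract[OF that, of x] by simp
  show "formV u (addV v w) x - formW (\<phi> u) (\<phi> (addV v w)) x =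
      formV u v x - formW (\<phi> u) (\<phi> v) x + (formV u w x - formW (\<phi> u) (\<phi> w) x)"
    if "u \<in> V" "v \<in> V" "w \<in> V" for u v w x
    using that by (simp add: S.form_add T.form_add map_add map_closed)
  show "formV u (scaleV z v) x - formW (\<phi> u) (\<phi> (scaleV z v)) x =
      z * (formV u v x - formW (\<phi> u) (\<phi> v) x)" if "u \<in> V" "v \<in> V" for u v z x
    using that by (simp add: S.form_scale T.form_scale map_scale map_closed right_diff_distrib)
  show "formV u (actV f v) x - formW (\<phi> u) (\<phi> (actV f v)) x =
      f x * (formV u v x - formW (\<phi> u) (\<phi> v) x)" if "f \<in> C0 X" "u \<in> V" "v \<in> V" for u v f x
    using that by (simp add: S.form_act T.form_act map_act map_closed right_diff_distrib)
qed (simp_all add: S.closed_simps)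

text \<open>
  Polarisation: a contraction that preserves squared lengths has a defect of length 0 throughout, so
  the defect vanishes by Cauchy-Schwarz.
\<close>

lemma form_map_eq:
  assumes iso: "\<And>v x. v \<in> V \<Longrightarrow> Re (formW (\<phi> v) (\<phi> v) x) = Re (formV v v x)"
    and uv: "u \<in> V" "v \<in> V"
  shows "formW (\<phi> u) (\<phi> v) x = formV u v x"
proof -
  interpret D: semi_inner_product X V addV scaleV actV nullV
    "\<lambda>u v x. formV u v x - formW (\<phi> u) (\<phi> v) x"
    by (rule semi_inner_product_defect)
  show ?thesis using D.Cauchy_Schwarz[OF uv, of x] iso[OF uv(1), of x] by simp
qed

end

section \<open>The tensor product of two modules\<close>

abbreviation tsum_scale :: "('x, 'a) hmodule \<Rightarrow> complex \<Rightarrow> ('a \<times> 'b) list \<Rightarrow> ('a \<times> 'b) list" where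
  "tsum_scale A z \<equiv> map (\<lambda>(a, b). (cscale A z a, b))"

abbreviation tsum_act ::
    "('x, 'a) hmodule \<Rightarrow> ('x \<Rightarrow> complex) \<Rightarrow> ('a \<times> 'b) list \<Rightarrow> ('a \<times> 'b) list" where
  "tsum_act A f \<equiv> map (\<lambda>(a, b). (f \<odot>\<^bsub>A\<^esub> a, b))"

lemma tsum_ip_eq_sum:
  "tsum_ip A B p q x = (\<Sum>i<length p. \<Sum>j<length q.
     ip A (fst (p ! i)) (fst (q ! j)) x * ip B (snd (p ! i)) (snd (q ! j)) x)"
  by (simp add: tsum_ip_def sum_list_sum_nth atLeast0LessThan case_prod_unfold)

lemma tsum_ip_append_right: "tsum_ip A B p (q @ r) x = tsum_ip A B p q x + tsum_ip A B p r x"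
  by (simp add: tsum_ip_def case_prod_unfold sum_list_addf)

lemma tsumsD: "p \<in> tsums A B \<Longrightarrow> z \<in> set p \<Longrightarrow> fst z \<in> carrier A \<and> snd z \<in> carrier B"
  by (auto simp: tsums_def lists_eq_set)

lemma tsumsI:
  "(\<And>z. z \<in> set p \<Longrightarrow> fst z \<in> carrier A \<and> snd z \<in> carrier B) \<Longrightarrow> p \<in> tsums A B"
  by (auto simp: tsums_def lists_eq_set mem_Times_iff)

locale hilbert_C0_module_pair =
  A: hilbert_C0_module X A + B: hilbert_C0_module X B
  for X :: "'x topology" and A :: "('x, 'a) hmodule" and B :: "('x, 'b) hmodule"
begin

lemma tsums_nth:
  assumes "p \<in> tsums A B" "i < length p" shows "fst (p ! i) \<in> carrier A" "snd (p ! i) \<in> carrier B"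
  using tsumsD[OF assms(1) nth_mem[OF assms(2)]] by blast+

lemma tsums_map:
  assumes "p \<in> tsums A B" "\<And>a. a \<in> carrier A \<Longrightarrow> f a \<in> carrier A"
  shows "map (\<lambda>(a, b). (f a, b)) p \<in> tsums A B"
proof (rule tsumsI)
  fix z assume "z \<in> set (map (\<lambda>(a, b). (f a, b)) p)"
  then obtain y where "y \<in> set p" "z = (f (fst y), snd y)" by auto
  then show "fst z \<in> carrier A \<and> snd z \<in> carrier B"
    using tsumsD[OF assms(1), of y] assms(2) by simp
qed

lemma tsum_ip_closed:
  assumes "p \<in> tsums A B" "q \<in> tsums A B" shows "tsum_ip A B p q \<in> C0 X"
proof -
  have "(\<lambda>x. \<Sum>i<length p. \<Sum>j<length q.
     ip A (fst (p ! i)) (fst (q ! j)) x * ip B (snd (p ! i)) (snd (q ! j)) x) \<in> C0 X"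
    using assms by (intro C0_sum C0_mult A.ip_closed B.ip_closed tsums_nth) auto
  then show ?thesis by (simp add: tsum_ip_eq_sum[abs_def])
qed

text \<open>
  Positivity is the Schur product theorem for the two Gram matrices at a point of \<open>X\<close>.
\<close>

lemma semi_inner_product_tsums:
  "semi_inner_product X (tsums A B) (@) (tsum_scale A) (tsum_act A) [] (tsum_ip A B)"
proof
  show "p @ q \<in> tsums A B" if "p \<in> tsums A B" "q \<in> tsums A B" for p q
    using that by (simp add: tsums_def)
  show "tsum_scale A z p \<in> tsums A B" if "p \<in> tsums A B" for z p
    using that by (intro tsums_map A.cscale_closed)
  show "tsum_act A f p \<in> tsums A B" if "f \<in> C0 X" "p \<in> tsums A B" for f p
    using that by (intro tsums_map A.act_closed)
  show "tsum_ip A B p (tsum_scale A z q) x = z * tsum_ip A B p q x"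
    if "p \<in> tsums A B" "q \<in> tsums A B" for p q z x
    unfolding tsum_ip_eq_sum length_map sum_distrib_left using that
    by (intro sum.cong refl) (simp add: case_prod_unfold tsums_nth A.sip.form_scale mult_ac)
  show "tsum_ip A B p (tsum_act A f q) x = f x * tsum_ip A B p q x"
    if "f \<in> C0 X" "p \<in> tsums A B" "q \<in> tsums A B" for p q f x
    unfolding tsum_ip_eq_sum length_map sum_distrib_left using that
    by (intro sum.cong refl) (simp add: case_prod_unfold tsums_nth A.sip.form_act mult_ac)
  show "tsum_ip A B p q x = cnj (tsum_ip A B q p x)"
    if "p \<in> tsums A B" "q \<in> tsums A B" for p q x
  proof -
    have "cnj (tsum_ip A B q p x) = (\<Sum>j<length q. \<Sum>i<length p.
        ip A (fst (p ! i)) (fst (q ! j)) x * ip B (snd (p ! i)) (snd (q ! j)) x)"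
      unfolding tsum_ip_eq_sum cnj_sum complex_cnj_mult
    proof (intro sum.cong refl)
      fix i j assume "j \<in> {..<length q}" "i \<in> {..<length p}"
      then show "cnj (ip A (fst (q ! j)) (fst (p ! i)) x) * cnj (ip B (snd (q ! j)) (snd (p ! i)) x) =
          ip A (fst (p ! i)) (fst (q ! j)) x * ip B (snd (p ! i)) (snd (q ! j)) x"
        using A.sip.form_commute[of "fst (p ! i)" "fst (q ! j)" x]
          B.sip.form_commute[of "snd (p ! i)" "snd (q ! j)" x] that by (simp add: tsums_nth)
    qed
    also have "\<dots> = tsum_ip A B p q x"
      unfolding tsum_ip_eq_sum by (rule sum.swap)
    finally show ?thesis by simp
  qed
  show "0 \<le> Re (tsum_ip A B p p x)" if "p \<in> tsums A B" for p x
    unfolding tsum_ip_eq_sum using that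
    by (intro Schur_product_nonneg A.sip.positive_kernel_form B.sip.positive_kernel_form tsums_nth) auto
  show "tsum_ip A B p [] x = 0" for p x
    unfolding tsum_ip_eq_sum by simp
  show "[] \<in> tsums A B" by (simp add: tsums_def)
  show "tsum_ip A B p q \<in> C0 X" if "p \<in> tsums A B" "q \<in> tsums A B" for p q
    using that by (rule tsum_ip_closed)
  show "tsum_ip A B p (q @ r) x = tsum_ip A B p q x + tsum_ip A B p r x" for p q r x
    by (rule tsum_ip_append_right)
qed

sublocale T: semi_inner_product X "tsums A B" "(@)" "tsum_scale A" "tsum_act A" "[]" "tsum_ip A B"
  by (rule semi_inner_product_tsums)

lemma tsum_dist_eq_gap:
  assumes q: "q \<in> tsums A B" shows "tsum_dist X A B p q = T.gap p q"
proof -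
  have "map (\<lambda>(a, b). (\<ominus>\<^bsub>A\<^esub> a, b)) q = tsum_scale A (- 1) q"
  proof (rule map_cong[OF refl])
    fix z assume "z \<in> set q"
    with q have "fst z \<in> carrier A" by (blast dest: tsumsD)
    then show "(\<lambda>(a, b). (\<ominus>\<^bsub>A\<^esub> a, b)) z = (\<lambda>(a, b). (cscale A (- 1) a, b)) z"
      using A.uminus_eq_cscale[of "fst z"] by (cases z) simp
  qed
  then show ?thesis
    by (simp only: tsum_dist_def tsum_diff_def T.gap_def T.len_def)
qed

lemma tcauchy_eq: "tcauchy X A B = T.cauchy_seqs"
  unfolding tcauchy_def T.cauchy_seqs_def
proof (rule Collect_cong, rule conj_cong[OF refl])
  fix s :: "nat \<Rightarrow> ('a \<times> 'b) list"
  assume "\<forall>n. s n \<in> tsums A B"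
  then have "tsum_dist X A B (s m) (s n) = T.gap (s m) (s n)" for m n
    by (intro tsum_dist_eq_gap) blast
  then show "(\<forall>e>0. \<exists>N. \<forall>m\<ge>N. \<forall>n\<ge>N. tsum_dist X A B (s m) (s n) < e) =
      (\<forall>e>0. \<exists>N. \<forall>m\<ge>N. \<forall>n\<ge>N. T.gap (s m) (s n) < e)"
    by (simp only:)
qed

lemma tnull_eq: "tnull X A B = T.null_rel"
proof -
  have "(\<lambda>n. tsum_dist X A B (s n) (t n)) = (\<lambda>n. T.gap (s n) (t n))" if "t \<in> T.cauchy_seqs" for s t
    using T.cauchy_seqs_closed[OF that] by (simp add: tsum_dist_eq_gap)
  then show ?thesis
    unfolding tnull_def T.null_rel_def tcauchy_eq by (intro Collect_cong) auto
qed

lemma tclass_eq: "tclass X A B = T.cls"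
  by (simp add: tclass_def T.cls_def tnull_eq fun_eq_iff)

lemma trep_eq: "trep = T.rep"
  by (simp add: trep_def T.rep_def fun_eq_iff)

lemma tensor_completion_eq: "tensor_completion X A B = T.completion"
  by (simp add: tensor_completion_def T.completion_def tcauchy_eq tnull_eq tclass_eq trep_eq)

lemma hilbert_C0_module_tensor_completion: "hilbert_C0_module X (tensor_completion X A B)"
  unfolding tensor_completion_eq by (rule T.hilbert_C0_module_completion)

end

locale module_contraction =
  contraction X "carrier A" "ring.add A" "cscale A" "smult A" "ring.zero A" "ip A"
    "carrier A'" "ring.add A'" "cscale A'" "smult A'" "ring.zero A'" "ip A'" f
  for X :: "'x topology" and A :: "('x, 'a) hmodule" and A' :: "('x, 'c) hmodule" and f

locale tensor_contraction =
  S: hilbert_C0_module_pair X A B + R: hilbert_C0_module_pair X A' B +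
  f: module_contraction X A A' f
  for X :: "'x topology" and A :: "('x, 'a) hmodule" and A' :: "('x, 'c) hmodule"
    and B :: "('x, 'b) hmodule" and f :: "'a \<Rightarrow> 'c" +
  \<comment> \<open>Identities of the category are restricted to the carrier, so \<open>g\<close> is the identity only there.\<close>
  fixes g :: "'b \<Rightarrow> 'b"
  assumes g_id: "b \<in> carrier B \<Longrightarrow> g b = b"
begin

text \<open>
  The inner product of a sum with itself exceeds that of its image by the sum of the entries of the
  product of two positive kernels, the Gram matrix of the defect of \<open>f\<close> and a Gram matrix of \<open>B\<close>.
\<close>

lemma contraction_tsums:
  "contraction X (tsums A B) (@) (tsum_scale A) (tsum_act A) [] (tsum_ip A B)
     (tsums A' B) (@) (tsum_scale A') (tsum_act A') [] (tsum_ip A' B) (map (map_prod f g))"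
proof
  show "map (map_prod f g) p \<in> tsums A' B" if "p \<in> tsums A B" for p
  proof (rule tsumsI)
    fix z assume "z \<in> set (map (map_prod f g) p)"
    then obtain y where "y \<in> set p" "z = map_prod f g y" by auto
    then show "fst z \<in> carrier A' \<and> snd z \<in> carrier B"
      using tsumsD[OF that, of y] by (simp add: f.map_closed g_id)
  qed
  show "map (map_prod f g) (p @ q) = map (map_prod f g) p @ map (map_prod f g) q" for p q
    by simp
  show "map (map_prod f g) (tsum_scale A z p) = tsum_scale A' z (map (map_prod f g) p)"
    if "p \<in> tsums A B" for z p
    unfolding map_map
  proof (rule map_cong[OF refl])
    fix y assume "y \<in> set p"
    from tsumsD[OF that this] show "(map_prod f g \<circ> (\<lambda>(a, b). (cscale A z a, b))) y =
        ((\<lambda>(a, b). (cscale A' z a, b)) \<circ> map_prod f g) y"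
      by (cases y) (simp add: f.map_scale)
  qed
  show "map (map_prod f g) (tsum_act A h p) = tsum_act A' h (map (map_prod f g) p)"
    if "h \<in> C0 X" "p \<in> tsums A B" for h p
    unfolding map_map
  proof (rule map_cong[OF refl])
    fix y assume "y \<in> set p"
    from tsumsD[OF that(2) this] show "(map_prod f g \<circ> (\<lambda>(a, b). (h \<odot>\<^bsub>A\<^esub> a, b))) y =
        ((\<lambda>(a, b). (h \<odot>\<^bsub>A'\<^esub> a, b)) \<circ> map_prod f g) y"
      by (cases y) (simp add: f.map_act that(1))
  qed
  show "Re (tsum_ip A' B (map (map_prod f g) p) (map (map_prod f g) p) x) \<le> Re (tsum_ip A B p p x)"
    if p: "p \<in> tsums A B" for p x
  proof -
    interpret D: semi_inner_product X "carrier A" "ring.add A" "cscale A" "smult A" "ring.zero A"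
      "\<lambda>u v x. ip A u v x - ip A' (f u) (f v) x"
      by (rule f.semi_inner_product_defect)
    have "0 \<le> Re (\<Sum>i<length p. \<Sum>j<length p.
        (ip A (fst (p ! i)) (fst (p ! j)) x - ip A' (f (fst (p ! i))) (f (fst (p ! j))) x) *
        ip B (snd (p ! i)) (snd (p ! j)) x)"
      by (rule Schur_product_nonneg[OF finite_lessThan D.positive_kernel_form
            S.B.sip.positive_kernel_form])
        (auto simp: S.tsums_nth[OF p])
    also have "(\<Sum>i<length p. \<Sum>j<length p.
        (ip A (fst (p ! i)) (fst (p ! j)) x - ip A' (f (fst (p ! i))) (f (fst (p ! j))) x) *
        ip B (snd (p ! i)) (snd (p ! j)) x) =
      tsum_ip A B p p x - tsum_ip A' B (map (map_prod f g) p) (map (map_prod f g) p) x"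
      unfolding tsum_ip_eq_sum length_map sum_subtractf[symmetric]
      by (intro sum.cong refl) (simp add: g_id S.tsums_nth[OF p] left_diff_distrib)
    finally show ?thesis by simp
  qed
qed

sublocale T: contraction X "tsums A B" "(@)" "tsum_scale A" "tsum_act A" "[]" "tsum_ip A B"
  "tsums A' B" "(@)" "tsum_scale A'" "tsum_act A'" "[]" "tsum_ip A' B" "map (map_prod f g)"
  by (rule contraction_tsums)

lemma tensor_completion_map_eq: "tensor_completion_map X A' B f g = T.extend"
  by (simp add: tensor_completion_map_def T.extend_def R.tclass_eq S.trep_eq fun_eq_iff)

lemma tsum_ip_map_eq:
  assumes iso: "\<And>a a' x. a \<in> carrier A \<Longrightarrow> a' \<in> carrier A \<Longrightarrow> ip A' (f a) (f a') x = ip A a a' x"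
    and p: "p \<in> tsums A B" and q: "q \<in> tsums A B"
  shows "tsum_ip A' B (map (map_prod f g) p) (map (map_prod f g) q) x = tsum_ip A B p q x"
  unfolding tsum_ip_eq_sum length_map
  by (intro sum.cong refl) (simp add: g_id S.tsums_nth[OF p] S.tsums_nth[OF q] iso)

end


section \<open>Morphisms of Hilbert modules\<close>

lemma sup_Re_ip_act:
  assumes "hilbert_C0_module X A" "h \<in> C0 X" "a \<in> carrier A"
  shows "ip A (h \<odot>\<^bsub>A\<^esub> a) (h \<odot>\<^bsub>A\<^esub> a) = (\<lambda>x. cnj (h x) * h x * ip A a a x)"
proof -
  interpret A: hilbert_C0_module X A by fact
  show ?thesis
    using assms by (simp add: A.sip.form_act A.sip.form_act_left A.act_closed fun_eq_iff)
qed

text \<open>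
  If \<open>f\<close> stretches some \<open>a\<close>, the ratio of the two norms exceeds 1 and is a lower bound of all
  constants for \<open>f\<close>.  It is well defined because \<open>f a\<close> has length 0 whenever \<open>a\<close> has.
\<close>

lemma nonexpansive_iff:
  assumes A: "hilbert_C0_module X A" and B: "hilbert_C0_module X B"
    and f: "f \<in> carrier A \<rightarrow> carrier B"
  shows "nonexpansive X A B f \<longleftrightarrow> (\<forall>a \<in> carrier A. hnorm X B (f a) \<le> hnorm X A a)"
proof
  interpret A: hilbert_C0_module X A by (rule A)
  interpret B: hilbert_C0_module X B by (rule B)
  assume ne: "nonexpansive X A B f"
  show "\<forall>a \<in> carrier A. hnorm X B (f a) \<le> hnorm X A a"
  proof (rule ballI, rule ccontr)
    fix a assume a: "a \<in> carrier A" and "\<not> hnorm X B (f a) \<le> hnorm X A a"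
    then have gt: "hnorm X A a < hnorm X B (f a)" by simp
    have nonneg: "0 \<le> hnorm X A a" using A.sip.len_nonneg[OF a] by (simp add: A.hnorm_eq_len)
    obtain c where "c \<in> bounds X A B f" using ne by (auto simp: nonexpansive_def)
    then have "hnorm X B (f a) \<le> c * hnorm X A a" using a by (simp add: bounds_def)
    then have pos: "0 < hnorm X A a" using gt nonneg by (cases "hnorm X A a = 0") auto
    have "hnorm X B (f a) / hnorm X A a \<le> Inf (bounds X A B f)"
      using ne a pos by (intro cInf_greatest) (auto simp: nonexpansive_def bounds_def field_simps)
    moreover have "1 < hnorm X B (f a) / hnorm X A a" using gt pos by simp
    ultimately show False using ne by (simp add: nonexpansive_def)
  qed
next
  assume le: "\<forall>a \<in> carrier A. hnorm X B (f a) \<le> hnorm X A a"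
  then have one: "1 \<in> bounds X A B f" by (simp add: bounds_def)
  have "bdd_below (bounds X A B f)" by (rule bdd_belowI[of _ 0]) (simp add: bounds_def)
  then have "Inf (bounds X A B f) \<le> 1" by (rule cInf_lower[OF one])
  with one show "nonexpansive X A B f" by (auto simp: nonexpansive_def)
qed

lemma C0_linearD:
  assumes "C0_linear X A B f"
  shows "a \<in> carrier A \<Longrightarrow> b \<in> carrier A \<Longrightarrow> f (a \<oplus>\<^bsub>A\<^esub> b) = f a \<oplus>\<^bsub>B\<^esub> f b"
    and "a \<in> carrier A \<Longrightarrow> f (cscale A z a) = cscale B z (f a)"
    and "h \<in> C0 X \<Longrightarrow> a \<in> carrier A \<Longrightarrow> f (h \<odot>\<^bsub>A\<^esub> a) = h \<odot>\<^bsub>B\<^esub> f a"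
  using assms unfolding C0_linear_def by blast+

text \<open>
  The inequality of norms, applied to all multiples of \<open>a\<close> by functions, becomes an inequality of
  suprema with arbitrary weights, and such an inequality holds pointwise.
\<close>

lemma hilb_hom_iff:
  assumes A: "hilbert_C0_module X A" and B: "hilbert_C0_module X B"
  shows "f \<in> hilb_hom X A B \<longleftrightarrow> f \<in> carrier A \<rightarrow>\<^sub>E carrier B \<and> C0_linear X A B f \<and>
    (\<forall>a \<in> carrier A. \<forall>x. Re (ip B (f a) (f a) x) \<le> Re (ip A a a x))"
proof -
  interpret A: hilbert_C0_module X A by (rule A)
  interpret B: hilbert_C0_module X B by (rule B)
  have "nonexpansive X A B f \<longleftrightarrow> (\<forall>a \<in> carrier A. \<forall>x. Re (ip B (f a) (f a) x) \<le> Re (ip A a a x))"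
    if f: "f \<in> carrier A \<rightarrow>\<^sub>E carrier B" and lin: "C0_linear X A B f"
  proof -
    have fc: "f a \<in> carrier B" if "a \<in> carrier A" for a using f that by blast
    have ne: "nonexpansive X A B f \<longleftrightarrow>
        (\<forall>a \<in> carrier A. sup_Re X (ip B (f a) (f a)) \<le> sup_Re X (ip A a a))"
      using nonexpansive_iff[OF A B, of f] f by (simp add: hnorm_def PiE_def)
    have pointwise: "Re (ip B (f a) (f a) x) \<le> Re (ip A a a x)"
      if le: "\<forall>a \<in> carrier A. sup_Re X (ip B (f a) (f a)) \<le> sup_Re X (ip A a a)"
        and a: "a \<in> carrier A" for a x
    proof -
      show "Re (ip B (f a) (f a) x) \<le> Re (ip A a a x)"
      proof (rule C0_le_of_weighted_sup_le[where p = "ip A a a" and q = "ip B (f a) (f a)" and x = x])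
        fix h assume h: "h \<in> C0 X"
        have "sup_Re X (ip B (f (h \<odot>\<^bsub>A\<^esub> a)) (f (h \<odot>\<^bsub>A\<^esub> a)))
            \<le> sup_Re X (ip A (h \<odot>\<^bsub>A\<^esub> a) (h \<odot>\<^bsub>A\<^esub> a))"
          using le A.act_closed[OF h a] by blast
        then show "sup_Re X (\<lambda>x. cnj (h x) * h x * ip B (f a) (f a) x)
            \<le> sup_Re X (\<lambda>x. cnj (h x) * h x * ip A a a x)"
          unfolding C0_linearD(3)[OF lin h a] sup_Re_ip_act[OF A h a] sup_Re_ip_act[OF B h fc[OF a]] .
      qed (use a fc in \<open>simp_all add: A.ip_closed B.ip_closed A.sip.form_nonneg B.sip.form_nonneg\<close>)
    qed
    have "sup_Re X (ip B (f a) (f a)) \<le> sup_Re X (ip A a a)"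
      if le: "\<forall>a \<in> carrier A. \<forall>x. Re (ip B (f a) (f a) x) \<le> Re (ip A a a x)"
        and a: "a \<in> carrier A" for a
    proof -
      show "sup_Re X (ip B (f a) (f a)) \<le> sup_Re X (ip A a a)"
      proof (rule sup_Re_least)
        fix x assume x: "x \<in> topspace X"
        have "Re (ip B (f a) (f a) x) \<le> Re (ip A a a x)" using le a by blast
        also have "\<dots> \<le> sup_Re X (ip A a a)" by (rule sup_Re_upper[OF A.ip_closed[OF a a] x])
        finally show "Re (ip B (f a) (f a) x) \<le> sup_Re X (ip A a a)" .
      qed (rule sup_Re_nonneg[OF A.ip_closed[OF a a]])
    qed
    with pointwise show ?thesis unfolding ne by blast
  qed
  then show ?thesis unfolding hilb_hom_def by blast
qed

lemma hilb_hom_imp_contraction: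
  assumes A: "hilbert_C0_module X A" and B: "hilbert_C0_module X B" and f: "f \<in> hilb_hom X A B"
  shows "module_contraction X A B f"
proof -
  interpret A: hilbert_C0_module X A by (rule A)
  interpret B: hilbert_C0_module X B by (rule B)
  note F = f[unfolded hilb_hom_iff[OF A B]]
  show ?thesis
  proof unfold_locales
    show "f a \<in> carrier B" if "a \<in> carrier A" for a using F that by blast
    show "Re (ip B (f a) (f a) x) \<le> Re (ip A a a x)" if "a \<in> carrier A" for a x
      using F that by blast
  qed (use C0_linearD[of X A B f] F in blast)+
qed

lemma hilb_homI:
  assumes "hilbert_C0_module X A" "hilbert_C0_module X B"
    and "\<And>a. a \<in> carrier A \<Longrightarrow> f a \<in> carrier B" "f \<in> extensional (carrier A)"
    and "C0_linear X A B f"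
    and "\<And>a x. a \<in> carrier A \<Longrightarrow> Re (ip B (f a) (f a) x) \<le> Re (ip A a a x)"
  shows "f \<in> hilb_hom X A B"
  using assms by (simp add: hilb_hom_iff PiE_def)

lemma hilb_hom_compose:
  assumes A: "hilbert_C0_module X A" and B: "hilbert_C0_module X B" and D: "hilbert_C0_module X D"
    and f: "f \<in> hilb_hom X A B" and g: "g \<in> hilb_hom X B D"
  shows "compose (carrier A) g f \<in> hilb_hom X A D"
proof (rule hilb_homI[OF A D])
  interpret A: hilbert_C0_module X A by (rule A)
  interpret f: module_contraction X A B f
    by (rule hilb_hom_imp_contraction[OF A B f])
  interpret g: module_contraction X B D g
    by (rule hilb_hom_imp_contraction[OF B D g])
  show "compose (carrier A) g f a \<in> carrier D" if "a \<in> carrier A" for a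
    using that by (simp add: compose_def f.map_closed g.map_closed)
  show "C0_linear X A D (compose (carrier A) g f)"
    unfolding C0_linear_def
    by (simp add: compose_def f.map_closed f.map_add g.map_add f.map_scale g.map_scale
        f.map_act g.map_act A.cscale_closed A.act_closed)
  show "Re (ip D (compose (carrier A) g f a) (compose (carrier A) g f a) x) \<le> Re (ip A a a x)"
    if "a \<in> carrier A" for a x
    using that order_trans[OF g.map_contract[OF f.map_closed[OF that]] f.map_contract[OF that]]
    by (simp add: compose_def)
qed (simp add: compose_def)

lemma Hilb_simps [simp]:
  "Ob (Hilb X) = {A. hilbert_C0_module X A}" "Hom (Hilb X) = hilb_hom X"
  "Id (Hilb X) A = (\<lambda>a \<in> carrier A. a)" "Comp (Hilb X) A B D g f = compose (carrier A) g f"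
  "Unit (Hilb X) = hilb_unit X" "TensorOb (Hilb X) = hilb_tensor X"
  "TensorArr (Hilb X) = hilb_tensor_map X"
  by (simp_all add: Hilb_def)

lemma mono_arr_of_inj:
  assumes A: "hilbert_C0_module X A" and B: "hilbert_C0_module X B"
    and f: "f \<in> hilb_hom X A B" and inj: "inj_on f (carrier A)"
  shows "mono_arr (Hilb X) A B f"
  unfolding mono_arr_def Hilb_simps
proof (intro conjI ballI impI)
  show "A \<in> {A. hilbert_C0_module X A}" "B \<in> {A. hilbert_C0_module X A}" "f \<in> hilb_hom X A B"
    using A B f by simp_all
  fix W g h
  assume g: "g \<in> hilb_hom X W A" and h: "h \<in> hilb_hom X W A"
    and eq: "compose (carrier W) f g = compose (carrier W) f h"
  have gh: "g \<in> carrier W \<rightarrow>\<^sub>E carrier A" "h \<in> carrier W \<rightarrow>\<^sub>E carrier A"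
    using g h by (simp_all add: hilb_hom_def)
  show "g = h"
  proof (rule PiE_ext[OF gh])
    fix w assume w: "w \<in> carrier W"
    then have "f (g w) = f (h w)" using fun_cong[OF eq, of w] by (simp add: compose_def)
    then show "g w = h w" using inj gh w by (auto dest!: inj_onD PiE_mem)
  qed
qed

text \<open>
  Both the isomorphism and its inverse are contractive at every point.
\<close>

lemma iso_arr_preserves_ip:
  assumes iso: "iso_arr (Hilb X) A B f" and a: "a \<in> carrier A"
  shows "Re (ip B (f a) (f a) x) = Re (ip A a a x)"
proof -
  obtain g where A: "hilbert_C0_module X A" and B: "hilbert_C0_module X B"
    and f: "f \<in> hilb_hom X A B" and g: "g \<in> hilb_hom X B A"
    and gf: "compose (carrier A) g f = (\<lambda>a \<in> carrier A. a)"
    using iso by (auto simp: iso_arr_def)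
  have fa: "f a \<in> carrier B" using f a by (auto simp: hilb_hom_def)
  have "g (f a) = a" using fun_cong[OF gf, of a] a by (simp add: compose_def)
  moreover have "Re (ip A (g (f a)) (g (f a)) x) \<le> Re (ip B (f a) (f a) x)"
    using g fa by (auto simp: hilb_hom_iff[OF B A])
  moreover have "Re (ip B (f a) (f a) x) \<le> Re (ip A a a x)"
    using f a by (auto simp: hilb_hom_iff[OF A B])
  ultimately show ?thesis by simp
qed

lemma inj_on_of_isometry:
  assumes A: "hilbert_C0_module X A" and B: "hilbert_C0_module X B" and f: "f \<in> hilb_hom X A B"
    and iso: "\<And>a x. a \<in> carrier A \<Longrightarrow> Re (ip B (f a) (f a) x) = Re (ip A a a x)"
  shows "inj_on f (carrier A)"
proof (rule inj_onI)
  interpret A: hilbert_C0_module X A by (rule A)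
  interpret B: hilbert_C0_module X B by (rule B)
  interpret f: module_contraction X A B f
    by (rule hilb_hom_imp_contraction[OF A B f])
  fix a b assume ab: "a \<in> carrier A" "b \<in> carrier A" "f a = f b"
  define d where "d = a \<oplus>\<^bsub>A\<^esub> cscale A (- 1) b"
  have d: "d \<in> carrier A" using ab by (simp add: d_def A.cscale_closed)
  have "f d = f a \<oplus>\<^bsub>B\<^esub> cscale B (- 1) (f a)"
    using ab by (simp add: d_def f.map_add f.map_scale A.cscale_closed)
  then have "ip B (f d) (f d) x = 0" for x
    using f.map_closed[OF ab(1)] by (simp add: B.sip.form_simps B.sip.closed_simps)
  then have "Re (ip A d d x) \<le> 0" for x
    using iso[OF d, of x] by simp
  then have "A.sip.len d \<le> 0" by (intro A.sip.len_least) simp_all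
  then show "a = b" using ab by (intro A.eq_of_gap) (simp_all add: A.sip.gap_def d_def)
qed

lemma iso_arr_of_isometry:
  assumes A: "hilbert_C0_module X A" and B: "hilbert_C0_module X B" and f: "f \<in> hilb_hom X A B"
    and iso: "\<And>a x. a \<in> carrier A \<Longrightarrow> Re (ip B (f a) (f a) x) = Re (ip A a a x)"
    and surj: "f ` carrier A = carrier B"
  shows "iso_arr (Hilb X) A B f"
proof -
  interpret A: hilbert_C0_module X A by (rule A)
  interpret B: hilbert_C0_module X B by (rule B)
  interpret f: module_contraction X A B f
    by (rule hilb_hom_imp_contraction[OF A B f])
  have inj: "inj_on f (carrier A)" by (rule inj_on_of_isometry[OF A B f iso])
  define g where "g = (\<lambda>b \<in> carrier B. inv_into (carrier A) f b)"
  have gc: "g b \<in> carrier A" and fg: "f (g b) = b" if "b \<in> carrier B" for b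
    using that surj by (auto simp: g_def inv_into_into f_inv_into_f)
  have gf: "g (f a) = a" if "a \<in> carrier A" for a
    using that inj by (simp add: g_def f.map_closed)
  have eq: "g b = a" if "a \<in> carrier A" "f a = b" for a b using gf that by blast
  have g: "g \<in> hilb_hom X B A"
  proof (rule hilb_homI[OF B A])
    show "C0_linear X B A g"
      unfolding C0_linear_def
      by (intro conjI ballI allI; rule eq)
        (simp_all add: gc fg f.map_add f.map_scale f.map_act A.cscale_closed A.act_closed)
    show "Re (ip A (g b) (g b) x) \<le> Re (ip B b b x)" if "b \<in> carrier B" for b x
      using iso[OF gc[OF that], of x] fg[OF that] by simp
    show "g \<in> extensional (carrier B)" by (simp add: g_def)
  qed (rule gc)
  have "compose (carrier A) g f = (\<lambda>a \<in> carrier A. a)" "compose (carrier B) f g = (\<lambda>b \<in> carrier B. b)"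
    using gf fg by (auto simp: compose_def fun_eq_iff)
  then show ?thesis using A B f g by (auto simp: iso_arr_def)
qed

lemma factors_through_trans:
  assumes "hilbert_C0_module X R" "hilbert_C0_module X S" "hilbert_C0_module X T"
    and "factors_through (Hilb X) B R r S s" "factors_through (Hilb X) B S s T t"
  shows "factors_through (Hilb X) B R r T t"
proof -
  obtain m n where m: "m \<in> hilb_hom X R S" "r = compose (carrier R) s m"
    and n: "n \<in> hilb_hom X S T" "s = compose (carrier S) t n"
    using assms by (auto simp: factors_through_def)
  have "r = compose (carrier R) t (compose (carrier R) n m)"
    using m n by (auto simp: compose_def fun_eq_iff hilb_hom_def)
  moreover have "compose (carrier R) n m \<in> hilb_hom X R T"
    using assms(1-3) m(1) n(1) by (rule hilb_hom_compose)
  ultimately show ?thesis by (auto simp: factors_through_def)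
qed

lemma subobject_class_eqI:
  assumes S: "hilbert_C0_module X S" and T: "hilbert_C0_module X T"
    and st: "factors_through (Hilb X) B S s T t" and ts: "factors_through (Hilb X) B T t S s"
  shows "subobject_class (Hilb X) B S s = subobject_class (Hilb X) B T t"
proof -
  have "subobject_class (Hilb X) B S s \<subseteq> subobject_class (Hilb X) B T t"
    if S: "hilbert_C0_module X S" and T: "hilbert_C0_module X T"
      and st: "factors_through (Hilb X) B S s T t" and ts: "factors_through (Hilb X) B T t S s"
    for S T s t
    unfolding subobject_class_def
  proof (clarify, intro conjI)
    fix R r assume R: "mono_arr (Hilb X) R B r"
      "factors_through (Hilb X) B S s R r" "factors_through (Hilb X) B R r S s"
    then have "hilbert_C0_module X R" by (simp add: mono_arr_def)
    then show "factors_through (Hilb X) B T t R r" "factors_through (Hilb X) B R r T t"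
      using R S T st ts factors_through_trans by metis+
  qed
  then show ?thesis using assms by (intro equalityI) auto
qed

section \<open>Copies in the universe\<close>

lemma inj_on_code:
  assumes "inj_on (e :: 'a \<Rightarrow> 'u) (carrier A)" shows "inj_on (code A :: 'a \<Rightarrow> 'u) (carrier A)"
  unfolding code_def by (rule someI[where P = "\<lambda>e. inj_on e (carrier A)"]) (rule assms)

text \<open>
  The dummy parameter fixes the type \<open>'u\<close> in which \<open>A\<close> is copied.
\<close>

locale coded_module = hilbert_C0_module X A
  for X :: "'x topology" and A :: "('x, 'a) hmodule" +
  fixes universe :: "'u itself"
  assumes code_inj: "inj_on (code A :: 'a \<Rightarrow> 'u) (carrier A)"
begin

abbreviation C :: "('x, 'u) hmodule" where "C \<equiv> copy A"

lemma decode_code: "a \<in> carrier A \<Longrightarrow> decode A (code A a :: 'u) = a"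
  unfolding decode_def by (rule inv_into_f_f[OF code_inj])

lemma decode_closed: "u \<in> carrier C \<Longrightarrow> decode A u \<in> carrier A"
  by (auto simp: copy_def decode_code)

lemma code_decode: "u \<in> carrier C \<Longrightarrow> code A (decode A u) = u"
  by (auto simp: copy_def decode_code)

lemma code_closed: "a \<in> carrier A \<Longrightarrow> code A a \<in> carrier C"
  by (simp add: copy_def)

lemma copy_add: "u \<oplus>\<^bsub>C\<^esub> v = code A (decode A u \<oplus>\<^bsub>A\<^esub> decode A v)"
  and copy_cscale: "cscale C z u = code A (cscale A z (decode A u))"
  and copy_act: "f \<odot>\<^bsub>C\<^esub> u = code A (f \<odot>\<^bsub>A\<^esub> decode A u)"
  and copy_zero: "\<zero>\<^bsub>C\<^esub> = code A \<zero>\<^bsub>A\<^esub>"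
  and copy_ip: "ip C u v = ip A (decode A u) (decode A v)"
  by (simp_all add: copy_def)

lemmas copy_simps = copy_add copy_cscale copy_act copy_zero copy_ip decode_code decode_closed
  code_closed

lemma semi_inner_product_copy: "module_semi_inner_product X C"
proof
  show "ip C u v x = cnj (ip C v u x)" if "u \<in> carrier C" "v \<in> carrier C" for u v x
    unfolding copy_ip using that by (intro sip.form_commute decode_closed)
qed (simp_all add: copy_simps sip.closed_simps sip.form_simps sip.form_nonneg sip.form_closed)

lemma gap_copy:
  assumes "u \<in> carrier C" "v \<in> carrier C"
  shows "module_gap X C u v = sip.gap (decode A u) (decode A v)"
proof -
  interpret C: module_semi_inner_product X C
    by (rule semi_inner_product_copy)
  show ?thesis
    using assms by (simp add: C.gap_def C.len_def sip.gap_def sip.len_def copy_simps sip.closed_simps)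
qed

lemma hilbert_C0_module_copy: "hilbert_C0_module X C"
proof (rule hilbert_C0_moduleI)
  show "u = v" if "u \<in> carrier C" "v \<in> carrier C" "module_gap X C u v = 0" for u v
  proof -
    have "decode A u = decode A v"
      using that by (intro eq_of_gap) (simp_all add: gap_copy decode_closed)
    then show ?thesis using code_decode that by metis
  qed
next
  fix s :: "nat \<Rightarrow> 'u"
  assume s: "\<And>n. s n \<in> carrier C"
    and cauchy: "\<And>e. 0 < e \<Longrightarrow> \<exists>N. \<forall>m\<ge>N. \<forall>n\<ge>N. module_gap X C (s m) (s n) < e"
  have "\<exists>a \<in> carrier A. (\<lambda>n. hnorm X A (decode A (s n) \<ominus>\<^bsub>A\<^esub> a)) \<longlonglongrightarrow> 0"
    using cauchy by (intro complete)
      (simp_all add: decode_closed s hnorm_minus_eq_gap gap_copy)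
  then obtain a where a: "a \<in> carrier A" "(\<lambda>n. sip.gap (decode A (s n)) a) \<longlonglongrightarrow> 0"
    by (auto simp: hnorm_minus_eq_gap decode_closed s)
  then show "\<exists>u \<in> carrier C. (\<lambda>n. module_gap X C (s n) u) \<longlonglongrightarrow> 0"
    by (intro bexI[of _ "code A a"]) (simp_all add: gap_copy s code_closed decode_code)
qed (rule semi_inner_product_copy)

end

lemma hilb_hom_copy:
  fixes f :: "'a \<Rightarrow> 'b"
  assumes "coded_module TYPE('u) X A" "coded_module TYPE('w) X B"
    and closed: "\<And>a. a \<in> carrier A \<Longrightarrow> f a \<in> carrier B" and lin: "C0_linear X A B f"
    and le: "\<And>a x. a \<in> carrier A \<Longrightarrow> Re (ip B (f a) (f a) x) \<le> Re (ip A a a x)"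
  shows "(\<lambda>u \<in> carrier (copy A :: ('x, 'u) hmodule). code B (f (decode A u)))
    \<in> hilb_hom X (copy A :: ('x, 'u) hmodule) (copy B :: ('x, 'w) hmodule)"
proof -
  interpret A: coded_module X A "TYPE('u)" by fact
  interpret B: coded_module X B "TYPE('w)" by fact
  interpret CA: module_semi_inner_product X "A.C"
    by (rule A.semi_inner_product_copy)
  note closed' = CA.closed_simps
  show ?thesis
  proof (rule hilb_homI[OF A.hilbert_C0_module_copy B.hilbert_C0_module_copy])
    show "C0_linear X A.C B.C (\<lambda>u \<in> carrier A.C. code B (f (decode A u)))"
      unfolding C0_linear_def
      by (simp add: closed')
       (simp add: A.copy_simps B.copy_simps A.sip.closed_simps closed C0_linearD[OF lin])
  qed (simp_all add: A.copy_simps B.copy_simps closed le)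
qed

text \<open>
  A sequence of lists of pairs of sequences is determined by the lengths of the lists and by countably
  many entries.  All of these can be recorded in a single sequence, because the values of the universe
  include the constant functions and thus a copy of the natural numbers.
\<close>

lemma ex_inj_sequences_of_lists:
  "\<exists>e :: (nat \<Rightarrow> (('x, 'k) universe \<times> ('x, 'k) universe) list) \<Rightarrow> ('x, 'k) universe. inj e"
proof -
  define num :: "nat \<Rightarrow> ('x \<Rightarrow> complex) + 'k" where "num n = Inl (\<lambda>x. of_nat n)" for n
  \<comment> \<open>At \<open>(i, l, b, r)\<close>: the length of the \<open>i\<close>-th list for \<open>b = 0\<close>, otherwise the \<open>r\<close>-th value of a
    component of its \<open>l\<close>-th entry.\<close>
  define e' :: "(nat \<Rightarrow> (('x, 'k) universe \<times> ('x, 'k) universe) list) \<Rightarrow>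
      nat \<times> nat \<times> nat \<times> nat \<Rightarrow> ('x \<Rightarrow> complex) + 'k" where
    "e' s = (\<lambda>(i, l, b, r). if b = 0 then num (length (s i))
       else if b = 1 then fst (s i ! l) r else snd (s i ! l) r)" for s
  have num: "num m = num n \<longleftrightarrow> m = n" for m n
    by (simp add: num_def fun_eq_iff)
  have "inj (\<lambda>s. e' s \<circ> from_nat)"
  proof (rule injI)
    fix s t assume "e' s \<circ> from_nat = e' t \<circ> from_nat"
    then have *: "(e' s \<circ> from_nat) (to_nat z) = (e' t \<circ> from_nat) (to_nat z)" for z
      by (rule fun_cong)
    have eq: "e' s z = e' t z" for z using *[of z] by simp
    show "s = t"
    proof
      fix i
      show "s i = t i"
      proof (rule nth_equalityI)
        show "length (s i) = length (t i)" using eq[of "(i, 0, 0, 0)"] by (simp add: e'_def num)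
        fix l assume "l < length (s i)"
        have "fst (s i ! l) = fst (t i ! l)"
        proof
          show "fst (s i ! l) r = fst (t i ! l) r" for r using eq[of "(i, l, 1, r)"] by (simp add: e'_def)
        qed
        moreover have "snd (s i ! l) = snd (t i ! l)"
        proof
          show "snd (s i ! l) r = snd (t i ! l) r" for r using eq[of "(i, l, 2, r)"] by (simp add: e'_def)
        qed
        ultimately show "s i ! l = t i ! l" by (rule prod_eqI)
      qed
    qed
  qed
  then show ?thesis by blast
qed

section \<open>Tensoring a morphism with an identity\<close>

lemma coded_module_tensor_completion:
  fixes A B :: "('x, ('x, 'k) universe) hmodule"
  assumes "hilbert_C0_module X A" "hilbert_C0_module X B"
  shows "coded_module TYPE(('x, 'k) universe) X (tensor_completion X A B)"
proof -
  interpret P: hilbert_C0_module_pair X A B by (intro hilbert_C0_module_pair.intro assms)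
  interpret H: hilbert_C0_module X "tensor_completion X A B"
    by (rule P.hilbert_C0_module_tensor_completion)
  obtain e :: "(nat \<Rightarrow> (('x, 'k) universe \<times> ('x, 'k) universe) list) \<Rightarrow> ('x, 'k) universe"
    where e: "inj e" using ex_inj_sequences_of_lists by blast
  have "inj_on (\<lambda>Q. e (P.T.rep Q)) (carrier (tensor_completion X A B))"
  proof (rule inj_onI)
    fix Q R assume "Q \<in> carrier (tensor_completion X A B)" "R \<in> carrier (tensor_completion X A B)"
      and "e (P.T.rep Q) = e (P.T.rep R)"
    then show "Q = R"
      unfolding P.tensor_completion_eq using P.T.cls_rep(2) injD[OF e] by metis
  qed
  from inj_on_code[OF this] show ?thesis by unfold_locales
qed

lemma hilbert_C0_module_hilb_tensor:
  fixes A B :: "('x, ('x, 'k) universe) hmodule"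
  assumes "hilbert_C0_module X A" "hilbert_C0_module X B"
  shows "hilbert_C0_module X (hilb_tensor X A B)"
  unfolding hilb_tensor_def
  by (rule coded_module.hilbert_C0_module_copy[OF coded_module_tensor_completion[OF assms]])

locale tensor_with_identity =
  fixes X :: "'x topology" and A A' B :: "('x, ('x, 'k) universe) hmodule"
    and f :: "('x, 'k) universe \<Rightarrow> ('x, 'k) universe"
  assumes A: "hilbert_C0_module X A" and A': "hilbert_C0_module X A'"
    and B: "hilbert_C0_module X B" and f: "f \<in> hilb_hom X A A'"
begin

sublocale A: hilbert_C0_module X A by (rule A)
sublocale A': hilbert_C0_module X A' by (rule A')
sublocale B: hilbert_C0_module X B by (rule B)

sublocale t: tensor_contraction X A A' B f "\<lambda>b \<in> carrier B. b"
  by (intro tensor_contraction.intro hilbert_C0_module_pair.intro tensor_contraction_axioms.intro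
      A A' B hilb_hom_imp_contraction[OF A A' f]) simp

sublocale S: coded_module X "tensor_completion X A B" "TYPE(('x, 'k) universe)"
  by (rule coded_module_tensor_completion[OF A B])

sublocale R: coded_module X "tensor_completion X A' B" "TYPE(('x, 'k) universe)"
  by (rule coded_module_tensor_completion[OF A' B])

abbreviation F :: "('x, 'k) universe \<Rightarrow> ('x, 'k) universe" where
  "F \<equiv> hilb_tensor_map X A A' B B f (\<lambda>b \<in> carrier B. b)"

lemma F_eq: "F = (\<lambda>u \<in> carrier (hilb_tensor X A B).
    code (tensor_completion X A' B) (t.T.extend (decode (tensor_completion X A B) u)))"
  by (simp add: hilb_tensor_map_def t.tensor_completion_map_eq)

lemma extend_closed:
  "P \<in> carrier (tensor_completion X A B) \<Longrightarrow> t.T.extend P \<in> carrier (tensor_completion X A' B)"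
  unfolding t.S.tensor_completion_eq t.R.tensor_completion_eq by (rule t.T.extend_closed)

lemma F_hom: "F \<in> hilb_hom X (hilb_tensor X A B) (hilb_tensor X A' B)"
  unfolding F_eq hilb_tensor_def
proof (rule hilb_hom_copy[OF S.coded_module_axioms R.coded_module_axioms])
  show "C0_linear X (tensor_completion X A B) (tensor_completion X A' B) t.T.extend"
    unfolding t.S.tensor_completion_eq t.R.tensor_completion_eq by (rule t.T.C0_linear_extend)
  show "Re (ip (tensor_completion X A' B) (t.T.extend P) (t.T.extend P) x)
      \<le> Re (ip (tensor_completion X A B) P P x)" if "P \<in> carrier (tensor_completion X A B)" for P x
    using that unfolding t.S.tensor_completion_eq t.R.tensor_completion_eq by (rule t.T.ip_extend_le)
qed (rule extend_closed)

lemma F_isometry: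
  assumes iso: "\<And>a a' x. a \<in> carrier A \<Longrightarrow> a' \<in> carrier A \<Longrightarrow> ip A' (f a) (f a') x = ip A a a' x"
    and u: "u \<in> carrier (hilb_tensor X A B)"
  shows "ip (hilb_tensor X A' B) (F u) (F u) x = ip (hilb_tensor X A B) u u x"
proof -
  let ?P = "decode (tensor_completion X A B) u"
  have P: "?P \<in> carrier (tensor_completion X A B)"
    using u unfolding hilb_tensor_def by (rule S.decode_closed)
  have "ip (hilb_tensor X A' B) (F u) (F u) = ip (tensor_completion X A' B) (t.T.extend ?P) (t.T.extend ?P)"
    using u P by (simp add: F_eq hilb_tensor_def R.copy_ip R.decode_code extend_closed)
  also have "\<dots> = ip (tensor_completion X A B) ?P ?P"
    using P unfolding t.S.tensor_completion_eq t.R.tensor_completion_eq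
    by (intro t.T.ip_extend_eq t.tsum_ip_map_eq iso)
  finally show ?thesis by (simp add: hilb_tensor_def S.copy_ip)
qed

text \<open>
  An element of the completion is a Cauchy sequence of finite sums, and these lift one by one.
\<close>

lemma F_surj:
  assumes iso: "\<And>a a' x. a \<in> carrier A \<Longrightarrow> a' \<in> carrier A \<Longrightarrow> ip A' (f a) (f a') x = ip A a a' x"
    and onto: "\<And>q. q \<in> tsums A' B \<Longrightarrow>
      \<exists>p \<in> tsums A B. t.R.T.gap (map (map_prod f (\<lambda>b \<in> carrier B. b)) p) q = 0"
  shows "F ` carrier (hilb_tensor X A B) = carrier (hilb_tensor X A' B)"
proof
  show "F ` carrier (hilb_tensor X A B) \<subseteq> carrier (hilb_tensor X A' B)"
    using F_hom by (auto simp: hilb_hom_def)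
  show "carrier (hilb_tensor X A' B) \<subseteq> F ` carrier (hilb_tensor X A B)"
  proof
    fix w assume w: "w \<in> carrier (hilb_tensor X A' B)"
    then have Q: "decode (tensor_completion X A' B) w \<in> carrier (tensor_completion X A' B)"
      unfolding hilb_tensor_def by (rule R.decode_closed)
    have "\<exists>P \<in> carrier t.S.T.completion. t.T.extend P = decode (tensor_completion X A' B) w"
    proof (rule t.T.extend_surj)
      show "decode (tensor_completion X A' B) w \<in> carrier t.R.T.completion"
        using Q unfolding t.R.tensor_completion_eq .
      show "tsum_ip A' B (map (map_prod f (\<lambda>b \<in> carrier B. b)) p)
          (map (map_prod f (\<lambda>b \<in> carrier B. b)) q) x = tsum_ip A B p q x"
        if "p \<in> tsums A B" "q \<in> tsums A B" for p q x
        by (rule t.tsum_ip_map_eq[OF iso that])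
    qed (rule onto)
    then obtain P where P: "P \<in> carrier (tensor_completion X A B)"
      and PQ: "t.T.extend P = decode (tensor_completion X A' B) w"
      unfolding t.S.tensor_completion_eq by blast
    have u: "code (tensor_completion X A B) P \<in> carrier (hilb_tensor X A B)"
      unfolding hilb_tensor_def by (rule S.code_closed[OF P])
    have "F (code (tensor_completion X A B) P) = w"
      using u P w by (simp add: F_eq S.decode_code PQ hilb_tensor_def R.code_decode)
    then show "w \<in> F ` carrier (hilb_tensor X A B)" using u by blast
  qed
qed

definition pure :: "('x, 'k) universe \<Rightarrow> ('x, 'k) universe \<Rightarrow> ('x, 'k) universe" where
  "pure a b = code (tensor_completion X A B) (t.S.T.embed [(a, b)])"

lemma pure:
  assumes a: "a \<in> carrier A" and b: "b \<in> carrier B"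
  shows "pure a b \<in> carrier (hilb_tensor X A B)"
    and "ip (hilb_tensor X A B) (pure a b) (pure a b) x = ip A a a x * ip B b b x"
    and "ip (hilb_tensor X A' B) (F (pure a b)) (F (pure a b)) x = ip A' (f a) (f a) x * ip B b b x"
proof -
  have ts: "[(a, b)] \<in> tsums A B" "[(f a, b)] \<in> tsums A' B"
    using a b by (simp_all add: tsums_def t.f.map_closed)
  have E: "t.S.T.embed [(a, b)] \<in> carrier (tensor_completion X A B)"
    unfolding t.S.tensor_completion_eq by (rule t.S.T.embed_closed[OF ts(1)])
  show pc: "pure a b \<in> carrier (hilb_tensor X A B)"
    unfolding pure_def hilb_tensor_def by (rule S.code_closed[OF E])
  have dec: "decode (tensor_completion X A B) (pure a b) = t.S.T.embed [(a, b)]"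
    unfolding pure_def by (rule S.decode_code[OF E])
  show "ip (hilb_tensor X A B) (pure a b) (pure a b) x = ip A a a x * ip B b b x"
  proof -
    have "ip (hilb_tensor X A B) (pure a b) (pure a b) x =
        ip (tensor_completion X A B) (t.S.T.embed [(a, b)]) (t.S.T.embed [(a, b)]) x"
      by (simp only: hilb_tensor_def S.copy_ip dec)
    also have "\<dots> = ip A a a x * ip B b b x"
      unfolding t.S.tensor_completion_eq t.S.T.ip_embed[OF ts(1) ts(1)] by (simp add: tsum_ip_def)
    finally show ?thesis .
  qed
  have "F (pure a b) = code (tensor_completion X A' B) (t.R.T.embed [(f a, b)])"
    using pc t.T.extend_embed[OF ts(1)] b by (simp add: F_eq dec)
  moreover have "t.R.T.embed [(f a, b)] \<in> carrier (tensor_completion X A' B)"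
    unfolding t.R.tensor_completion_eq by (rule t.R.T.embed_closed[OF ts(2)])
  ultimately have "ip (hilb_tensor X A' B) (F (pure a b)) (F (pure a b)) x =
      ip (tensor_completion X A' B) (t.R.T.embed [(f a, b)]) (t.R.T.embed [(f a, b)]) x"
    by (simp add: hilb_tensor_def R.copy_ip R.decode_code)
  also have "\<dots> = ip A' (f a) (f a) x * ip B b b x"
    unfolding t.R.tensor_completion_eq t.R.T.ip_embed[OF ts(2) ts(2)] by (simp add: tsum_ip_def)
  finally show "ip (hilb_tensor X A' B) (F (pure a b)) (F (pure a b)) x = ip A' (f a) (f a) x * ip B b b x" .
qed

end


section \<open>Closed ideals of continuous functions\<close>

lemma C0_openin_nonzero: "f \<in> C0 X \<Longrightarrow> openin X {x \<in> topspace X. f x \<noteq> 0}"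
  using openin_continuous_map_preimage[OF C0_continuous, of f X "- {0}"] by (simp add: open_Compl)

lemma C0_ideal_subset: "f \<in> C0_ideal X U \<Longrightarrow> f \<in> C0 X"
  by (simp add: C0_ideal_def)

lemma C0_ideal_outside: "f \<in> C0_ideal X U \<Longrightarrow> x \<notin> U \<Longrightarrow> f x = 0"
  by (cases "x \<in> topspace X") (auto simp: C0_ideal_def C0_outside)

lemma C0_idealI: "f \<in> C0 X \<Longrightarrow> (\<And>x. x \<notin> U \<Longrightarrow> f x = 0) \<Longrightarrow> f \<in> C0_ideal X U"
  by (simp add: C0_ideal_def)

text \<open>
  In both sets the functions are total and take the value 0 outside \<open>U\<close>, so restriction to \<open>U\<close> and
  extension by 0 are invisible.  The point is continuity of the extension outside \<open>U\<close>: the set where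
  the absolute value is at least \<open>e > 0\<close> is compact, hence closed in \<open>X\<close>.
\<close>

lemma C0_subtopology_eq_ideal:
  assumes "Hausdorff_space X" and U: "openin X U"
  shows "C0 (subtopology X U) = C0_ideal X U"
proof
  have top: "topspace (subtopology X U) = U"
    using openin_subset[OF U] by auto
  show "C0_ideal X U \<subseteq> C0 (subtopology X U)"
  proof
    fix f assume f: "f \<in> C0_ideal X U"
    have "{x \<in> U. e \<le> norm (f x)} = {x \<in> topspace X. e \<le> norm (f x)}" if "0 < e" for e
      using openin_subset[OF U] C0_ideal_outside[OF f] that by force
    then show "f \<in> C0 (subtopology X U)"
      using f C0_ideal_outside[OF f] unfolding C0_def C0_ideal_def top
      by (auto simp: compactin_subtopology continuous_map_from_subtopology)
  qed
  show "C0 (subtopology X U) \<subseteq> C0_ideal X U"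
  proof
    fix f assume f: "f \<in> C0 (subtopology X U)"
    have cont: "continuous_map (subtopology X U) euclidean f"
      and out: "\<And>x. x \<notin> U \<Longrightarrow> f x = 0"
      and comp: "\<And>e. 0 < e \<Longrightarrow> compactin (subtopology X U) {x \<in> U. e \<le> norm (f x)}"
      using f unfolding C0_def top by auto
    have "openin X {x \<in> topspace X. f x \<in> V}" if V: "open V" for V
    proof (cases "0 \<in> V")
      case False
      then have "{x \<in> topspace X. f x \<in> V} = {x \<in> U. f x \<in> V}"
        using out openin_subset[OF U] by force
      moreover have "openin (subtopology X U) {x \<in> topspace (subtopology X U). f x \<in> V}"
        using V by (intro openin_continuous_map_preimage[OF cont]) simp
      ultimately show ?thesis
        unfolding top using openin_trans_full[OF _ U] by metis
    next
      case True
      then obtain e where e: "0 < e" "ball 0 e \<subseteq> V" using V open_contains_ball by blast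
      have "closedin (subtopology X U) {x \<in> topspace (subtopology X U). f x \<in> - V}"
        using V by (intro closedin_continuous_map_preimage[OF cont]) (simp add: closed_def)
      then have "compactin (subtopology X U) {x \<in> U. f x \<in> - V}"
        using e unfolding top
        by (intro closed_compactin[OF comp[OF e(1)]]) (force simp: subset_eq not_less)+
      then have "closedin X {x \<in> U. f x \<in> - V}"
        using assms(1) by (simp add: compactin_subtopology compactin_imp_closedin)
      moreover have "{x \<in> topspace X. f x \<in> V} = topspace X - {x \<in> U. f x \<in> - V}"
        using out True openin_subset[OF U] by force
      ultimately show ?thesis by (simp add: openin_diff)
    qed
    then have "continuous_map X euclidean f" by (simp add: continuous_map_def)
    moreover have "compactin X {x \<in> topspace X. e \<le> norm (f x)}" if "0 < e" for e
    proof -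
      have "{x \<in> topspace X. e \<le> norm (f x)} = {x \<in> U. e \<le> norm (f x)}"
        using openin_subset[OF U] out that by force
      then show ?thesis using comp[OF that] by (simp add: compactin_subtopology)
    qed
    moreover have "f x = 0" if "x \<notin> topspace X" for x
      using out that openin_subset[OF U] by blast
    ultimately show "f \<in> C0_ideal X U"
      unfolding C0_ideal_def C0_def using out by auto
  qed
qed

lemma C0_divide_add_const:
  assumes f: "f \<in> C0 X" and g: "g \<in> C0 X" and d: "0 < d"
  shows "(\<lambda>x. f x / of_real (cmod (g x) + d)) \<in> C0 X"
proof -
  have "cmod z + d \<noteq> 0" for z using norm_ge_zero[of z] d by linarith
  then have "continuous_on UNIV (\<lambda>z. fst z / complex_of_real (cmod (snd z) + d))"
    by (intro continuous_intros) (simp del: of_real_add)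
  from C0_compose2[OF f g this] show ?thesis by simp
qed

text \<open>
  Let \<open>K\<close> be the compact set where \<open>\<bar>f\<bar> \<ge> e\<close>.  Finitely many members of \<open>J\<close> have no common zero on \<open>K\<close>, so
  the sum \<open>G\<close> of their squared absolute values belongs to \<open>J\<close> and is at least some \<open>m > 0\<close> on \<open>K\<close>.  For
  small \<open>d\<close> the function \<open>f G / (G + d)\<close> is in \<open>J\<close>; it differs from \<open>f\<close> by \<open>f d / (G + d)\<close>, which is
  small on \<open>K\<close> because \<open>G \<ge> m\<close>, and elsewhere because \<open>\<bar>f\<bar> < e\<close>.
\<close>

lemma C0_ideal_approximation:
  assumes sub: "J \<subseteq> C0 X" and zero: "(\<lambda>x. 0) \<in> J"
    and add: "\<And>f g. f \<in> J \<Longrightarrow> g \<in> J \<Longrightarrow> (\<lambda>x. f x + g x) \<in> J"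
    and mult: "\<And>f g. f \<in> C0 X \<Longrightarrow> g \<in> J \<Longrightarrow> (\<lambda>x. f x * g x) \<in> J"
    and f: "f \<in> C0_ideal X {x \<in> topspace X. \<exists>g \<in> J. g x \<noteq> 0}" and e: "0 < e"
  shows "\<exists>g \<in> J. \<forall>x. cmod (f x - g x) \<le> e"
proof -
  have fC: "f \<in> C0 X" using f by (rule C0_ideal_subset)
  define K where "K = {x \<in> topspace X. e \<le> norm (f x)}"
  have K: "compactin X K" using fC e by (simp add: C0_def K_def)
  define N where "N g = {x \<in> topspace X. g x \<noteq> 0}" for g :: "'a \<Rightarrow> complex"
  have "openin X W" if "W \<in> N ` J" for W
    using that sub unfolding N_def by (auto intro!: C0_openin_nonzero)
  moreover have "K \<subseteq> \<Union> (N ` J)"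
  proof
    fix x assume "x \<in> K"
    then have "f x \<noteq> 0" "x \<in> topspace X" using e by (auto simp: K_def)
    then show "x \<in> \<Union> (N ` J)" using C0_ideal_outside[OF f, of x] by (auto simp: N_def)
  qed
  ultimately obtain \<F> where \<F>: "finite \<F>" "\<F> \<subseteq> N ` J" "K \<subseteq> \<Union> \<F>"
    using K unfolding compactin_def by meson
  obtain F where F: "F \<subseteq> J" "finite F" "\<F> = N ` F"
    using finite_subset_image[OF \<F>(1,2)] by blast
  define G where "G x = (\<Sum>g\<in>F. cnj (g x) * g x)" for x
  have "(\<lambda>x. \<Sum>g\<in>F. cnj (g x) * g x) \<in> J"
    using F(2,1)
  proof (induction F rule: finite_induct)
    case (insert g F)
    then have "(\<lambda>x. cnj (g x) * g x) \<in> J" using sub by (intro mult C0_cnj) auto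
    then show ?case using insert by (simp add: add)
  qed (simp add: zero)
  then have GJ: "G \<in> J" by (simp add: G_def[abs_def])
  then have GC: "G \<in> C0 X" using sub by blast
  have G_eq: "G x = of_real (\<Sum>g\<in>F. (cmod (g x))\<^sup>2)" for x
    unfolding G_def of_real_sum complex_norm_square by (simp add: mult.commute)
  have G_norm: "cmod (G x) = (\<Sum>g\<in>F. (cmod (g x))\<^sup>2)" for x
    unfolding G_eq by (simp add: sum_nonneg del: of_real_sum of_real_power)
  have Gpos: "0 < cmod (G x)" if "x \<in> K" for x
  proof -
    have "x \<in> \<Union> (N ` F)" using \<F>(3) F(3) that by blast
    then obtain g where "g \<in> F" "g x \<noteq> 0" by (auto simp: N_def)
    then show ?thesis unfolding G_norm using F(2) by (intro sum_pos2[of F g]) auto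
  qed
  obtain m where m: "0 < m" "\<And>x. x \<in> K \<Longrightarrow> m \<le> cmod (G x)"
  proof (cases "K = {}")
    case False
    have "continuous_map X euclidean (\<lambda>x. cmod (G x))"
      using C0_continuous[OF GC] by (rule continuous_map_norm)
    from image_compactin[OF K this] have "compact ((\<lambda>x. cmod (G x)) ` K)" by simp
    then obtain x where "x \<in> K" "\<And>y. y \<in> K \<Longrightarrow> cmod (G x) \<le> cmod (G y)"
      using False compact_attains_inf[of "(\<lambda>x. cmod (G x)) ` K"] by auto
    then show ?thesis using that[of "cmod (G x)"] Gpos by blast
  qed (use that[of 1] in auto)
  obtain M where M: "0 \<le> M" "\<And>x. cmod (f x) \<le> M" using C0_bounded[OF fC] by blast
  define d where "d = e * m / (M + 1)"
  have d: "0 < d" using e m(1) M(1) by (simp add: d_def)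
  define h where "h x = f x / of_real (cmod (G x) + d) * G x" for x
  have "h \<in> J"
    unfolding h_def[abs_def] by (intro mult C0_divide_add_const fC GC d GJ)
  moreover have "cmod (f x - h x) \<le> e" for x
  proof -
    have pos: "0 < cmod (G x) + d" using d norm_ge_zero[of "G x"] by linarith
    have Gx: "G x = of_real (cmod (G x))" unfolding G_norm unfolding G_eq ..
    have "f x - h x = f x * of_real (d / (cmod (G x) + d))"
    proof -
      have "f x - h x = f x * (1 - of_real (cmod (G x)) / of_real (cmod (G x) + d))"
        unfolding h_def by (subst Gx) (simp add: algebra_simps)
      also have "1 - complex_of_real (cmod (G x)) / of_real (cmod (G x) + d) =
          of_real (1 - cmod (G x) / (cmod (G x) + d))"
        by (simp only: of_real_diff of_real_divide of_real_1)
      also have "1 - cmod (G x) / (cmod (G x) + d) = d / (cmod (G x) + d)"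
        using pos by (simp add: diff_divide_eq_iff)
      finally show ?thesis .
    qed
    then have eq: "cmod (f x - h x) = cmod (f x) * (d / (cmod (G x) + d))"
      using d pos by (simp add: norm_mult del: of_real_divide)
    show ?thesis
    proof (cases "x \<in> K")
      case True
      have "cmod (f x) * (d / (cmod (G x) + d)) \<le> M * (d / m)"
        using M m(1) m(2)[OF True] d by (intro mult_mono frac_le) auto
      also have "\<dots> = e * (M / (M + 1))" using m(1) M(1) by (simp add: d_def)
      also have "\<dots> \<le> e" using M(1) e by (simp add: divide_le_eq mult_left_le)
      finally show ?thesis by (simp add: eq)
    next
      case False
      then have "cmod (f x) \<le> e"
        using C0_outside[OF fC, of x] e by (cases "x \<in> topspace X") (auto simp: K_def)
      moreover have "cmod (f x) * (d / (cmod (G x) + d)) \<le> cmod (f x) * 1"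
        using d pos by (intro mult_left_mono) auto
      ultimately show ?thesis by (simp add: eq)
    qed
  qed
  ultimately show ?thesis by blast
qed

lemma continuous_on_divide_sqrt_norm: "continuous_on UNIV (\<lambda>z. z / complex_of_real (sqrt (cmod z)))"
  unfolding continuous_on_eq_continuous_at[OF open_UNIV]
proof
  fix w :: complex
  show "isCont (\<lambda>z. z / complex_of_real (sqrt (cmod z))) w"
  proof (cases "w = 0")
    case True
    have "((\<lambda>z::complex. sqrt (cmod z)) \<longlongrightarrow> sqrt (cmod 0)) (at 0)"
      by (intro tendsto_intros)
    then have lim: "((\<lambda>z::complex. sqrt (cmod z)) \<longlongrightarrow> 0) (at 0)" by simp
    have "((\<lambda>z. z / complex_of_real (sqrt (cmod z))) \<longlongrightarrow> 0) (at 0)"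
    proof (rule tendsto_norm_zero_cancel)
      show "((\<lambda>z. cmod (z / complex_of_real (sqrt (cmod z)))) \<longlongrightarrow> 0) (at 0)"
        using lim by (simp add: norm_divide real_div_sqrt)
    qed
    then show ?thesis by (simp add: True isCont_def)
  next
    case False
    then show ?thesis by (intro continuous_intros) auto
  qed
qed

text \<open>
  The factors are \<open>h / \<surd>\<bar>h\<bar>\<close>, which is 0 where \<open>h\<close> is 0, and \<open>\<surd>\<bar>h\<bar>\<close>.
\<close>

lemma C0_ideal_factorisation:
  assumes h: "h \<in> C0_ideal X U"
  shows "\<exists>f \<in> C0_ideal X U. \<exists>g \<in> C0_ideal X U. \<forall>x. f x * g x = h x"
proof (intro bexI allI)
  show "h x / complex_of_real (sqrt (cmod (h x))) * complex_of_real (sqrt (cmod (h x))) = h x" for x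
    by simp
  have hC: "h \<in> C0 X" using h by (rule C0_ideal_subset)
  have "continuous_on UNIV (\<lambda>z. complex_of_real (sqrt (cmod z)))" by (intro continuous_intros)
  from C0_compose[OF hC this] show "(\<lambda>x. complex_of_real (sqrt (cmod (h x)))) \<in> C0_ideal X U"
    by (intro C0_idealI) (simp_all add: C0_ideal_outside[OF h])
  from C0_compose[OF hC continuous_on_divide_sqrt_norm]
  show "(\<lambda>x. h x / complex_of_real (sqrt (cmod (h x)))) \<in> C0_ideal X U"
    by (intro C0_idealI) (simp_all add: C0_ideal_outside[OF h])
qed

section \<open>The tensor unit and its ideals\<close>

lemma C0_self_simps:
  "carrier (C0_self X) = C0 X" "\<zero>\<^bsub>C0_self X\<^esub> = (\<lambda>x. 0)"
  "f \<oplus>\<^bsub>C0_self X\<^esub> g = (\<lambda>x. f x + g x)" "h \<odot>\<^bsub>C0_self X\<^esub> f = (\<lambda>x. h x * f x)"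
  "cscale (C0_self X) z f = (\<lambda>x. z * f x)" "ip (C0_self X) f g = (\<lambda>x. cnj (f x) * g x)"
  by (simp_all add: C0_self_def)

lemma semi_inner_product_C0_self: "module_semi_inner_product X (C0_self X)"
  by standard (simp_all add: C0_self_simps C0_add C0_mult C0_cmult C0_zero C0_cnj algebra_simps)

lemma C0_self_gap:
  assumes "f \<in> C0 X" "g \<in> C0 X"
  shows "cmod (f x - g x) \<le> module_gap X (C0_self X) f g"
    and "0 \<le> c \<Longrightarrow> (\<And>x. cmod (f x - g x) \<le> c) \<Longrightarrow> module_gap X (C0_self X) f g \<le> c"
proof -
  interpret S: module_semi_inner_product X "C0_self X"
    by (rule semi_inner_product_C0_self)
  let ?d = "f \<oplus>\<^bsub>C0_self X\<^esub> cscale (C0_self X) (- 1) g"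
  have d: "?d \<in> carrier (C0_self X)"
    using assms by (intro S.closed_simps) (simp_all add: C0_self_simps)
  have form: "Re (ip (C0_self X) ?d ?d x) = (cmod (f x - g x))\<^sup>2" for x
    by (simp add: C0_self_simps cmod_power2) (simp add: power2_eq_square algebra_simps)
  show "cmod (f x - g x) \<le> S.gap f g"
    unfolding S.gap_def using S.len_upper[OF d, of x] S.len_nonneg[OF d]
    unfolding form by (rule power2_le_imp_le)
  show "S.gap f g \<le> c" if "0 \<le> c" "\<And>x. cmod (f x - g x) \<le> c"
    unfolding S.gap_def using that by (intro S.len_least) (simp_all only: form power_mono norm_ge_zero)
qed

lemma hilbert_C0_module_C0_self: "hilbert_C0_module X (C0_self X)"
proof (rule hilbert_C0_moduleI[OF semi_inner_product_C0_self])
  fix f g assume "f \<in> carrier (C0_self X)" "g \<in> carrier (C0_self X)"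
    "module_gap X (C0_self X) f g = 0"
  then show "f = g" using C0_self_gap(1)[of f X g] by (auto simp: C0_self_simps)
next
  fix s :: "nat \<Rightarrow> 'a \<Rightarrow> complex"
  assume s: "\<And>n. s n \<in> carrier (C0_self X)"
    and cauchy: "\<And>e. 0 < e \<Longrightarrow> \<exists>N. \<forall>m\<ge>N. \<forall>n\<ge>N. module_gap X (C0_self X) (s m) (s n) < e"
  have sC: "s n \<in> C0 X" for n using s by (simp add: C0_self_simps)
  have "uniformly_Cauchy_on UNIV s"
  proof (rule uniformly_Cauchy_onI)
    fix e :: real assume "0 < e"
    from cauchy[OF this] show "\<exists>N. \<forall>x\<in>UNIV. \<forall>m\<ge>N. \<forall>n\<ge>N. dist (s m x) (s n x) < e"
      unfolding dist_norm using order_le_less_trans[OF C0_self_gap(1)[OF sC sC]] by metis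
  qed
  then obtain g where g: "uniform_limit UNIV s g sequentially"
    using Cauchy_uniformly_convergent uniformly_convergent_on_def by blast
  have gC: "g \<in> C0 X" by (rule C0_uniform_limit[OF sC g])
  have "(\<lambda>n. module_gap X (C0_self X) (s n) g) \<longlonglongrightarrow> 0"
  proof (rule metric_LIMSEQ_I)
    fix e :: real assume e: "0 < e"
    then obtain N where N: "\<And>n x. n \<ge> N \<Longrightarrow> dist (s n x) (g x) < e / 2"
      using uniform_limitD[OF g, of "e / 2"] unfolding eventually_sequentially by auto
    have "dist (module_gap X (C0_self X) (s n) g) 0 < e" if "n \<ge> N" for n
    proof -
      have "module_gap X (C0_self X) (s n) g \<le> e / 2"
        using N[OF that] e by (intro C0_self_gap(2) sC gC) (simp_all add: dist_norm less_imp_le)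
      moreover have "0 \<le> module_gap X (C0_self X) (s n) g"
        using C0_self_gap(1)[OF sC gC] norm_ge_zero order_trans by blast
      ultimately show ?thesis using e by simp
    qed
    then show "\<exists>N. \<forall>n\<ge>N. dist (module_gap X (C0_self X) (s n) g) 0 < e" by blast
  qed
  then show "\<exists>g \<in> carrier (C0_self X). (\<lambda>n. module_gap X (C0_self X) (s n) g) \<longlonglongrightarrow> 0"
    using gC by (auto simp: C0_self_simps)
qed

lemma coded_module_C0_self: "coded_module TYPE(('x, 'k) universe) X (C0_self (X :: 'x topology))"
proof -
  interpret hilbert_C0_module X "C0_self X" by (rule hilbert_C0_module_C0_self)
  have "inj_on ((\<lambda>f n. Inl f) :: ('x \<Rightarrow> complex) \<Rightarrow> ('x, 'k) universe) (carrier (C0_self X))"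
    by (rule inj_onI) (simp add: fun_eq_iff)
  from inj_on_code[OF this] show ?thesis by unfold_locales
qed

lemma hilbert_C0_submodule:
  fixes A :: "('x, 'a) hmodule"
  assumes A: "hilbert_C0_module X A" and sub: "C \<subseteq> carrier A"
    and closed: "\<zero>\<^bsub>A\<^esub> \<in> C" "\<And>a b. a \<in> C \<Longrightarrow> b \<in> C \<Longrightarrow> a \<oplus>\<^bsub>A\<^esub> b \<in> C"
      "\<And>z a. a \<in> C \<Longrightarrow> cscale A z a \<in> C" "\<And>f a. f \<in> C0 X \<Longrightarrow> a \<in> C \<Longrightarrow> f \<odot>\<^bsub>A\<^esub> a \<in> C"
    and lim: "\<And>s a. (\<And>n. s n \<in> C) \<Longrightarrow> a \<in> carrier A \<Longrightarrow>
      (\<lambda>n. module_gap X A (s n) a) \<longlonglongrightarrow> 0 \<Longrightarrow> a \<in> C"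
  shows "hilbert_C0_module X (A\<lparr>carrier := C\<rparr>)"
proof -
  interpret A: hilbert_C0_module X A by (rule A)
  have inA: "a \<in> carrier A" if "a \<in> C" for a using sub that by blast
  have "module_semi_inner_product X (A\<lparr>carrier := C\<rparr>)"
  proof
    show "ip (A\<lparr>carrier := C\<rparr>) a b x = cnj (ip (A\<lparr>carrier := C\<rparr>) b a x)"
      if "a \<in> carrier (A\<lparr>carrier := C\<rparr>)" "b \<in> carrier (A\<lparr>carrier := C\<rparr>)" for a b x
      using that A.sip.form_commute[of a b x] by (simp add: inA)
  qed (simp_all add: closed inA A.ip_closed A.sip.form_simps A.sip.form_nonneg)
  then show ?thesis
  proof (rule hilbert_C0_moduleI)
    fix s :: "nat \<Rightarrow> 'a"
    assume s: "\<And>n. s n \<in> carrier (A\<lparr>carrier := C\<rparr>)" and cauchy: "\<And>e. 0 < e \<Longrightarrow>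
      \<exists>N. \<forall>m\<ge>N. \<forall>n\<ge>N. module_gap X (A\<lparr>carrier := C\<rparr>) (s m) (s n) < e"
    have sC: "s n \<in> C" for n using s by simp
    have "\<exists>a \<in> carrier A. (\<lambda>n. hnorm X A (s n \<ominus>\<^bsub>A\<^esub> a)) \<longlonglongrightarrow> 0"
      using cauchy by (intro A.complete) (simp_all add: inA sC A.hnorm_minus_eq_gap)
    then obtain a where a: "a \<in> carrier A" "(\<lambda>n. A.sip.gap (s n) a) \<longlonglongrightarrow> 0"
      by (auto simp: A.hnorm_minus_eq_gap inA sC)
    then show "\<exists>a \<in> carrier (A\<lparr>carrier := C\<rparr>).
        (\<lambda>n. module_gap X (A\<lparr>carrier := C\<rparr>) (s n) a) \<longlonglongrightarrow> 0"
      using lim[OF sC a] by auto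
  qed (use A.eq_of_gap inA in auto)
qed

text \<open>
  The dummy parameter fixes the type \<open>'k\<close>.  Elements of the tensor unit are codes of functions;
  \<open>fn\<close> decodes them and \<open>nf\<close> encodes a function.
\<close>

locale C0_unit =
  fixes X :: "'x topology" and universe :: "('x, 'k) universe itself"
begin

sublocale I: coded_module X "C0_self X" "TYPE(('x, 'k) universe)"
  by (rule coded_module_C0_self)

abbreviation unit :: "('x, ('x, 'k) universe) hmodule" where "unit \<equiv> hilb_unit X"

abbreviation ideal :: "'x set \<Rightarrow> ('x, ('x, 'k) universe) hmodule" where "ideal \<equiv> ideal_object X"

abbreviation fn :: "('x, 'k) universe \<Rightarrow> 'x \<Rightarrow> complex" where "fn \<equiv> decode (C0_self X)"

abbreviation nf :: "('x \<Rightarrow> complex) \<Rightarrow> ('x, 'k) universe" where "nf \<equiv> code (C0_self X)"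

lemma hilbert_unit: "hilbert_C0_module X unit"
  unfolding hilb_unit_def by (rule I.hilbert_C0_module_copy)

sublocale unit: hilbert_C0_module X unit by (rule hilbert_unit)

lemma fn_nf: "f \<in> C0 X \<Longrightarrow> fn (nf f) = f"
  by (rule I.decode_code) (simp add: C0_self_simps)

lemma nf_fn: "u \<in> carrier unit \<Longrightarrow> nf (fn u) = u"
  unfolding hilb_unit_def by (rule I.code_decode)

lemma fn_closed: "u \<in> carrier unit \<Longrightarrow> fn u \<in> C0 X"
  using I.decode_closed by (simp add: hilb_unit_def C0_self_simps)

lemma nf_closed: "f \<in> C0 X \<Longrightarrow> nf f \<in> carrier unit"
  unfolding hilb_unit_def by (rule I.code_closed) (simp add: C0_self_simps)

lemma unit_add: "u \<oplus>\<^bsub>unit\<^esub> v = nf (\<lambda>x. fn u x + fn v x)"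
  and unit_cscale: "cscale unit z u = nf (\<lambda>x. z * fn u x)"
  and unit_act: "f \<odot>\<^bsub>unit\<^esub> u = nf (\<lambda>x. f x * fn u x)"
  and unit_zero: "\<zero>\<^bsub>unit\<^esub> = nf (\<lambda>x. 0)"
  and unit_ip: "ip unit u v x = cnj (fn u x) * fn v x"
  by (simp_all add: hilb_unit_def I.copy_simps C0_self_simps)

lemma unit_gap:
  "u \<in> carrier unit \<Longrightarrow> v \<in> carrier unit \<Longrightarrow>
    unit.sip.gap u v = module_gap X (C0_self X) (fn u) (fn v)"
  unfolding hilb_unit_def by (rule I.gap_copy)

lemma ideal_simps:
  "carrier (ideal U) = nf ` C0_ideal X U" "ring.add (ideal U) = ring.add unit"
  "ring.zero (ideal U) = ring.zero unit" "cscale (ideal U) = cscale unit"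
  "smult (ideal U) = smult unit" "ip (ideal U) = ip unit"
  by (simp_all add: ideal_object_def)

lemma ideal_iff: "u \<in> carrier (ideal U) \<longleftrightarrow> u \<in> carrier unit \<and> fn u \<in> C0_ideal X U"
proof
  assume "u \<in> carrier (ideal U)"
  then obtain f where "f \<in> C0_ideal X U" "u = nf f" by (auto simp: ideal_simps)
  then show "u \<in> carrier unit \<and> fn u \<in> C0_ideal X U"
    using C0_ideal_subset[of f X U] by (simp add: fn_nf nf_closed)
next
  assume u: "u \<in> carrier unit \<and> fn u \<in> C0_ideal X U"
  then have "u = nf (fn u)" by (simp add: nf_fn)
  then show "u \<in> carrier (ideal U)" using u unfolding ideal_simps by blast
qed

lemma hilbert_ideal: "hilbert_C0_module X (ideal U)"
proof -
  have idl: "nf f \<in> nf ` C0_ideal X U" if "f \<in> C0 X" "\<And>x. x \<notin> U \<Longrightarrow> f x = 0" for f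
    using that C0_idealI by blast
  have D: "fn u \<in> C0 X \<and> (\<forall>x. x \<notin> U \<longrightarrow> fn u x = 0)" if "u \<in> nf ` C0_ideal X U" for u
    using that C0_ideal_subset C0_ideal_outside fn_nf by fastforce
  have "hilbert_C0_module X (unit\<lparr>carrier := nf ` C0_ideal X U\<rparr>)"
  proof (rule hilbert_C0_submodule[OF hilbert_unit])
    show "nf ` C0_ideal X U \<subseteq> carrier unit"
      using nf_closed C0_ideal_subset by blast
    show "\<zero>\<^bsub>unit\<^esub> \<in> nf ` C0_ideal X U" unfolding unit_zero by (rule idl) (simp_all add: C0_zero)
    show "u \<oplus>\<^bsub>unit\<^esub> v \<in> nf ` C0_ideal X U"
      if "u \<in> nf ` C0_ideal X U" "v \<in> nf ` C0_ideal X U" for u v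
      unfolding unit_add using D[OF that(1)] D[OF that(2)] by (intro idl C0_add) auto
    show "cscale unit z u \<in> nf ` C0_ideal X U" if "u \<in> nf ` C0_ideal X U" for z u
      unfolding unit_cscale using D[OF that] by (intro idl C0_cmult) auto
    show "f \<odot>\<^bsub>unit\<^esub> u \<in> nf ` C0_ideal X U" if "f \<in> C0 X" "u \<in> nf ` C0_ideal X U" for f u
      unfolding unit_act using D[OF that(2)] that(1) by (intro idl C0_mult) auto
    fix s u assume s: "\<And>n. s n \<in> nf ` C0_ideal X U" and u: "u \<in> carrier unit"
      and lim: "(\<lambda>n. unit.sip.gap (s n) u) \<longlonglongrightarrow> 0"
    have sU: "s n \<in> carrier unit" for n using s[of n] C0_ideal_subset nf_closed by fastforce
    have "fn u x = 0" if "x \<notin> U" for x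
    proof -
      have "cmod (fn u x) \<le> unit.sip.gap (s n) u" for n
        using C0_self_gap(1)[OF fn_closed fn_closed, OF sU u, of n x] D[OF s, of n] that
        by (simp add: unit_gap sU u)
      then have "cmod (fn u x) \<le> 0" by (intro LIMSEQ_le_const[OF lim]) auto
      then show ?thesis by simp
    qed
    then show "u \<in> nf ` C0_ideal X U"
      using idl[of "fn u"] fn_closed[OF u] nf_fn[OF u] by simp
  qed
  then show ?thesis by (simp add: ideal_object_def)
qed

lemma inclusion_apply: "u \<in> carrier (ideal U) \<Longrightarrow> ideal_inclusion X U u = u"
  by (simp add: ideal_inclusion_def)

lemma inclusion_hom: "ideal_inclusion X U \<in> hilb_hom X (ideal U) unit"
proof (rule hilb_homI[OF hilbert_ideal hilbert_unit])
  interpret J: hilbert_C0_module X "ideal U" by (rule hilbert_ideal)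
  show "ideal_inclusion X U u \<in> carrier unit" if "u \<in> carrier (ideal U)" for u
    using that by (simp add: inclusion_apply ideal_iff)
  show "C0_linear X (ideal U) unit (ideal_inclusion X U)"
    unfolding C0_linear_def
    using J.a_closed J.cscale_closed J.act_closed by (simp add: inclusion_apply) (simp add: ideal_simps)
qed (simp_all add: inclusion_apply ideal_simps(6), simp add: ideal_inclusion_def)

end


section \<open>Subunits\<close>

context C0_unit
begin

text \<open>
  Apply the isomorphism \<open>s \<otimes> id\<close> to \<open>a \<otimes> a\<close> and write \<open>p = \<bar>s(a)\<bar>\<^sup>2\<close>, \<open>q = \<langle>a | a\<rangle>\<close>.  Then \<open>p q = q\<^sup>2\<close> and
  \<open>0 \<le> p \<le> q\<close>, so \<open>p = q\<close>.
\<close>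

lemma subunit_isometry:
  assumes S: "represents_subunit (Hilb X :: ('x, 'k) hilb_category) S s" and a: "a \<in> carrier S"
  shows "Re (ip unit (s a) (s a) x) = Re (ip S a a x)"
proof -
  have HS: "hilbert_C0_module X S" and hom: "s \<in> hilb_hom X S unit"
    using S by (auto simp: represents_subunit_def mono_arr_def)
  interpret tensor_with_identity X S unit S s
    by (rule tensor_with_identity.intro[OF HS hilbert_unit HS hom])
  define p q where "p = Re (ip unit (s a) (s a) x)" and "q = Re (ip S a a x)"
  have "iso_arr (Hilb X) (hilb_tensor X S S) (hilb_tensor X unit S) F"
    using S by (simp add: represents_subunit_def)
  from iso_arr_preserves_ip[OF this pure(1)[OF a a], of x]
  have "Re (ip unit (s a) (s a) x * ip S a a x) = Re (ip S a a x * ip S a a x)"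
    by (simp only: pure(2,3)[OF a a])
  then have "p * q = q * q"
    using A.sip.form_self_Im[OF a, of x] by (simp add: p_def q_def)
  moreover have "p \<le> q" unfolding p_def q_def by (rule t.f.map_contract[OF a])
  moreover have "0 \<le> p"
    unfolding p_def by (intro unit.sip.form_nonneg t.f.map_closed a)
  ultimately have "p = q" by (cases "q = 0") auto
  then show ?thesis by (simp add: p_def q_def)
qed

lemma firm_Hilb: "firm (Hilb X :: ('x, 'k) hilb_category)"
  unfolding firm_def
proof (intro allI impI, elim conjE)
  fix S T :: "('x, ('x, 'k) universe) hmodule" and s t
  assume S: "represents_subunit (Hilb X) S s" and T: "represents_subunit (Hilb X) T t"
  have HS: "hilbert_C0_module X S" and hom: "s \<in> hilb_hom X S unit"
    and HT: "hilbert_C0_module X T"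
    using S T by (auto simp: represents_subunit_def mono_arr_def)
  interpret tensor_with_identity X S unit T s
    by (rule tensor_with_identity.intro[OF HS hilbert_unit HT hom])
  have "ip (hilb_tensor X unit T) (F u) (F u) x = ip (hilb_tensor X S T) u u x"
    if "u \<in> carrier (hilb_tensor X S T)" for u x
    using that by (intro F_isometry t.f.form_map_eq subunit_isometry[OF S])
  then have "inj_on F (carrier (hilb_tensor X S T))"
    by (intro inj_on_of_isometry[OF hilbert_C0_module_hilb_tensor[OF HS HT]
          hilbert_C0_module_hilb_tensor[OF hilbert_unit HT] F_hom]) simp
  then have "mono_arr (Hilb X) (hilb_tensor X S T) (hilb_tensor X unit T) F"
    by (intro mono_arr_of_inj hilbert_C0_module_hilb_tensor HS HT hilbert_unit F_hom)
  then show "mono_arr (Hilb X) (TensorOb (Hilb X) S T) (TensorOb (Hilb X) (Unit (Hilb X)) T)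
      (TensorArr (Hilb X) S (Unit (Hilb X)) T T s (Id (Hilb X) T))"
    by simp
qed

text \<open>
  The range is an ideal, so every function that vanishes off \<open>U\<close> is approximated by values of \<open>s\<close>.  As
  \<open>s\<close> is isometric, the arguments form a Cauchy sequence and converge in \<open>S\<close>.
\<close>

lemma isometry_range_is_ideal:
  assumes HS: "hilbert_C0_module X S" and hom: "s \<in> hilb_hom X S unit"
    and iso: "\<And>a x. a \<in> carrier S \<Longrightarrow> Re (ip unit (s a) (s a) x) = Re (ip S a a x)"
  defines "U \<equiv> {x \<in> topspace X. \<exists>a \<in> carrier S. fn (s a) x \<noteq> 0}"
  shows "openin X U" and "s ` carrier S = carrier (ideal U)"
proof -
  interpret S: hilbert_C0_module X S by (rule HS)
  interpret s: module_contraction X S unit s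
    by (rule hilb_hom_imp_contraction[OF HS hilbert_unit hom])
  have fs: "fn (s a) \<in> C0 X" if "a \<in> carrier S" for a
    by (intro fn_closed s.map_closed that)
  have "openin X (\<Union>a\<in>carrier S. {x \<in> topspace X. fn (s a) x \<noteq> 0})"
    using fs by (intro openin_Union) (auto intro!: C0_openin_nonzero)
  moreover have "(\<Union>a\<in>carrier S. {x \<in> topspace X. fn (s a) x \<noteq> 0}) = U"
    by (auto simp: U_def)
  ultimately show "openin X U" by simp
  define J where "J = (\<lambda>a. fn (s a)) ` carrier S"
  have U_J: "U = {x \<in> topspace X. \<exists>g \<in> J. g x \<noteq> 0}" by (simp add: U_def J_def)
  have JI: "g \<in> J" if "a \<in> carrier S" "fn (s a) = g" for a g
    unfolding J_def using that by blast
  have J_sub: "J \<subseteq> C0 X" using fs by (auto simp: J_def)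
  have J_zero: "(\<lambda>x. 0) \<in> J"
  proof -
    have "s (cscale S 0 \<zero>\<^bsub>S\<^esub>) = cscale unit 0 (s \<zero>\<^bsub>S\<^esub>)" by (intro s.map_scale) simp
    then have "fn (s (cscale S 0 \<zero>\<^bsub>S\<^esub>)) = (\<lambda>x. 0)"
      by (simp add: unit_cscale fn_nf C0_zero)
    then show ?thesis by (rule JI[OF S.cscale_closed[OF S.zero_closed]])
  qed
  have J_add: "(\<lambda>x. f x + g x) \<in> J" if fg: "f \<in> J" "g \<in> J" for f g
  proof -
    obtain a b where ab: "a \<in> carrier S" "b \<in> carrier S" "f = fn (s a)" "g = fn (s b)"
      using fg by (auto simp: J_def)
    then have "fn (s (a \<oplus>\<^bsub>S\<^esub> b)) = (\<lambda>x. f x + g x)"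
      by (simp add: s.map_add unit_add fn_nf C0_add fs)
    then show ?thesis by (rule JI[OF S.a_closed[OF ab(1,2)]])
  qed
  have J_mult: "(\<lambda>x. f x * g x) \<in> J" if f: "f \<in> C0 X" and g: "g \<in> J" for f g
  proof -
    obtain a where a: "a \<in> carrier S" "g = fn (s a)" using g by (auto simp: J_def)
    then have "fn (s (f \<odot>\<^bsub>S\<^esub> a)) = (\<lambda>x. f x * g x)"
      using f by (simp add: s.map_act unit_act fn_nf C0_mult fs)
    then show ?thesis by (rule JI[OF S.act_closed[OF f a(1)]])
  qed
  show "s ` carrier S = carrier (ideal U)"
  proof (intro equalityI subsetI)
    fix u assume "u \<in> s ` carrier S"
    then obtain a where a: "a \<in> carrier S" "u = s a" by blast
    have "fn (s a) \<in> C0_ideal X U"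
      using a fs by (auto simp: C0_ideal_def U_def)
    then show "u \<in> carrier (ideal U)" using a s.map_closed by (simp add: ideal_iff)
  next
    fix u assume "u \<in> carrier (ideal U)"
    then have u: "u \<in> carrier unit" and fu: "fn u \<in> C0_ideal X U" by (simp_all add: ideal_iff)
    have "\<exists>a \<in> carrier S. unit.sip.gap u (s a) \<le> 1 / (real n + 1)" for n
    proof -
      have "\<exists>g \<in> J. \<forall>x. cmod (fn u x - g x) \<le> 1 / (real n + 1)"
        using fu unfolding U_J
        by (intro C0_ideal_approximation[OF J_sub J_zero J_add J_mult]) auto
      then obtain a where a: "a \<in> carrier S" "\<And>x. cmod (fn u x - fn (s a) x) \<le> 1 / (real n + 1)"
        by (auto simp: J_def)
      then have "unit.sip.gap u (s a) \<le> 1 / (real n + 1)"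
        unfolding unit_gap[OF u s.map_closed[OF a(1)]]
        by (intro C0_self_gap(2) fn_closed u s.map_closed) auto
      then show ?thesis using a(1) by blast
    qed
    then obtain a where a: "\<And>n. a n \<in> carrier S"
      and near: "\<And>n. unit.sip.gap u (s (a n)) \<le> 1 / (real n + 1)" by metis
    note sa = s.map_closed[OF a]
    have inv0: "(\<lambda>n. 1 / (real n + 1)) \<longlonglongrightarrow> 0"
      using LIMSEQ_inverse_real_of_nat by (simp add: inverse_eq_divide add.commute)
    have gap_le: "S.sip.gap (a m) (a n) \<le> 1 / (real m + 1) + 1 / (real n + 1)" for m n
    proof -
      have "S.sip.gap (a m) (a n) = unit.sip.gap (s (a m)) (s (a n))"
        by (intro s.gap_map_eq[symmetric] iso a)
      also have "\<dots> \<le> unit.sip.gap (s (a m)) u + unit.sip.gap u (s (a n))"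
        by (intro unit.sip.gap_triangle sa u)
      also have "unit.sip.gap (s (a m)) u = unit.sip.gap u (s (a m))"
        by (intro unit.sip.gap_commute sa u)
      finally show ?thesis using near[of m] near[of n] by linarith
    qed
    have "\<exists>b \<in> carrier S. (\<lambda>n. hnorm X S (a n \<ominus>\<^bsub>S\<^esub> b)) \<longlonglongrightarrow> 0"
    proof (intro S.complete allI impI a)
      fix e :: real assume "0 < e"
      then have "eventually (\<lambda>n. 1 / (real n + 1) < e / 2) sequentially"
        using inv0 by (intro order_tendstoD) auto
      then obtain N where N: "\<And>n. n \<ge> N \<Longrightarrow> 1 / (real n + 1) < e / 2"
        unfolding eventually_sequentially by blast
      have "hnorm X S (a m \<ominus>\<^bsub>S\<^esub> a n) < e" if "m \<ge> N" "n \<ge> N" for m n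
        using gap_le[of m n] N[OF that(1)] N[OF that(2)] by (simp add: S.hnorm_minus_eq_gap a)
      then show "\<exists>N. \<forall>m\<ge>N. \<forall>n\<ge>N. hnorm X S (a m \<ominus>\<^bsub>S\<^esub> a n) < e" by blast
    qed
    then obtain b where b: "b \<in> carrier S" and lim: "(\<lambda>n. S.sip.gap (a n) b) \<longlonglongrightarrow> 0"
      by (auto simp: S.hnorm_minus_eq_gap a)
    have "unit.sip.gap u (s b) \<le> 1 / (real n + 1) + S.sip.gap (a n) b" for n
    proof -
      have "unit.sip.gap u (s b) \<le> unit.sip.gap u (s (a n)) + unit.sip.gap (s (a n)) (s b)"
        by (intro unit.sip.gap_triangle sa u s.map_closed b)
      also have "unit.sip.gap (s (a n)) (s b) = S.sip.gap (a n) b"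
        by (intro s.gap_map_eq iso a b)
      finally show ?thesis using near[of n] by linarith
    qed
    moreover have "(\<lambda>n. 1 / (real n + 1) + S.sip.gap (a n) b) \<longlonglongrightarrow> 0"
      using tendsto_add[OF inv0 lim] by simp
    ultimately have "unit.sip.gap u (s b) \<le> 0"
      by (intro LIMSEQ_le_const[where X = "\<lambda>n. 1 / (real n + 1) + S.sip.gap (a n) b"]) auto
    then have "u = s b" by (intro unit.eq_of_gap u s.map_closed b)
    then show "u \<in> s ` carrier S" using b by blast
  qed
qed

text \<open>
  As a map into the ideal of its range, \<open>s\<close> is a bijective isometry and hence an isomorphism; so \<open>s\<close>
  and the inclusion factor through each other.
\<close>

lemma subunit_class_is_ideal_class:
  assumes S: "represents_subunit (Hilb X :: ('x, 'k) hilb_category) S s"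
  shows "\<exists>U. openin X U \<and> subobject_class (Hilb X :: ('x, 'k) hilb_category) unit S s =
    subobject_class (Hilb X) unit (ideal U) (ideal_inclusion X U)"
proof -
  have HS: "hilbert_C0_module X S" and hom: "s \<in> hilb_hom X S unit"
    using S by (auto simp: represents_subunit_def mono_arr_def)
  note iso = subunit_isometry[OF S]
  define U where "U = {x \<in> topspace X. \<exists>a \<in> carrier S. fn (s a) x \<noteq> 0}"
  have U: "openin X U" and image: "s ` carrier S = carrier (ideal U)"
    unfolding U_def by (rule isometry_range_is_ideal[OF HS hom iso]; assumption)+
  note H = hom[unfolded hilb_hom_iff[OF HS hilbert_unit]]
  have s_ideal: "s \<in> hilb_hom X S (ideal U)"
  proof (rule hilb_homI[OF HS hilbert_ideal])
    show "s a \<in> carrier (ideal U)" if "a \<in> carrier S" for a using image that by blast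
    show "C0_linear X S (ideal U) s" using H by (simp add: C0_linear_def ideal_simps)
    show "Re (ip (ideal U) (s a) (s a) x) \<le> Re (ip S a a x)" if "a \<in> carrier S" for a x
      using H that by (simp add: ideal_simps)
  qed (use H in \<open>simp add: PiE_def\<close>)
  have "iso_arr (Hilb X :: ('x, 'k) hilb_category) S (ideal U) s"
    by (rule iso_arr_of_isometry[OF HS hilbert_ideal s_ideal _ image]) (simp add: ideal_simps iso)
  then obtain k where k: "k \<in> hilb_hom X (ideal U) S"
    and sk: "compose (carrier (ideal U)) s k = (\<lambda>u \<in> carrier (ideal U). u)"
    by (auto simp: iso_arr_def)
  have "s = compose (carrier S) (ideal_inclusion X U) s"
  proof (rule ext)
    show "s a = compose (carrier S) (ideal_inclusion X U) s a" for a
    proof (cases "a \<in> carrier S")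
      case True
      then have "s a \<in> carrier (ideal U)" using image by blast
      then show ?thesis using True by (simp add: compose_def inclusion_apply)
    next
      case False
      then show ?thesis using H by (simp add: compose_def PiE_def extensional_def)
    qed
  qed
  then have "factors_through (Hilb X :: ('x, 'k) hilb_category) unit S s (ideal U) (ideal_inclusion X U)"
    using s_ideal by (auto simp: factors_through_def)
  moreover have "factors_through (Hilb X :: ('x, 'k) hilb_category) unit (ideal U) (ideal_inclusion X U) S s"
    using k by (auto simp: factors_through_def ideal_inclusion_def sk intro!: bexI[of _ k])
  ultimately show ?thesis
    using U subobject_class_eqI[OF HS hilbert_ideal] by blast
qed

text \<open>
  The inner product of two sums in \<open>C\<^sub>0(X) \<otimes> J\<close> depends only on their images \<open>\<mu>\<close> under multiplication.
  As \<open>\<mu> q\<close> factors into two functions of the ideal, every sum \<open>q\<close> agrees, up to distance 0, with an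
  elementary tensor from \<open>J \<otimes> J\<close>.
\<close>

lemma ideal_represents_subunit:
  "represents_subunit (Hilb X :: ('x, 'k) hilb_category) (ideal U) (ideal_inclusion X U)"
proof -
  let ?i = "ideal_inclusion X U :: ('x, 'k) universe \<Rightarrow> ('x, 'k) universe"
  interpret tensor_with_identity X "ideal U" unit "ideal U" ?i
    by (rule tensor_with_identity.intro[OF hilbert_ideal hilbert_unit hilbert_ideal inclusion_hom])
  have iso: "ip unit (?i u) (?i v) x = ip (ideal U) u v x"
    if "u \<in> carrier (ideal U)" "v \<in> carrier (ideal U)" for u v x
    using that by (simp add: inclusion_apply ideal_simps)
  have "inj_on ?i (carrier (ideal U))"
    by (rule inj_onI) (simp add: inclusion_apply)
  then have mono: "mono_arr (Hilb X) (ideal U) unit ?i"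
    by (intro mono_arr_of_inj hilbert_ideal hilbert_unit inclusion_hom)
  define \<mu> where "\<mu> q x = (\<Sum>(a, b)\<leftarrow>q. fn a x * fn b x)"
    for q :: "(('x, 'k) universe \<times> ('x, 'k) universe) list" and x
  have form: "tsum_ip unit (ideal U) p q x = cnj (\<mu> p x) * \<mu> q x" for p q x
    by (induction p)
      (auto simp: tsum_ip_def \<mu>_def ideal_simps unit_ip case_prod_unfold sum_list_const_mult
        algebra_simps)
  have "\<exists>p \<in> tsums (ideal U) (ideal U).
      t.R.T.gap (map (map_prod ?i (\<lambda>b \<in> carrier (ideal U). b)) p) q = 0"
    if q: "q \<in> tsums unit (ideal U)" for q
  proof -
    have "\<mu> q \<in> C0_ideal X U"
    proof (rule C0_idealI)
      have "(\<lambda>x. \<Sum>z\<leftarrow>q. fn (fst z) x * fn (snd z) x) \<in> C0 X"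
        using tsumsD[OF q] by (intro C0_sum_list C0_mult fn_closed) (auto simp: ideal_iff)
      then show "\<mu> q \<in> C0 X" by (simp add: \<mu>_def[abs_def] case_prod_unfold)
      fix x assume "x \<notin> U"
      then have "fn (fst z) x * fn (snd z) x = 0" if "z \<in> set q" for z
        using tsumsD[OF q that] C0_ideal_outside[of "fn (snd z)" X U x] by (simp add: ideal_iff)
      then have "map (\<lambda>z. fn (fst z) x * fn (snd z) x) q = map (\<lambda>z. 0) q" by simp
      then show "\<mu> q x = 0" by (simp only: \<mu>_def case_prod_unfold) simp
    qed
    then obtain f g where f: "f \<in> C0_ideal X U" and g: "g \<in> C0_ideal X U"
      and fg: "\<And>x. f x * g x = \<mu> q x"
      using C0_ideal_factorisation by blast
    let ?p = "[(nf f, nf g)]"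
    have mem: "nf f \<in> carrier (ideal U)" "nf g \<in> carrier (ideal U)"
      using f g by (simp_all add: ideal_simps)
    have p: "?p \<in> tsums (ideal U) (ideal U)" using mem by (simp add: tsums_def)
    have map_p: "map (map_prod ?i (\<lambda>b \<in> carrier (ideal U). b)) ?p = ?p"
      using mem by (simp add: inclusion_apply)
    have "\<mu> ?p x = \<mu> q x" for x
      using f g by (simp add: \<mu>_def fn_nf C0_ideal_subset fg)
    then have "t.R.T.gap ?p q = 0"
      using q mem by (intro t.R.T.gap_eq_0I) (simp_all add: form tsums_def ideal_iff)
    then show ?thesis using p map_p by metis
  qed
  from F_surj[OF iso this]
  have surj: "F ` carrier (hilb_tensor X (ideal U) (ideal U)) = carrier (hilb_tensor X unit (ideal U))" .
  have "iso_arr (Hilb X) (hilb_tensor X (ideal U) (ideal U)) (hilb_tensor X unit (ideal U)) F"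
    by (rule iso_arr_of_isometry[OF hilbert_C0_module_hilb_tensor[OF hilbert_ideal hilbert_ideal]
          hilbert_C0_module_hilb_tensor[OF hilbert_unit hilbert_ideal] F_hom _ surj])
      (simp only: F_isometry[OF iso])
  with mono show ?thesis by (simp add: represents_subunit_def)
qed

lemma subunits_Hilb:
  "subunits (Hilb X :: ('x, 'k) hilb_category) =
    {subobject_class (Hilb X) unit (ideal U) (ideal_inclusion X U) | U. openin X U}"
proof (intro equalityI subsetI)
  fix c assume "c \<in> subunits (Hilb X :: ('x, 'k) hilb_category)"
  then obtain S s where "represents_subunit (Hilb X :: ('x, 'k) hilb_category) S s"
    and c: "c = subobject_class (Hilb X) unit S s"
    by (auto simp: subunits_def)
  from subunit_class_is_ideal_class[OF this(1)]
  show "c \<in> {subobject_class (Hilb X) unit (ideal U) (ideal_inclusion X U) | U. openin X U}"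
    unfolding c by blast
next
  fix c assume "c \<in> {subobject_class (Hilb X :: ('x, 'k) hilb_category) unit (ideal U)
    (ideal_inclusion X U) | U. openin X U}"
  then show "c \<in> subunits (Hilb X :: ('x, 'k) hilb_category)"
    using ideal_represents_subunit by (auto simp: subunits_def)
qed

end

theorem proposition3p16:
  fixes X :: "'x topology"
  assumes "locally_compact_space X" and "Hausdorff_space X"
  shows "firm (Hilb X :: ('x, 'k) hilb_category) \<and>
    subunits (Hilb X :: ('x, 'k) hilb_category) =
      {subobject_class (Hilb X) (Unit (Hilb X)) (ideal_object X U) (ideal_inclusion X U) | U.
        openin X U} \<and>
    (\<forall>U. openin X U \<longrightarrow>
      star_isomorphism (C0_ideal X U) (C0 (subtopology X U)) (\<lambda>f x. if x \<in> U then f x else 0))"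
proof (intro conjI allI impI)
  interpret C0_unit X "TYPE(('x, 'k) universe)" .
  show "firm (Hilb X :: ('x, 'k) hilb_category)" by (rule firm_Hilb)
  show "subunits (Hilb X :: ('x, 'k) hilb_category) =
      {subobject_class (Hilb X) (Unit (Hilb X)) (ideal_object X U) (ideal_inclusion X U) | U.
        openin X U}"
    unfolding Hilb_simps by (rule subunits_Hilb)
  fix U assume "openin X U"
  then have eq: "C0 (subtopology X U) = C0_ideal X U"
    by (rule C0_subtopology_eq_ideal[OF assms(2)])
  have id: "(\<lambda>x. if x \<in> U then f x else 0) = f" if "f \<in> C0_ideal X U" for f
    using C0_ideal_outside[OF that] by auto
  have "bij_betw (\<lambda>f x. if x \<in> U then f x else 0) (C0_ideal X U) (C0_ideal X U)"
    using bij_betw_id by (rule bij_betw_cong[THEN iffD1, rotated]) (simp add: id)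
  then show "star_isomorphism (C0_ideal X U) (C0 (subtopology X U)) (\<lambda>f x. if x \<in> U then f x else 0)"
    unfolding star_isomorphism_def eq by (auto simp: fun_eq_iff)
qed

end
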